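(* Let $d\ge1$ and let $\Phi$ be a stationary Poisson hyperplane process in $\mathbb{R}^d$ with intensity $\lambda>0$ and nondegenerate spherical orientation distribution $\Theta$, i.e. $\Theta(L\cap S_+^{d-1})<1$ for every $(d-1)$-dimensional linear subspace $L$ of $\mathbb{R}^d$. With $\Psi_k(B_r^d)$, $\zeta_k(B_r^d)$, $\sigma_{\chi,k}^{(1,d-k)}$ and $\sigma_{\nu,k}^{(1,d-k)}$ as defined in the context, for each $k=0,1,\ldots,d-1$, $$Z_{k,r}^{(d)}(\chi):=\frac{(d-k-1)!}{(2\lambda r)^{d-k-1/2}}\big(\Psi_k(B_r^d)-\mathbb{E}\Psi_k(B_r^d)\big)\xrightarrow[r\to\infty]{\mathrm{d}}\mathcal{N}(0,\sigma_{\chi,k}^{(1,d-k)})$$ and $$Z_{k,r}^{(d)}(\nu):=\frac{(d-k-1)!\,r^{-k}}{(2\lambda r)^{d-k-1/2}}\big(\zeta_k(B_r^d)-\mathbb{E}\zeta_k(B_r^d)\big)\xrightarrow[r\to\infty]{\mathrm{d}}\mathcal{N}(0,\sigma_{\nu,k}^{(1,d-k)}),$$ where $\xrightarrow{\mathrm{d}}$ denotes convergence in distribution and $\mathcal{N}(0,\sigma^2)$ is a Gaussian random variable with mean $0$ and variance $\sigma^2$.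
   Context: Notation. $B_r^d=\{x\in\mathbb{R}^d:\|x\|\le r\}$; $S_+^{d-1}=\{x\in\mathbb{R}^d:\|x\|=1,\ x_d\ge 0\}$; $H(p,v)=\{x\in\mathbb{R}^d:\langle x,v\rangle=p\}$ for $p\in\mathbb{R}$, $v\in S_+^{d-1}$, and $H(x)=H(p,v)$ for $x=(p,v)$; $\chi(K)=1$ if $K\ne\varnothing$, $\chi(\varnothing)=0$; $\nu_k$ is $k$-dimensional volume (Hausdorff measure) in $\mathbb{R}^d$, with $\nu_0$ the counting measure. Poisson hyperplane process. $\Phi$ is the random collection of hyperplanes $H(P_i,V_i)$, $i\ge1$, where $\Psi=\sum_{i\ge1}\delta_{(P_i,V_i)}$ is a Poisson process on $\mathbb{R}\times S_+^{d-1}$ with intensity measure $\lambda\,dp\,\Theta(dv)$. For $k\in\{0,\dots,d-1\}$ and $r>0$ define $$\Psi_k(B_r^d)=\frac1{(d-k)!}\sum^{*}\chi\Big(\bigcap_{j=1}^{d-k}H(P_{i_j},V_{i_j})\cap B_r^d\Big),\qquad \zeta_k(B_r^d)=\frac1{(d-k)!}\sum^{*}\nu_k\Big(\bigcap_{j=1}^{d-k}H(P_{i_j},V_{i_j})\cap B_r^d\Big),$$ the sums running over all tuples of pairwise distinct indices $i_1,\dots,i_{d-k}$. These are the number of $k$-flats (intersections of $d-k$ distinct hyperplanes of $\Phi$) hitting $B_r^d$ and their total $k$-volume in $B_r^d$. Auxiliary variables. For given $r>0$, $X_1,X_2,\ldots$ are i.i.d. random elements $X_i=(P_i,V_i)$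 of $[-r,r]\times S_+^{d-1}$ with independent components, $P_i$ uniform on $[-r,r]$, $V_i\sim\Theta$. Put $$\sigma_{\chi,k}^{(1,d-k)}=\mathbb{E}\Big(\chi\Big(\bigcap_{i=1}^{d-k}H(X_i)\cap B_r^d\Big)\chi\Big(\bigcap_{i=d-k}^{2d-2k-1}H(X_i)\cap B_r^d\Big)\Big),$$ $$\sigma_{\nu,k}^{(1,d-k)}=r^{-2k}\,\mathbb{E}\Big(\nu_k\Big(\bigcap_{i=1}^{d-k}H(X_i)\cap B_r^d\Big)\nu_k\Big(\bigcap_{i=d-k}^{2d-2k-1}H(X_i)\cap B_r^d\Big)\Big).$$ These quantities do not depend on $r>0$. *)

theory Defs
  imports "HOL-Probability.Probability"
begin

(* The ambient space R^d is real ^ 'n with d = CARD('n); the order on 'n singles out the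
   last coordinate x_d. *)

definition half_sphere :: "(real ^ 'n::{finite,linorder}) set"
  where "half_sphere = {x. norm x = 1 \<and> x $ Max UNIV \<ge> 0}"

definition hyperplane :: "real \<times> (real ^ 'n) \<Rightarrow> (real ^ 'n) set"
  where "hyperplane = (\<lambda>(p, v). {x. x \<bullet> v = p})"

definition chi :: "'a set \<Rightarrow> ennreal"
  where "chi K = (if K = {} then 0 else 1)"

(* Counting measure for k = 0, otherwise the k-dimensional Hausdorff (outer) measure.  The
   factor unit_ball_vol k * (diam / 2) ^ k, the volume of a k-ball of the given diameter, is
   the normalisation under which it extends k-dimensional volume.  Covering sets are
   required to be bounded because the library's diameter of an unbounded set is unspecified;
   as k > 0, empty covering sets contribute nothing. *)
definition nu :: "nat \<Rightarrow> 'a::metric_space set \<Rightarrow> ennreal"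
  where "nu k A =
    (if k = 0 then emeasure (count_space UNIV) A
     else SUP \<delta>\<in>{0<..}. INF U\<in>{U :: nat \<Rightarrow> 'a set.
            A \<subseteq> (\<Union>i. U i) \<and> (\<forall>i. bounded (U i) \<and> diameter (U i) \<le> \<delta>)}.
            (\<Sum>i. ennreal (unit_ball_vol (real k) * (diameter (U i) / 2) ^ k)))"

definition spherical_distribution :: "(real ^ 'n::{finite,linorder}) measure \<Rightarrow> bool"
  where "spherical_distribution \<Theta> \<longleftrightarrow>
    prob_space \<Theta> \<and> space \<Theta> = half_sphere \<and> sets \<Theta> = sets (restrict_space borel half_sphere)"

definition nondegenerate :: "(real ^ 'n::{finite,linorder}) measure \<Rightarrow> bool"
  where "nondegenerate \<Theta> \<longleftrightarrow>
    (\<forall>L. subspace L \<and> dim L = CARD('n) - 1 \<longrightarrow> measure \<Theta> (L \<inter> half_sphere) < 1)"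

(* The point process \<Sum>i. \<delta>_(X i) evaluated at A. *)
definition point_count :: "(nat \<Rightarrow> 'w \<Rightarrow> 'a) \<Rightarrow> 'a set \<Rightarrow> 'w \<Rightarrow> ennreal"
  where "point_count X A \<omega> = (\<Sum>i. indicator A (X i \<omega>))"

(* The points are enumerated by all of nat, so this is meant for intensity measures of
   infinite total mass, which almost surely produce infinitely many points. *)
definition poisson_process :: "'w measure \<Rightarrow> (nat \<Rightarrow> 'w \<Rightarrow> 'a) \<Rightarrow> 'a measure \<Rightarrow> bool"
  where "poisson_process M X \<mu> \<longleftrightarrow>
    prob_space M \<and> (\<forall>i. X i \<in> measurable M \<mu>) \<and>
    (\<forall>A\<in>sets \<mu>. emeasure \<mu> A < \<infinity> \<longrightarrow>
      (\<forall>n. measure M {\<omega>\<in>space M. point_count X A \<omega> = of_nat n} =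
            measure \<mu> A ^ n / fact n * exp (- measure \<mu> A))) \<and>
    (\<forall>A\<in>sets \<mu>. emeasure \<mu> A = \<infinity> \<longrightarrow> (AE \<omega> in M. point_count X A \<omega> = \<infinity>)) \<and>
    (\<forall>A :: nat \<Rightarrow> 'a set. range A \<subseteq> sets \<mu> \<and> disjoint_family A \<longrightarrow>
      prob_space.indep_vars M (\<lambda>_. borel) (\<lambda>j. point_count X (A j)) UNIV)"

(* The intensity is called \<gamma>, since \<lambda> is the abstraction symbol. *)
definition poisson_hyperplane_process ::
    "'w measure \<Rightarrow> (nat \<Rightarrow> 'w \<Rightarrow> real \<times> (real ^ 'n::{finite,linorder})) \<Rightarrow> real \<Rightarrow>
     (real ^ 'n::{finite,linorder}) measure \<Rightarrow> bool"
  where "poisson_hyperplane_process M X \<gamma> \<Theta> \<longleftrightarrow>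
    poisson_process M X (scale_measure (ennreal \<gamma>) (lborel \<Otimes>\<^sub>M \<Theta>))"

definition index_tuples :: "nat \<Rightarrow> nat list set"
  where "index_tuples m = {js. length js = m \<and> distinct js}"

(* The sums are formed in ennreal, where they always exist, and then read as real numbers;
   the value infinity, which is sent to 0, occurs with probability 0 only. *)
definition Psi :: "nat \<Rightarrow> (nat \<Rightarrow> 'w \<Rightarrow> real \<times> (real ^ 'n)) \<Rightarrow> real \<Rightarrow> 'w \<Rightarrow> real"
  where "Psi k X r \<omega> = 1 / fact (CARD('n) - k) *
    enn2real (\<Sum>\<^sub>\<infinity>js\<in>index_tuples (CARD('n) - k).
      chi ((\<Inter>j\<in>set js. hyperplane (X j \<omega>)) \<inter> cball 0 r))"

definition zeta :: "nat \<Rightarrow> (nat \<Rightarrow> 'w \<Rightarrow> real \<times> (real ^ 'n)) \<Rightarrow> real \<Rightarrow> 'w \<Rightarrow> real"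
  where "zeta k X r \<omega> = 1 / fact (CARD('n) - k) *
    enn2real (\<Sum>\<^sub>\<infinity>js\<in>index_tuples (CARD('n) - k).
      nu k ((\<Inter>j\<in>set js. hyperplane (X j \<omega>)) \<inter> cball 0 r))"

(* Joint law of i.i.d. (P_i, V_i), 1 <= i <= m, with P_i uniform on [-r, r] and
   V_i ~ \<Theta> independent of P_i. *)
definition iid_law :: "nat \<Rightarrow> real \<Rightarrow> (real ^ 'n) measure \<Rightarrow> (nat \<Rightarrow> real \<times> (real ^ 'n)) measure"
  where "iid_law m r \<Theta> = PiM {1..m} (\<lambda>_. uniform_measure lborel {-r..r} \<Otimes>\<^sub>M \<Theta>)"

definition sigma_chi :: "nat \<Rightarrow> real \<Rightarrow> (real ^ 'n) measure \<Rightarrow> real"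
  where "sigma_chi k r \<Theta> = enn2real (\<integral>\<^sup>+ x.
    chi ((\<Inter>i\<in>{1..CARD('n) - k}. hyperplane (x i)) \<inter> cball 0 r) *
    chi ((\<Inter>i\<in>{CARD('n) - k..2 * CARD('n) - 2 * k - 1}. hyperplane (x i)) \<inter> cball 0 r)
    \<partial>iid_law (2 * CARD('n) - 2 * k - 1) r \<Theta>)"

definition sigma_nu :: "nat \<Rightarrow> real \<Rightarrow> (real ^ 'n) measure \<Rightarrow> real"
  where "sigma_nu k r \<Theta> = 1 / r ^ (2 * k) * enn2real (\<integral>\<^sup>+ x.
    nu k ((\<Inter>i\<in>{1..CARD('n) - k}. hyperplane (x i)) \<inter> cball 0 r) *
    nu k ((\<Inter>i\<in>{CARD('n) - k..2 * CARD('n) - 2 * k - 1}. hyperplane (x i)) \<inter> cball 0 r)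
    \<partial>iid_law (2 * CARD('n) - 2 * k - 1) r \<Theta>)"

definition Z_chi ::
    "nat \<Rightarrow> 'w measure \<Rightarrow> (nat \<Rightarrow> 'w \<Rightarrow> real \<times> (real ^ 'n)) \<Rightarrow> real \<Rightarrow> real \<Rightarrow> 'w \<Rightarrow> real"
  where "Z_chi k M X \<gamma> r \<omega> =
    fact (CARD('n) - k - 1) / (2 * \<gamma> * r) powr (real CARD('n) - real k - 1 / 2) *
    (Psi k X r \<omega> - integral\<^sup>L M (Psi k X r))"

definition Z_nu ::
    "nat \<Rightarrow> 'w measure \<Rightarrow> (nat \<Rightarrow> 'w \<Rightarrow> real \<times> (real ^ 'n)) \<Rightarrow> real \<Rightarrow> real \<Rightarrow> 'w \<Rightarrow> real"
  where "Z_nu k M X \<gamma> r \<omega> =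
    fact (CARD('n) - k - 1) * (1 / r ^ k) /
      (2 * \<gamma> * r) powr (real CARD('n) - real k - 1 / 2) *
    (zeta k X r \<omega> - integral\<^sup>L M (zeta k X r))"

(* Parametrised by the variance; the density formula is meaningless at variance 0. *)
definition gaussian :: "real \<Rightarrow> real \<Rightarrow> real measure"
  where "gaussian m v =
    (if v = 0 then return borel m else density lborel (normal_density m (sqrt v)))"

(* The notion weak_conv_m of the library, with the index tending to infinity in the reals. *)
definition converges_in_distribution ::
    "'w measure \<Rightarrow> (real \<Rightarrow> 'w \<Rightarrow> real) \<Rightarrow> real measure \<Rightarrow> bool"
  where "converges_in_distribution M Z \<mu> \<longleftrightarrow>
    (\<forall>x. isCont (cdf \<mu>) x \<longrightarrow>
      ((\<lambda>r. cdf (distr M borel (Z r)) x) \<longlongrightarrow> cdf \<mu> x) at_top)"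

end

(* The number of k-flats hitting the ball and r^(-k) times their k-volume are Poisson U-statistics
   of order m = d - k with a kernel f bounded uniformly in r over a Poisson process with intensity t Q, where
   t = 2 \<gamma> r and Q is uniform times \<Theta>.  The Campbell formula for sums over tuples of distinct points
   gives all second moments: splitting the square of the U-statistic U by the overlap of the two
   index sets, overlap 0 reproduces the squared mean, overlap 1 has expectation
   t^(2m-1) / (m-1)!^2 times the integral of g^2 with g(x) = E f(x, X_2, ..., X_m), and larger overlaps are
   O(t^(2m-2)).  Hence U differs from its linearization, the sum of t^(m-1)/(m-1)! g over the
   points, by o(t^(m-1/2)) in L^2 after centring.  The linear statistic has the explicit characteristic
   function exp (t * integral of (e^(iug) - 1) dQ), so a Taylor expansion bounds the distance of the
   characteristic function of the normalized U-statistic from the Gaussian one by a multiple of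
   t^(-1/2), and Levy's theorem concludes.  Hyperplanes with dependent normals almost surely have no common
   point, which makes the volume kernel bounded; it is measurable because the Hausdorff
   measure can be computed with open covers. *)
theory Submission
  imports Defs "HOL-Combinatorics.Multiset_Permutations" "HOL-Real_Asymp.Real_Asymp"
begin

section \<open>Poisson counts in a window\<close>

text \<open>The process is given only through counts of sets and an arbitrary measurable
  enumeration, so the indices of the points in a ball have no known joint law; every moment has to
  come from counts. The radial coordinate has no atoms, hence dyadic cells in that coordinate alone
  separate the points, whatever the orientation law. The window and the law \<open>Q\<close> change
  with r. The analysis is therefore done for one window with explicit error bounds, and the limit is
  taken only at the end, where the dependence on r sits in t = 2 \<gamma> r and in a factor r^k of
  the kernel bound. The limiting variance is the integral of a squared projection and may vanish;
  characteristic functions treat that case together with the others because the normalization never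
  divides by the variance. The volume of an intersection can be infinite for a null set of tuples.
  The kernel is replaced by a bounded one before any moment is taken, and the Campbell formula shows
  that almost surely no tuple of the process is affected.\<close>

lemma point_count_finite:
  assumes "finite {i. X i \<omega> \<in> B}"
  shows "point_count X B \<omega> = of_nat (card {i. X i \<omega> \<in> B})"
proof -
  have "point_count X B \<omega> = (\<Sum>i\<in>{i. X i \<omega> \<in> B}. indicator B (X i \<omega>))"
    unfolding point_count_def by (rule suminf_finite) (use assms in auto)
  also have "\<dots> = (\<Sum>i\<in>{i. X i \<omega> \<in> B}. 1)" by (rule sum.cong) auto
  finally show ?thesis by simp
qed

lemma point_count_infinite:
  assumes "infinite {i. X i \<omega> \<in> B}"
  shows "point_count X B \<omega> = \<infinity>"
proof -
  have "of_nat n \<le> point_count X B \<omega>" for n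
  proof -
    obtain F where F: "finite F" "card F = n" "F \<subseteq> {i. X i \<omega> \<in> B}"
      using infinite_arbitrarily_large[OF assms] by blast
    have "of_nat n = (\<Sum>i\<in>F. indicator B (X i \<omega>) :: ennreal)"
      using F by (subst sum.cong[of F F _ "\<lambda>_. 1"]) auto
    also have "\<dots> \<le> point_count X B \<omega>"
      unfolding point_count_def by (rule sum_le_suminf) (use F in auto)
    finally show ?thesis .
  qed
  then show ?thesis
    by (metis ennreal_Ex_less_of_nat infinity_ennreal_def leD top.not_eq_extremum)
qed

text \<open>Labels form an arbitrary set \<open>I\<close>, so that a pair of overlapping tuples is a
  single tuple over \<open>I1 \<union> I2\<close>. For finite \<open>I\<close>, extensionality keeps
  the set countable over the naturals and finite over a finite \<open>A\<close>.\<close>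

definition inj_tuples :: "'i set \<Rightarrow> 'j set \<Rightarrow> ('i \<Rightarrow> 'j) set"
  where "inj_tuples I A = {js \<in> I \<rightarrow>\<^sub>E A. inj_on js I}"

lemma finite_inj_tuples: "finite I \<Longrightarrow> finite A \<Longrightarrow> finite (inj_tuples I A)"
  unfolding inj_tuples_def by (rule finite_subset[OF _ finite_PiE[of I "\<lambda>_. A"]]) auto

lemma countable_inj_tuples: "finite I \<Longrightarrow> countable (inj_tuples I (UNIV :: nat set))"
  unfolding inj_tuples_def by (rule countable_subset[OF _ countable_PiE[of I "\<lambda>_. UNIV"]]) auto

text \<open>Sums over tuples of all indices are written as integrals over counting measure, which
  makes Tonelli available; once only indices in a finite \<open>A\<close> contribute, they become
  finite sums.\<close>

lemma nn_integral_inj_tuples: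
  assumes "finite I" "finite A"
    and "\<And>js. js \<in> inj_tuples I UNIV \<Longrightarrow> \<not> js ` I \<subseteq> A \<Longrightarrow> f js = 0"
  shows "(\<integral>\<^sup>+js. f js \<partial>count_space (inj_tuples I UNIV)) = (\<Sum>js\<in>inj_tuples I A. f js)"
proof (rule nn_integral_count_space')
  show "finite (inj_tuples I A)" by (rule finite_inj_tuples) fact+
  show "inj_tuples I A \<subseteq> inj_tuples I UNIV" by (auto simp: inj_tuples_def)
  show "f js = 0" if "js \<in> inj_tuples I UNIV" "js \<notin> inj_tuples I A" for js
    using assms(3)[OF that(1)] that by (auto simp: inj_tuples_def PiE_iff)
qed

(* The cells form nested partitions whose cells become uniformly small; almost surely they
   eventually separate the points of the process, so that the Campbell formula need only be checked on
   products of disjoint sets, where it is the independence of counts. *)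
locale poisson_window = prob_space M + Q: prob_space Q
  for M :: "'w measure" and Q :: "'a measure" +
  fixes X :: "nat \<Rightarrow> 'w \<Rightarrow> 'a" and W :: "'a set" and t :: real and cell :: "nat \<Rightarrow> 'a \<Rightarrow> nat"
  assumes X [measurable]: "\<And>i. X i \<in> measurable M Q"
    and W [measurable]: "W \<in> sets Q" and Q_W: "AE x in Q. x \<in> W"
    and t: "t > 0"
    and poisson: "\<And>B n. B \<in> sets Q \<Longrightarrow> B \<subseteq> W \<Longrightarrow>
      prob {\<omega>\<in>space M. point_count X B \<omega> = of_nat n} = (t * Q.prob B)^n / fact n * exp (-(t * Q.prob B))"
    and indep: "\<And>B :: nat \<Rightarrow> 'a set. range B \<subseteq> sets Q \<Longrightarrow> disjoint_family B \<Longrightarrow>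
      indep_vars (\<lambda>_. borel) (\<lambda>j. point_count X (B j)) UNIV"
    and cell [measurable]: "\<And>n. cell n \<in> measurable Q (count_space UNIV)"
    and cell_mono: "\<And>n x y. cell (Suc n) x = cell (Suc n) y \<Longrightarrow> cell n x = cell n y"
    and cell_bound: "\<And>n x. x \<in> W \<Longrightarrow> cell n x \<le> 2^n"
    and cell_small: "\<And>n c. Q.prob {x\<in>space Q. x \<in> W \<and> cell n x = c} \<le> 1/2^n"
begin

definition idx :: "'w \<Rightarrow> nat set" where "idx \<omega> = {i. X i \<omega> \<in> W}"

text \<open>\<open>card\<close> sends infinite sets to 0, so this natural number agrees with
  \<open>point_count\<close> only for finitely many points, which is almost surely the case inside
  the window.\<close>

definition cnt :: "'a set \<Rightarrow> 'w \<Rightarrow> nat" where "cnt B \<omega> = card {i. X i \<omega> \<in> B}"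

lemma point_count_measurable [measurable]:
  assumes "B \<in> sets Q" shows "point_count X B \<in> borel_measurable M"
proof -
  have [measurable]: "(\<lambda>\<omega>. indicator B (X i \<omega>) :: ennreal) \<in> borel_measurable M" for i
    by (rule measurable_compose[OF X borel_measurable_indicator[OF assms]])
  show ?thesis unfolding point_count_def[abs_def] by measurable
qed

lemma W_space: "W \<subseteq> space Q" using W by (rule sets.sets_into_space)

lemma Q_prob_W: "Q.prob W = 1" using Q_W by (subst Q.prob_eq_1) auto

text \<open>The Poisson probabilities of all finite counts add up to 1, which leaves nothing for the
  infinite count.\<close>

lemma AE_finite_idx: "AE \<omega> in M. finite (idx \<omega>)"
proof -
  let ?E = "\<lambda>n::nat. {\<omega>\<in>space M. point_count X W \<omega> = of_nat n}"
  have m: "?E n \<in> events" for n by measurable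
  have "disjoint_family ?E" by (auto simp: disjoint_family_on_def)
  then have "(\<lambda>n. prob (?E n)) sums prob (\<Union>n. ?E n)"
    using m by (intro finite_measure_UNION) auto
  moreover have "(\<lambda>n. prob (?E n)) sums 1"
  proof -
    have "(\<lambda>n. t ^ n /\<^sub>R fact n) sums exp t" by (rule exp_converges)
    then have "(\<lambda>n. t ^ n /\<^sub>R fact n * exp (-t)) sums (exp t * exp (-t))" by (rule sums_mult2)
    then show ?thesis
      unfolding poisson[OF W order_refl] by (simp add: Q_prob_W exp_minus field_simps)
  qed
  ultimately have "prob (\<Union>n. ?E n) = 1" by (rule sums_unique2)
  then have "AE \<omega> in M. \<omega> \<in> (\<Union>n. ?E n)" using m by (subst (asm) prob_eq_1) auto
  then show ?thesis
  proof (eventually_elim)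
    case (elim \<omega>)
    then have "point_count X W \<omega> \<noteq> \<infinity>" by auto
    then show ?case using point_count_infinite[of X \<omega> W] by (auto simp: idx_def)
  qed
qed

lemma cnt_point_count:
  assumes "finite (idx \<omega>)" "B \<subseteq> W" shows "point_count X B \<omega> = of_nat (cnt B \<omega>)"
proof -
  have "finite {i. X i \<omega> \<in> B}" using assms by (auto simp: idx_def intro: finite_subset[rotated])
  then show ?thesis by (simp add: cnt_def point_count_finite)
qed

lemma AE_cnt: "B \<subseteq> W \<Longrightarrow> AE \<omega> in M. point_count X B \<omega> = of_nat (cnt B \<omega>)"
  using AE_finite_idx by eventually_elim (rule cnt_point_count)

lemma cnt_measurable [measurable]:
  assumes [measurable]: "B \<in> sets Q" shows "cnt B \<in> measurable M (count_space UNIV)"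
proof (rule measurable_count_space_eq_countable[THEN iffD2], safe)
  fix n
  \<comment> \<open>An infinite count is read as 0 by \<open>card\<close>, so the fibre over 0
    contains that event as well.\<close>
  have eq: "cnt B \<omega> = n \<longleftrightarrow> point_count X B \<omega> = of_nat n \<or> point_count X B \<omega> = \<infinity> \<and> n = 0" for \<omega>
  proof (cases "finite {i. X i \<omega> \<in> B}")
    case True
    then show ?thesis using ennreal_of_nat_neq_top by (simp add: cnt_def point_count_finite)
  next
    case False
    then show ?thesis by (auto simp: cnt_def point_count_infinite)
  qed
  have "cnt B -` {n} \<inter> space M = {\<omega>\<in>space M. point_count X B \<omega> = of_nat n \<or> point_count X B \<omega> = \<infinity> \<and> n = 0}"
    using eq by auto
  also have "\<dots> \<in> events" by measurable
  finally show "cnt B -` {n} \<inter> space M \<in> events" .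
qed auto

lemma distr_cnt:
  assumes [measurable]: "B \<in> sets Q" and "B \<subseteq> W"
  shows "distr M (count_space UNIV) (cnt B) =
    density (count_space UNIV) (\<lambda>n. ennreal ((t * Q.prob B)^n / fact n * exp (-(t * Q.prob B))))"
    (is "_ = density _ ?p")
proof (rule measure_eqI_countable)
  fix n :: nat
  have "emeasure (distr M (count_space UNIV) (cnt B)) {n} = emeasure M {\<omega>\<in>space M. cnt B \<omega> = n}"
    by (subst emeasure_distr) (auto intro!: arg_cong[where f="emeasure M"])
  also have "\<dots> = emeasure M {\<omega>\<in>space M. point_count X B \<omega> = of_nat n}"
    using AE_cnt[OF assms(2)] by (intro emeasure_eq_AE) auto
  also have "\<dots> = ?p n" using poisson[OF assms] by (simp add: emeasure_eq_measure)
  also have "\<dots> = emeasure (density (count_space UNIV) ?p) {n}"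
    by (subst emeasure_density) (auto simp: nn_integral_count_space_indicator[symmetric] nn_integral_count_space_finite)
  finally show "emeasure (distr M (count_space UNIV) (cnt B)) {n} = emeasure (density (count_space UNIV) ?p) {n}" .
qed auto

lemma nn_integral_cnt:
  assumes [measurable]: "B \<in> sets Q" and "B \<subseteq> W"
  shows "(\<integral>\<^sup>+\<omega>. f (cnt B \<omega>) \<partial>M) = (\<Sum>n. ennreal ((t * Q.prob B)^n / fact n * exp (-(t * Q.prob B))) * f n)"
proof -
  have "(\<integral>\<^sup>+\<omega>. f (cnt B \<omega>) \<partial>M) = (\<integral>\<^sup>+n. f n \<partial>distr M (count_space UNIV) (cnt B))"
    by (subst nn_integral_distr) auto
  also have "\<dots> = (\<Sum>n. ennreal ((t * Q.prob B)^n / fact n * exp (-(t * Q.prob B))) * f n)"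
    unfolding distr_cnt[OF assms] by (subst nn_integral_density) (auto simp: nn_integral_count_space_nat)
  finally show ?thesis .
qed

lemma expectation_point_count:
  assumes B [measurable]: "B \<in> sets Q" and "B \<subseteq> W"
  shows "(\<integral>\<^sup>+\<omega>. point_count X B \<omega> \<partial>M) = ennreal t * emeasure Q B"
proof -
  define l where "l = t * Q.prob B"
  have l: "l \<ge> 0" unfolding l_def using t by simp
  \<comment> \<open>Cancelling n against n! turns the mean of the Poisson law into l times the
    exponential series, shifted by one.\<close>
  have "(\<lambda>n. (l ^ n /\<^sub>R fact n) * (l * exp (-l))) sums (exp l * (l * exp (-l)))"
    by (intro sums_mult2 exp_converges)
  then have "(\<lambda>n. l ^ Suc n / fact (Suc n) * exp (-l) * real (Suc n)) sums l"
    by (simp add: exp_minus field_simps del: of_nat_Suc)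
  then have "(\<lambda>n. l ^ n / fact n * exp (-l) * real n) sums l"
    by (subst (asm) sums_Suc_iff) simp
  then have s: "(\<Sum>n. ennreal (l ^ n / fact n * exp (-l) * real n)) = ennreal l"
    using l by (intro suminf_ennreal_eq) auto
  have "(\<integral>\<^sup>+\<omega>. point_count X B \<omega> \<partial>M) = (\<integral>\<^sup>+\<omega>. of_nat (cnt B \<omega>) \<partial>M)"
    using AE_cnt[OF assms(2)] by (intro nn_integral_cong_AE) auto
  also have "\<dots> = (\<Sum>n. ennreal (l ^ n / fact n * exp (-l)) * of_nat n)"
    unfolding nn_integral_cnt[OF assms] l_def ..
  also have "\<dots> = ennreal l"
    unfolding s[symmetric] using l
    by (intro suminf_cong) (simp add: ennreal_mult'[symmetric] ennreal_of_nat_eq_real_of_nat)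
  also have "\<dots> = ennreal t * emeasure Q B"
    using t by (simp add: l_def ennreal_mult Q.emeasure_eq_measure)
  finally show ?thesis .
qed

text \<open>A Poisson variable of mean l exceeds 1 with probability 1 - (1 + l) exp (-l), and exp
  (-l) \<ge> 1 - l makes this at most l^2. It is the quadratic order that lets the sum over many
  small cells tend to 0.\<close>

lemma prob_cnt_ge_2:
  assumes B [measurable]: "B \<in> sets Q" and "B \<subseteq> W"
  shows "prob {\<omega>\<in>space M. 2 \<le> cnt B \<omega>} \<le> (t * Q.prob B)^2"
proof -
  define l where "l = t * Q.prob B"
  have p: "prob {\<omega>\<in>space M. cnt B \<omega> = n} = l ^ n / fact n * exp (-l)" for n
  proof -
    have "prob {\<omega>\<in>space M. cnt B \<omega> = n} = prob {\<omega>\<in>space M. point_count X B \<omega> = of_nat n}"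
      using AE_cnt[OF assms(2)] by (intro finite_measure_eq_AE) auto
    then show ?thesis using poisson[OF assms] by (simp add: l_def)
  qed
  have "1 = prob (space M)" by (simp add: prob_space)
  also have "space M = {\<omega>\<in>space M. 2 \<le> cnt B \<omega>} \<union> ({\<omega>\<in>space M. cnt B \<omega> = 0} \<union> {\<omega>\<in>space M. cnt B \<omega> = 1})"
    by auto
  also have "prob \<dots> = prob {\<omega>\<in>space M. 2 \<le> cnt B \<omega>} + (prob {\<omega>\<in>space M. cnt B \<omega> = 0} + prob {\<omega>\<in>space M. cnt B \<omega> = 1})"
    by (subst finite_measure_Union, measurable, force, subst finite_measure_Union, measurable, auto)
  finally have "prob {\<omega>\<in>space M. 2 \<le> cnt B \<omega>} = 1 - (1 + l) * exp (-l)"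
    unfolding p by (simp add: algebra_simps)
  also have "\<dots> \<le> 1 - (1 + l) * (1 - l)"
    using exp_ge_add_one_self[of "-l"] t
    by (intro diff_left_mono mult_left_mono) (auto simp: l_def)
  also have "\<dots> = l^2" by (simp add: algebra_simps power2_eq_square)
  finally show ?thesis by (simp add: l_def)
qed

end

section \<open>The multivariate Campbell formula\<close>

context poisson_window
begin

sublocale QP: product_sigma_finite "\<lambda>_::nat. Q" ..

text \<open>An index cannot serve two labels whose sets are disjoint, so non-injective tuples
  contribute 0 anyway. The sum then factors into one count per label, and the counts are independent
  with means \<open>t * Q.prob (B i)\<close>.\<close>

lemma nn_integral_prod_indicator_tuples:
  fixes I :: "nat set"
  assumes I: "finite I" and B: "\<And>i. i \<in> I \<Longrightarrow> B i \<in> sets Q" "\<And>i. i \<in> I \<Longrightarrow> B i \<subseteq> W"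
    and disj: "\<And>i j. i \<in> I \<Longrightarrow> j \<in> I \<Longrightarrow> i \<noteq> j \<Longrightarrow> B i \<inter> B j = {}"
  shows "(\<integral>\<^sup>+\<omega>. (\<integral>\<^sup>+js. (\<Prod>i\<in>I. indicator (B i) (X (js i) \<omega>)) \<partial>count_space (inj_tuples I UNIV)) \<partial>M)
    = (\<Prod>i\<in>I. ennreal t * emeasure Q (B i))"
proof -
  \<comment> \<open>Independence is available for sequences of sets, so the family is continued by
    empty sets.\<close>
  define B' where "B' i = (if i \<in> I then B i else {})" for i
  have "indep_vars (\<lambda>_. borel) (\<lambda>j. point_count X (B' j)) UNIV"
    using B disj by (intro indep) (auto simp: B'_def disjoint_family_on_def)
  then have ind: "indep_vars (\<lambda>_. borel) (\<lambda>j. point_count X (B' j)) I"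
    by (rule indep_vars_subset) auto
  have "(\<integral>\<^sup>+\<omega>. (\<integral>\<^sup>+js. (\<Prod>i\<in>I. indicator (B i) (X (js i) \<omega>)) \<partial>count_space (inj_tuples I UNIV)) \<partial>M)
    = (\<integral>\<^sup>+\<omega>. (\<Prod>i\<in>I. point_count X (B' i) \<omega>) \<partial>M)"
  proof (rule nn_integral_cong_AE)
    show "AE \<omega> in M. (\<integral>\<^sup>+js. (\<Prod>i\<in>I. indicator (B i) (X (js i) \<omega>)) \<partial>count_space (inj_tuples I UNIV))
      = (\<Prod>i\<in>I. point_count X (B' i) \<omega>)"
      using AE_finite_idx
    proof eventually_elim
      case (elim \<omega>)
      have zero: "(\<Prod>i\<in>I. indicator (B i) (X (js i) \<omega>)) = (0::ennreal)" if "\<not> js ` I \<subseteq> idx \<omega>" for js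
      proof -
        from that obtain i where "i \<in> I" "X (js i) \<omega> \<notin> W" by (auto simp: idx_def)
        then show ?thesis using I B(2) by (intro prod_zero) (auto intro!: bexI[of _ i] simp: indicator_def)
      qed
      have "(\<integral>\<^sup>+js. (\<Prod>i\<in>I. indicator (B i) (X (js i) \<omega>)) \<partial>count_space (inj_tuples I UNIV))
        = (\<Sum>js\<in>inj_tuples I (idx \<omega>). \<Prod>i\<in>I. indicator (B i) (X (js i) \<omega>))"
        using zero by (intro nn_integral_inj_tuples I elim) auto
      also have "\<dots> = (\<Sum>js\<in>I \<rightarrow>\<^sub>E idx \<omega>. \<Prod>i\<in>I. indicator (B i) (X (js i) \<omega>))"
      proof (rule sum.mono_neutral_left)
        show "finite (I \<rightarrow>\<^sub>E idx \<omega>)" using I elim by (intro finite_PiE)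
        show "inj_tuples I (idx \<omega>) \<subseteq> I \<rightarrow>\<^sub>E idx \<omega>" by (auto simp: inj_tuples_def)
        show "\<forall>js\<in>(I \<rightarrow>\<^sub>E idx \<omega>) - inj_tuples I (idx \<omega>). (\<Prod>i\<in>I. indicator (B i) (X (js i) \<omega>)) = (0::ennreal)"
        proof
          fix js assume "js \<in> (I \<rightarrow>\<^sub>E idx \<omega>) - inj_tuples I (idx \<omega>)"
          then obtain i j where ij: "i \<in> I" "j \<in> I" "i \<noteq> j" "js i = js j"
            by (auto simp: inj_tuples_def inj_on_def)
          then have "X (js i) \<omega> \<notin> B i \<or> X (js j) \<omega> \<notin> B j" using disj[OF ij(1-3)] by auto
          then have "\<exists>l\<in>I. X (js l) \<omega> \<notin> B l" using ij by blast
          then show "(\<Prod>i\<in>I. indicator (B i) (X (js i) \<omega>)) = (0::ennreal)"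
            using I ij by (intro prod_zero) (auto simp: indicator_def)
        qed
      qed
      also have "\<dots> = (\<Prod>i\<in>I. \<Sum>j\<in>idx \<omega>. indicator (B i) (X j \<omega>))"
        using I elim by (subst prod_sum_PiE) auto
      also have "\<dots> = (\<Prod>i\<in>I. point_count X (B' i) \<omega>)"
      proof (rule prod.cong)
        fix i assume i: "i \<in> I"
        show "(\<Sum>j\<in>idx \<omega>. indicator (B i) (X j \<omega>)) = point_count X (B' i) \<omega>"
          unfolding point_count_def B'_def using i elim B(2)[OF i]
          by (subst suminf_finite[of "idx \<omega>"]) (auto simp: idx_def indicator_def)
      qed simp
      finally show ?case .
    qed
  qed
  also have "\<dots> = (\<Prod>i\<in>I. \<integral>\<^sup>+\<omega>. point_count X (B' i) \<omega> \<partial>M)"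
    by (rule indep_vars_nn_integral[OF I ind]) auto
  also have "\<dots> = (\<Prod>i\<in>I. ennreal t * emeasure Q (B i))"
    using B by (intro prod.cong) (auto simp: B'_def expectation_point_count)
  finally show ?thesis .
qed

lemma tuple_measurable [measurable]:
  assumes "finite I" "js \<in> inj_tuples I UNIV"
  shows "(\<lambda>\<omega>. \<lambda>i\<in>I. X (js i) \<omega>) \<in> measurable M (PiM I (\<lambda>_. Q))"
  by (rule measurable_restrict) simp

text \<open>Both sides are integrals of \<open>h\<close> against measures, which need only be
  compared on rectangles; there the identity is the product formula for disjoint sets. Both measures
  are identified with the product of the restrictions of t Q to the sets \<open>C i\<close>.\<close>

lemma campbell_disjoint:
  fixes I :: "nat set"
  assumes I: "finite I" and C: "\<And>i. i \<in> I \<Longrightarrow> C i \<in> sets Q" "\<And>i. i \<in> I \<Longrightarrow> C i \<subseteq> W"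
    and disj: "\<And>i j. i \<in> I \<Longrightarrow> j \<in> I \<Longrightarrow> i \<noteq> j \<Longrightarrow> C i \<inter> C j = {}"
    and h [measurable]: "h \<in> borel_measurable (PiM I (\<lambda>_. Q))"
  shows "(\<integral>\<^sup>+\<omega>. (\<integral>\<^sup>+js. h (\<lambda>i\<in>I. X (js i) \<omega>) * (\<Prod>i\<in>I. indicator (C i) (X (js i) \<omega>))
      \<partial>count_space (inj_tuples I UNIV)) \<partial>M)
    = ennreal t ^ card I * (\<integral>\<^sup>+x. h x * (\<Prod>i\<in>I. indicator (C i) (x i)) \<partial>PiM I (\<lambda>_. Q))"
proof -
  let ?J = "inj_tuples I (UNIV :: nat set)" and ?P = "PiM I (\<lambda>_. Q)"
  define T where "T = (\<lambda>(js, \<omega>). \<lambda>i\<in>I. X (js i) \<omega>)"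
  define c :: "(nat \<Rightarrow> 'a) \<Rightarrow> ennreal" where "c x = (\<Prod>i\<in>I. indicator (C i) (x i))" for x
  have c [measurable]: "c \<in> borel_measurable ?P"
    unfolding c_def using C(1)
    by (intro borel_measurable_prod_ennreal measurable_compose[OF measurable_component_singleton]) auto
  \<comment> \<open>There are only countably many tuples, so joint measurability can be checked for
    each of them separately.\<close>
  have T [measurable]: "T \<in> measurable (count_space ?J \<Otimes>\<^sub>M M) ?P"
    unfolding T_def
    by (rule measurable_pair_measure_countable1[OF countable_inj_tuples[OF I]]) (simp add: tuple_measurable I)
  interpret J: sigma_finite_measure "count_space ?J"
    by (rule sigma_finite_measure_count_space_countable[OF countable_inj_tuples[OF I]])
  interpret JM: pair_sigma_finite "count_space ?J" M ..
  \<comment> \<open>\<open>D\<close> is the intensity measure of the random tuples with component i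
    in \<open>C i\<close>: it assigns to a set the expected number of such tuples in it.\<close>
  define D where "D = distr (density (count_space ?J \<Otimes>\<^sub>M M) (\<lambda>y. c (T y))) ?P T"
  have nnD: "(\<integral>\<^sup>+x. g x \<partial>D) = (\<integral>\<^sup>+\<omega>. (\<integral>\<^sup>+js. g (T (js, \<omega>)) * c (T (js, \<omega>)) \<partial>count_space ?J) \<partial>M)"
    if [measurable]: "g \<in> borel_measurable ?P" for g
  proof -
    have "(\<integral>\<^sup>+x. g x \<partial>D) = (\<integral>\<^sup>+y. c (T y) * g (T y) \<partial>(count_space ?J \<Otimes>\<^sub>M M))"
      unfolding D_def by (subst nn_integral_distr, measurable, subst nn_integral_density) auto
    also have "\<dots> = (\<integral>\<^sup>+\<omega>. (\<integral>\<^sup>+js. g (T (js, \<omega>)) * c (T (js, \<omega>)) \<partial>count_space ?J) \<partial>M)"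
      by (subst JM.nn_integral_snd[symmetric]) (auto simp: mult.commute)
    finally show ?thesis .
  qed
  have cT: "c (T (js, \<omega>)) = (\<Prod>i\<in>I. indicator (C i) (X (js i) \<omega>))" for js \<omega>
    by (simp add: c_def T_def)
  \<comment> \<open>Labels outside \<open>I\<close> get the zero measure, which completes the family
    to all naturals.\<close>
  interpret N: product_sigma_finite "\<lambda>i. density Q (\<lambda>x. ennreal t * indicator (if i \<in> I then C i else {}) x)"
  proof (rule product_sigma_finite.intro)
    fix i
    interpret finite_measure "density Q (\<lambda>x. ennreal t * indicator (if i \<in> I then C i else {}) x)"
    proof
      show "emeasure (density Q (\<lambda>x. ennreal t * indicator (if i \<in> I then C i else {}) x))
          (space (density Q (\<lambda>x. ennreal t * indicator (if i \<in> I then C i else {}) x))) \<noteq> \<infinity>"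
        using C(1)[of i]
        by (cases "i \<in> I") (auto simp: emeasure_density nn_integral_cmult ennreal_mult_eq_top_iff Q.emeasure_eq_measure)
    qed
    show "sigma_finite_measure (density Q (\<lambda>x. ennreal t * indicator (if i \<in> I then C i else {}) x))" ..
  qed
  let ?N = "\<lambda>i. density Q (\<lambda>x. ennreal t * indicator (if i \<in> I then C i else {}) x)"
  have em: "emeasure (?N i) A = ennreal t * emeasure Q (A \<inter> C i)" if "i \<in> I" "A \<in> sets Q" for i A
    using that C(1)[OF that(1)]
    by (subst emeasure_density) (auto simp: mult.assoc nn_integral_cmult indicator_inter_arith[symmetric] Int_commute)
  have setsP: "sets ?P = sets (PiM I ?N)" by (intro sets_PiM_cong) auto
  have D_eq: "D = PiM I ?N"
  proof (rule N.PiM_eqI[OF I])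
    show "sets D = sets (PiM I ?N)" using setsP by (simp add: D_def)
    fix A assume "\<And>i. i \<in> I \<Longrightarrow> A i \<in> sets (?N i)"
    then have A: "\<And>i. i \<in> I \<Longrightarrow> A i \<in> sets Q" by auto
    then have [measurable]: "Pi\<^sub>E I A \<in> sets ?P" using I by (intro sets_PiM_I_finite) auto
    have "emeasure D (Pi\<^sub>E I A) = (\<integral>\<^sup>+x. indicator (Pi\<^sub>E I A) x \<partial>D)"
      by (subst nn_integral_indicator) (auto simp: D_def)
    also have "\<dots> = (\<integral>\<^sup>+\<omega>. (\<integral>\<^sup>+js. indicator (Pi\<^sub>E I A) (T (js, \<omega>)) * c (T (js, \<omega>)) \<partial>count_space ?J) \<partial>M)"
      by (rule nnD) simp
    also have "\<dots> = (\<integral>\<^sup>+\<omega>. (\<integral>\<^sup>+js. (\<Prod>i\<in>I. indicator (A i \<inter> C i) (X (js i) \<omega>)) \<partial>count_space ?J) \<partial>M)"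
    proof (intro nn_integral_cong)
      fix js \<omega>
      have "indicator (Pi\<^sub>E I A) (T (js, \<omega>)) = (\<Prod>i\<in>I. indicator (A i) (X (js i) \<omega>) :: ennreal)"
        using I by (auto simp: T_def indicator_def PiE_iff prod_zero_iff)
      then show "indicator (Pi\<^sub>E I A) (T (js, \<omega>)) * c (T (js, \<omega>)) = (\<Prod>i\<in>I. indicator (A i \<inter> C i) (X (js i) \<omega>) :: ennreal)"
        by (simp add: cT prod.distrib[symmetric] indicator_inter_arith)
    qed
    also have "\<dots> = (\<Prod>i\<in>I. ennreal t * emeasure Q (A i \<inter> C i))"
    proof (rule nn_integral_prod_indicator_tuples[OF I])
      fix i assume i: "i \<in> I"
      show "A i \<inter> C i \<in> sets Q" using A[OF i] C(1)[OF i] by auto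
      show "A i \<inter> C i \<subseteq> W" using C(2)[OF i] by auto
    next
      fix i j assume "i \<in> I" "j \<in> I" "i \<noteq> j"
      then show "(A i \<inter> C i) \<inter> (A j \<inter> C j) = {}" using disj by blast
    qed
    also have "\<dots> = (\<Prod>i\<in>I. emeasure (?N i) (A i))"
      by (intro prod.cong refl em[symmetric] A)
    finally show "emeasure D (Pi\<^sub>E I A) = (\<Prod>i\<in>I. emeasure (?N i) (A i))" .
  qed
  have "density ?P (\<lambda>x. ennreal t ^ card I * c x) = PiM I ?N"
  proof (rule N.PiM_eqI[OF I])
    show "sets (density ?P (\<lambda>x. ennreal t ^ card I * c x)) = sets (PiM I ?N)" using setsP by simp
    fix A assume "\<And>i. i \<in> I \<Longrightarrow> A i \<in> sets (?N i)"
    then have A: "\<And>i. i \<in> I \<Longrightarrow> A i \<in> sets Q" by auto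
    then have [measurable]: "Pi\<^sub>E I A \<in> sets ?P" using I by (intro sets_PiM_I_finite) auto
    have "emeasure (density ?P (\<lambda>x. ennreal t ^ card I * c x)) (Pi\<^sub>E I A) =
      (\<integral>\<^sup>+x. ennreal t ^ card I * c x * indicator (Pi\<^sub>E I A) x \<partial>?P)"
      by (subst emeasure_density) auto
    also have "\<dots> = (\<integral>\<^sup>+x. (\<Prod>i\<in>I. ennreal t * indicator (A i \<inter> C i) (x i)) \<partial>?P)"
    proof (intro nn_integral_cong)
      fix x assume x: "x \<in> space ?P"
      have "indicator (Pi\<^sub>E I A) x = (\<Prod>i\<in>I. indicator (A i) (x i) :: ennreal)"
        using I x by (auto simp: indicator_def PiE_iff prod_zero_iff space_PiM)
      then show "ennreal t ^ card I * c x * indicator (Pi\<^sub>E I A) x = (\<Prod>i\<in>I. ennreal t * indicator (A i \<inter> C i) (x i))"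
        by (simp add: c_def prod.distrib indicator_inter_arith mult_ac)
    qed
    also have "\<dots> = (\<Prod>i\<in>I. \<integral>\<^sup>+x. ennreal t * indicator (A i \<inter> C i) x \<partial>Q)"
      using A C(1) by (intro QP.product_nn_integral_prod I) auto
    also have "\<dots> = (\<Prod>i\<in>I. emeasure (?N i) (A i))"
    proof (rule prod.cong)
      fix i assume i: "i \<in> I"
      show "(\<integral>\<^sup>+x. ennreal t * indicator (A i \<inter> C i) x \<partial>Q) = emeasure (?N i) (A i)"
        unfolding em[OF i A[OF i]] using A[OF i] C(1)[OF i] by (simp add: nn_integral_cmult)
    qed simp
    finally show "emeasure (density ?P (\<lambda>x. ennreal t ^ card I * c x)) (Pi\<^sub>E I A) = (\<Prod>i\<in>I. emeasure (?N i) (A i))" .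
  qed
  then have "(\<integral>\<^sup>+x. h x \<partial>D) = (\<integral>\<^sup>+x. h x \<partial>density ?P (\<lambda>x. ennreal t ^ card I * c x))"
    by (simp add: D_eq)
  also have "\<dots> = ennreal t ^ card I * (\<integral>\<^sup>+x. h x * c x \<partial>?P)"
    by (subst nn_integral_density) (auto simp: nn_integral_cmult[symmetric] mult_ac)
  finally show ?thesis unfolding nnD[OF h] by (simp add: cT) (simp add: c_def T_def)
qed


section \<open>Partitions whose cells separate the points\<close>

lemma prob_tuple_coincidence:
  fixes I :: "nat set"
  assumes I: "finite I" "i \<in> I" "j \<in> I" "i \<noteq> j" and C [measurable]: "C \<in> sets Q"
  shows "emeasure (PiM I (\<lambda>_. Q)) {x\<in>space (PiM I (\<lambda>_. Q)). x i \<in> C \<and> x j \<in> C} = (emeasure Q C)^2"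
proof -
  let ?f = "\<lambda>l y. if l = i \<or> l = j then indicator C y else (1::ennreal)"
  have [measurable]: "(\<lambda>x. x i) \<in> measurable (PiM I (\<lambda>_. Q)) Q" "(\<lambda>x. x j) \<in> measurable (PiM I (\<lambda>_. Q)) Q"
    using I by measurable
  have eq: "indicator {x\<in>space (PiM I (\<lambda>_. Q)). x i \<in> C \<and> x j \<in> C} x = (\<Prod>l\<in>I. ?f l (x l))"
    if "x \<in> space (PiM I (\<lambda>_. Q))" for x
  proof -
    have "(\<Prod>l\<in>I. ?f l (x l)) = (\<Prod>l\<in>{i,j}. indicator C (x l))"
      using I by (intro prod.mono_neutral_cong_right) auto
    also have "\<dots> = indicator {x\<in>space (PiM I (\<lambda>_. Q)). x i \<in> C \<and> x j \<in> C} x"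
      using I that by (auto simp: indicator_def)
    finally show ?thesis ..
  qed
  have "emeasure (PiM I (\<lambda>_. Q)) {x\<in>space (PiM I (\<lambda>_. Q)). x i \<in> C \<and> x j \<in> C} =
    (\<integral>\<^sup>+x. indicator {x\<in>space (PiM I (\<lambda>_. Q)). x i \<in> C \<and> x j \<in> C} x \<partial>PiM I (\<lambda>_. Q))"
    by (subst nn_integral_indicator) auto
  also have "\<dots> = (\<integral>\<^sup>+x. (\<Prod>l\<in>I. ?f l (x l)) \<partial>PiM I (\<lambda>_. Q))"
    by (intro nn_integral_cong eq)
  also have "\<dots> = (\<Prod>l\<in>I. \<integral>\<^sup>+y. ?f l y \<partial>Q)"
    by (rule QP.product_nn_integral_prod[of I ?f, OF I(1)]) auto
  also have "\<dots> = (\<Prod>l\<in>{i,j}. emeasure Q C)"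
    using I by (intro prod.mono_neutral_cong_right) (auto simp: Q.emeasure_space_1)
  also have "\<dots> = (emeasure Q C)^2" using I by (simp add: power2_eq_square)
  finally show ?thesis .
qed

definition cellset :: "nat \<Rightarrow> nat \<Rightarrow> 'a set" where "cellset n c = {x\<in>space Q. x \<in> W \<and> cell n x = c}"

lemma cellset_sets [measurable]: "cellset n c \<in> sets Q"
  unfolding cellset_def by measurable

lemma cellset_W: "cellset n c \<subseteq> W" by (auto simp: cellset_def)

lemma cellset_disjoint: "c \<noteq> c' \<Longrightarrow> cellset n c \<inter> cellset n c' = {}" by (auto simp: cellset_def)

text \<open>The sum of squares is at most the largest cell probability times the total mass. It
  controls collisions of two process points and of two independent coordinates alike.\<close>

lemma sum_prob_cellset_sq: "(\<Sum>c\<le>2^n. (Q.prob (cellset n c))^2) \<le> 1/2^n"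
proof -
  have "(\<Sum>c\<le>2^n. (Q.prob (cellset n c))^2) \<le> (\<Sum>c\<le>2^n. 1/2^n * Q.prob (cellset n c))"
    unfolding power2_eq_square using cell_small[of n]
    by (intro sum_mono mult_right_mono) (auto simp: cellset_def)
  also have "\<dots> = 1/2^n * Q.prob (\<Union>c\<le>2^n. cellset n c)"
    using cellset_disjoint
    by (subst Q.finite_measure_finite_Union) (auto simp: disjoint_family_on_def sum_distrib_left)
  also have "\<dots> \<le> 1/2^n * 1" by (intro mult_left_mono) auto
  finally show ?thesis by simp
qed

definition separated :: "nat \<Rightarrow> nat set \<Rightarrow> (nat \<Rightarrow> 'a) \<Rightarrow> bool"
  where "separated n I x \<longleftrightarrow> (\<forall>i\<in>I. x i \<in> W) \<and> inj_on (\<lambda>i. cell n (x i)) I"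

lemma separated_mono: "separated n I x \<Longrightarrow> n \<le> n' \<Longrightarrow> separated n' I x"
proof (rotate_tac 1, induction rule: dec_induct)
  case (step m)
  have "i = j" if "i \<in> I" "j \<in> I" "cell (Suc m) (x i) = cell (Suc m) (x j)" for i j
    using step.IH that(1,2) cell_mono[OF that(3)] step.prems by (auto simp: separated_def dest: inj_onD)
  then show ?case using step by (auto simp: separated_def inj_on_def)
qed simp

text \<open>A union bound over the cells of level n bounds the probability of a cell with two points
  by t^2 / 2^n. A single level without such a cell is enough, so only the intersection of the events
  \<open>E n\<close> has to be null.\<close>

lemma AE_separated_idx: "AE \<omega> in M. \<exists>n. separated n (idx \<omega>) (\<lambda>i. X i \<omega>)"
proof -
  define E where "E n = (\<Union>c\<le>2^n. {\<omega>\<in>space M. 2 \<le> cnt (cellset n c) \<omega>})" for n :: nat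
  have [measurable]: "E n \<in> events" for n unfolding E_def by measurable
  have E: "prob (E n) \<le> t^2 * (1/2^n)" for n
  proof -
    have "prob (E n) \<le> (\<Sum>c\<le>2^n. prob {\<omega>\<in>space M. 2 \<le> cnt (cellset n c) \<omega>})"
      unfolding E_def by (intro finite_measure_subadditive_finite) auto
    also have "\<dots> \<le> (\<Sum>c\<le>2^n. (t * Q.prob (cellset n c))^2)"
      by (intro sum_mono prob_cnt_ge_2 cellset_sets cellset_W)
    also have "\<dots> = t^2 * (\<Sum>c\<le>2^n. (Q.prob (cellset n c))^2)"
      by (simp add: power_mult_distrib sum_distrib_left)
    also have "\<dots> \<le> t^2 * (1/2^n)" by (intro mult_left_mono sum_prob_cellset_sq) auto
    finally show ?thesis .
  qed
  have "prob (\<Inter>n. E n) \<le> t^2 * (1/2^n)" for n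
    by (rule order_trans[OF finite_measure_mono E[of n]]) auto
  moreover have "(\<lambda>n. t^2 * (1/2^n)) \<longlonglongrightarrow> t^2 * 0"
    by (intro tendsto_mult tendsto_const) (auto simp: power_one_over[symmetric] intro: LIMSEQ_realpow_zero)
  ultimately have "prob (\<Inter>n. E n) \<le> 0"
    by (intro tendsto_lowerbound[of _ _ sequentially]) auto
  then have "(\<Inter>n. E n) \<in> null_sets M"
    by (intro null_setsI) (auto simp: emeasure_eq_measure measure_le_0_iff)
  then have "AE \<omega> in M. \<omega> \<notin> (\<Inter>n. E n)" by (rule AE_not_in)
  with AE_finite_idx AE_space show ?thesis
  proof eventually_elim
    case (elim \<omega>)
    then obtain n where n: "\<omega> \<notin> E n" by auto
    have "separated n (idx \<omega>) (\<lambda>i. X i \<omega>)"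
      unfolding separated_def inj_on_def
    proof (intro conjI ballI impI)
      fix i assume "i \<in> idx \<omega>" then show "X i \<omega> \<in> W" by (simp add: idx_def)
    next
      fix i j assume ij: "i \<in> idx \<omega>" "j \<in> idx \<omega>" "cell n (X i \<omega>) = cell n (X j \<omega>)"
      show "i = j"
      proof (rule ccontr)
        assume "i \<noteq> j"
        define c where "c = cell n (X i \<omega>)"
        have sub: "{i, j} \<subseteq> {l. X l \<omega> \<in> cellset n c}" "{l. X l \<omega> \<in> cellset n c} \<subseteq> idx \<omega>"
          using ij W_space by (auto simp: idx_def cellset_def c_def)
        then have "card {i, j} \<le> cnt (cellset n c) \<omega>"
          unfolding cnt_def using elim by (intro card_mono finite_subset[OF sub(2)]) auto
        then have "2 \<le> cnt (cellset n c) \<omega>" using \<open>i \<noteq> j\<close> by simp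
        moreover have "c \<le> 2^n" using ij cell_bound by (auto simp: c_def idx_def)
        ultimately show False using n elim by (auto simp: E_def)
      qed
    qed
    then show ?case ..
  qed
qed

lemma separated_measurable [measurable]:
  assumes "finite I" shows "Measurable.pred (PiM I (\<lambda>_. Q)) (separated n I)"
proof -
  have "Measurable.pred (PiM I (\<lambda>_. Q)) (\<lambda>x. (\<forall>i\<in>I. x i \<in> W) \<and> (\<forall>i\<in>I. \<forall>j\<in>I. cell n (x i) = cell n (x j) \<longrightarrow> i = j))"
    using assms by (intro pred_intros_logic pred_intros_finite) measurable
  then show ?thesis by (simp add: separated_def[abs_def] inj_on_def)
qed

text \<open>The sum of squares bounds the probability that two independent coordinates share a cell,
  which yields a separating level for each pair of labels; nestedness lets the largest of these
  finitely many levels serve all pairs.\<close>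

lemma AE_separated_PiM:
  assumes I: "finite I" shows "AE x in PiM I (\<lambda>_. Q). \<exists>n. separated n I x"
proof -
  let ?P = "PiM I (\<lambda>_. Q)"
  interpret P: prob_space ?P by (intro prob_space_PiM) (rule Q.prob_space_axioms)
  have W: "AE x in ?P. x i \<in> W" if "i \<in> I" for i
    by (rule AE_PiM_component[OF _ that Q_W]) (rule Q.prob_space_axioms)
  have coin: "AE x in ?P. \<exists>n. \<not> (x i \<in> W \<and> x j \<in> W \<and> cell n (x i) = cell n (x j))"
    if ij: "i \<in> I" "j \<in> I" "i \<noteq> j" for i j
  proof -
    define E where "E n = (\<Union>c\<le>2^n. {x\<in>space ?P. x i \<in> cellset n c \<and> x j \<in> cellset n c})" for n :: nat
    have [measurable]: "(\<lambda>x. x i) \<in> measurable ?P Q" "(\<lambda>x. x j) \<in> measurable ?P Q"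
      using ij by measurable
    have [measurable]: "E n \<in> P.events" for n unfolding E_def by measurable
    have E: "P.prob (E n) \<le> 1/2^n" for n
    proof -
      have "P.prob (E n) \<le> (\<Sum>c\<le>2^n. P.prob {x\<in>space ?P. x i \<in> cellset n c \<and> x j \<in> cellset n c})"
        unfolding E_def by (intro P.finite_measure_subadditive_finite) auto
      also have "\<dots> = (\<Sum>c\<le>2^n. (Q.prob (cellset n c))^2)"
      proof (rule sum.cong)
        fix c
        have "ennreal (P.prob {x\<in>space ?P. x i \<in> cellset n c \<and> x j \<in> cellset n c}) = ennreal ((Q.prob (cellset n c))^2)"
          unfolding P.emeasure_eq_measure[symmetric] prob_tuple_coincidence[OF I ij cellset_sets]
          by (simp add: Q.emeasure_eq_measure ennreal_power)
        then show "P.prob {x\<in>space ?P. x i \<in> cellset n c \<and> x j \<in> cellset n c} = (Q.prob (cellset n c))^2"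
          by simp
      qed simp
      also have "\<dots> \<le> 1/2^n" by (rule sum_prob_cellset_sq)
      finally show ?thesis .
    qed
    have "P.prob (\<Inter>n. E n) \<le> 1/2^n" for n
      by (rule order_trans[OF P.finite_measure_mono E[of n]]) auto
    moreover have "(\<lambda>n. 1/2^n :: real) \<longlonglongrightarrow> 0"
      by (auto simp: power_one_over[symmetric] intro: LIMSEQ_realpow_zero)
    ultimately have "P.prob (\<Inter>n. E n) \<le> 0"
      by (intro tendsto_lowerbound[of _ _ sequentially]) auto
    then have "(\<Inter>n. E n) \<in> null_sets ?P"
      by (intro null_setsI) (auto simp: P.emeasure_eq_measure measure_le_0_iff)
    then have "AE x in ?P. x \<notin> (\<Inter>n. E n)" by (rule AE_not_in)
    with AE_space show ?thesis
    proof eventually_elim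
      case (elim x)
      then obtain n where n: "x \<notin> E n" by auto
      have "\<not> (x i \<in> W \<and> x j \<in> W \<and> cell n (x i) = cell n (x j))"
      proof
        assume "x i \<in> W \<and> x j \<in> W \<and> cell n (x i) = cell n (x j)"
        then have "x \<in> E n"
          using elim cell_bound[of "x j" n] W_space by (auto simp: E_def cellset_def)
        with n show False ..
      qed
      then show ?case ..
    qed
  qed
  have "AE x in ?P. \<forall>i\<in>I. x i \<in> W" using W I by (intro AE_finite_allI) auto
  moreover have "AE x in ?P. \<forall>i\<in>I. \<forall>j\<in>I. i \<noteq> j \<longrightarrow> (\<exists>n. \<not> (x i \<in> W \<and> x j \<in> W \<and> cell n (x i) = cell n (x j)))"
    using coin I by (intro AE_finite_allI) (auto intro: AE_I2)
  ultimately show ?thesis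
  proof eventually_elim
    case (elim x)
    have "\<forall>i\<in>I. \<forall>j\<in>I. \<exists>n. i \<noteq> j \<longrightarrow> cell n (x i) \<noteq> cell n (x j)" using elim by blast
    then obtain N where N: "\<And>i j. i \<in> I \<Longrightarrow> j \<in> I \<Longrightarrow> i \<noteq> j \<Longrightarrow> cell (N i j) (x i) \<noteq> cell (N i j) (x j)"
      by metis
    define n where "n = Max ((\<lambda>(i, j). N i j) ` (I \<times> I))"
    have mono: "cell m (x i) = cell m (x j)" if "m \<le> n" "cell n (x i) = cell n (x j)" for m n i j
      using that by (induction rule: dec_induct) (auto dest: cell_mono)
    have "inj_on (\<lambda>i. cell n (x i)) I"
    proof (rule inj_onI, rule ccontr)
      fix i j assume ij: "i \<in> I" "j \<in> I" "cell n (x i) = cell n (x j)" "i \<noteq> j"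
      have "N i j \<le> n" unfolding n_def using ij I by (intro Max_ge) force+
      with mono ij N show False by blast
    qed
    then show ?case using elim by (auto simp: separated_def)
  qed
qed


text \<open>Countability of the tuples gives joint measurability, and the inner integral is then
  measurable by Tonelli.\<close>

lemma tuple_sum_measurable:
  fixes g :: "(nat \<Rightarrow> 'a) \<Rightarrow> ennreal"
  assumes I: "finite I" and g [measurable]: "g \<in> borel_measurable (PiM I (\<lambda>_. Q))"
  shows "(\<lambda>\<omega>. \<integral>\<^sup>+js. g (\<lambda>i\<in>I. X (js i) \<omega>) \<partial>count_space (inj_tuples I UNIV)) \<in> borel_measurable M"
proof -
  let ?J = "inj_tuples I (UNIV :: nat set)"
  interpret J: sigma_finite_measure "count_space ?J"
    by (rule sigma_finite_measure_count_space_countable[OF countable_inj_tuples[OF I]])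
  have [measurable]: "(\<lambda>(js, \<omega>). g (\<lambda>i\<in>I. X (js i) \<omega>)) \<in> borel_measurable (count_space ?J \<Otimes>\<^sub>M M)"
    by (rule measurable_pair_measure_countable1[OF countable_inj_tuples[OF I]])
      (simp add: measurable_compose[OF tuple_measurable[OF I] g])
  show ?thesis
  proof (rule J.borel_measurable_nn_integral)
    show "(\<lambda>(\<omega>, js). g (\<lambda>i\<in>I. X (js i) \<omega>)) \<in> borel_measurable (M \<Otimes>\<^sub>M count_space ?J)"
      using measurable_compose[OF measurable_pair_swap' \<open>(\<lambda>(js, \<omega>). g (\<lambda>i\<in>I. X (js i) \<omega>)) \<in> _\<close>]
      by (simp add: split_beta)
  qed
qed

text \<open>A separated tuple determines exactly one injective assignment of cells to labels, so its
  indicator is a finite sum of indicators of products of disjoint cells, and each summand falls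
  under \<open>campbell_disjoint\<close>.\<close>

lemma campbell_separated:
  fixes I :: "nat set"
  assumes I: "finite I" and h [measurable]: "h \<in> borel_measurable (PiM I (\<lambda>_. Q))"
  shows "(\<integral>\<^sup>+\<omega>. (\<integral>\<^sup>+js. h (\<lambda>i\<in>I. X (js i) \<omega>) * of_bool (separated n I (\<lambda>i\<in>I. X (js i) \<omega>))
      \<partial>count_space (inj_tuples I UNIV)) \<partial>M)
    = ennreal t ^ card I * (\<integral>\<^sup>+x. h x * of_bool (separated n I x) \<partial>PiM I (\<lambda>_. Q))"
proof -
  let ?J = "inj_tuples I (UNIV :: nat set)" and ?P = "PiM I (\<lambda>_. Q)"
  \<comment> \<open>Injectivity makes the cells of one assignment disjoint; their numbers are
    bounded by \<open>cell_bound\<close>, which keeps the set of assignments finite.\<close>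
  define Z where "Z = inj_tuples I {..2^n :: nat}"
  have Z: "finite Z" unfolding Z_def by (intro finite_inj_tuples I) auto
  define c :: "(nat \<Rightarrow> nat) \<Rightarrow> (nat \<Rightarrow> 'a) \<Rightarrow> ennreal"
    where "c z x = (\<Prod>i\<in>I. indicator (cellset n (z i)) (x i))" for z x
  have c_meas [measurable]: "c z \<in> borel_measurable ?P" for z
    unfolding c_def
    by (intro borel_measurable_prod_ennreal measurable_compose[OF measurable_component_singleton]) auto
  have split: "of_bool (separated n I x) = (\<Sum>z\<in>Z. c z x)" if x: "x \<in> I \<rightarrow>\<^sub>E space Q" for x
  proof -
    have c: "c z x = of_bool (\<forall>i\<in>I. x i \<in> W \<and> z i = cell n (x i))" for z
    proof (cases "\<forall>i\<in>I. x i \<in> W \<and> z i = cell n (x i)")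
      case True
      then have "x i \<in> cellset n (z i)" if "i \<in> I" for i using that x by (auto simp: cellset_def)
      then have "c z x = (\<Prod>i\<in>I. 1)" unfolding c_def by (intro prod.cong) auto
      then show ?thesis using True by simp
    next
      case False
      then obtain i where i: "i \<in> I" "x i \<notin> cellset n (z i)" by (auto simp: cellset_def)
      then have "c z x = 0" unfolding c_def using I by (intro prod_zero) (auto simp: indicator_def)
      then show ?thesis using False by auto
    qed
    define z where "z = (\<lambda>i\<in>I. cell n (x i))"
    show ?thesis
    proof (cases "separated n I x")
      case True
      then have "z \<in> Z"
        using cell_bound by (auto simp: Z_def z_def separated_def inj_tuples_def inj_on_def)
      have "(\<Sum>z\<in>Z. c z x) = (\<Sum>z\<in>{z}. c z x)"
      proof (rule sum.mono_neutral_right)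
        show "\<forall>z'\<in>Z - {z}. c z' x = 0"
        proof
          fix z' assume z': "z' \<in> Z - {z}"
          then obtain i where "z' i \<noteq> z i" by auto
          moreover have "i \<in> I" using calculation z' by (auto simp: Z_def z_def inj_tuples_def PiE_iff extensional_def)
          ultimately show "c z' x = 0" by (auto simp: c z_def)
        qed
      qed (use Z \<open>z \<in> Z\<close> in auto)
      also have "\<dots> = 1" using True by (auto simp: c z_def separated_def)
      finally show ?thesis using True by simp
    next
      case False
      have "c z' x = 0" if z': "z' \<in> Z" for z'
      proof -
        have "\<not> (\<forall>i\<in>I. x i \<in> W \<and> z' i = cell n (x i))"
        proof
          assume a: "\<forall>i\<in>I. x i \<in> W \<and> z' i = cell n (x i)"
          have "inj_on z' I" using z' by (simp add: Z_def inj_tuples_def)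
          then have "separated n I x" using a by (auto simp: separated_def inj_on_def)
          with False show False ..
        qed
        then show ?thesis by (simp add: c)
      qed
      then show ?thesis using False by simp
    qed
  qed
  have sp: "X j \<omega> \<in> space Q" if "\<omega> \<in> space M" for j \<omega>
    using measurable_space[OF X that] .
  have cX: "c z (\<lambda>i\<in>I. X (js i) \<omega>) = (\<Prod>i\<in>I. indicator (cellset n (z i)) (X (js i) \<omega>))" for z js \<omega>
    by (simp add: c_def)

  have "(\<integral>\<^sup>+\<omega>. (\<integral>\<^sup>+js. h (\<lambda>i\<in>I. X (js i) \<omega>) * of_bool (separated n I (\<lambda>i\<in>I. X (js i) \<omega>)) \<partial>count_space ?J) \<partial>M)
    = (\<integral>\<^sup>+\<omega>. (\<integral>\<^sup>+js. (\<Sum>z\<in>Z. h (\<lambda>i\<in>I. X (js i) \<omega>) * c z (\<lambda>i\<in>I. X (js i) \<omega>)) \<partial>count_space ?J) \<partial>M)"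
    by (intro nn_integral_cong) (auto simp: split sp sum_distrib_left)
  also have "\<dots> = (\<Sum>z\<in>Z. \<integral>\<^sup>+\<omega>. (\<integral>\<^sup>+js. h (\<lambda>i\<in>I. X (js i) \<omega>) * c z (\<lambda>i\<in>I. X (js i) \<omega>) \<partial>count_space ?J) \<partial>M)"
    by (simp add: nn_integral_sum tuple_sum_measurable[OF I, where g="\<lambda>x. h x * c _ x"])
  also have "\<dots> = (\<Sum>z\<in>Z. ennreal t ^ card I * (\<integral>\<^sup>+x. h x * c z x \<partial>?P))"
  proof (rule sum.cong)
    fix z assume z: "z \<in> Z"
    have "cellset n (z i) \<inter> cellset n (z j) = {}" if "i \<in> I" "j \<in> I" "i \<noteq> j" for i j
      using z that by (intro cellset_disjoint) (auto simp: Z_def inj_tuples_def inj_on_def)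
    then show "(\<integral>\<^sup>+\<omega>. (\<integral>\<^sup>+js. h (\<lambda>i\<in>I. X (js i) \<omega>) * c z (\<lambda>i\<in>I. X (js i) \<omega>) \<partial>count_space ?J) \<partial>M)
      = ennreal t ^ card I * (\<integral>\<^sup>+x. h x * c z x \<partial>?P)"
      unfolding cX unfolding c_def
      by (intro campbell_disjoint I h cellset_sets cellset_W)
  qed simp
  also have "\<dots> = ennreal t ^ card I * (\<integral>\<^sup>+x. (\<Sum>z\<in>Z. h x * c z x) \<partial>?P)"
    by (simp add: nn_integral_sum sum_distrib_left)
  also have "\<dots> = ennreal t ^ card I * (\<integral>\<^sup>+x. h x * of_bool (separated n I x) \<partial>?P)"
    by (intro arg_cong2[where f="(*)"] refl nn_integral_cong) (simp add: split sum_distrib_left space_PiM)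
  finally show ?thesis .
qed

text \<open>This is the formula for the factorial moment measures of a Poisson process. On both
  sides the indicators of separated tuples increase almost surely to 1, and monotone convergence
  removes the separation from \<open>campbell_separated\<close>.\<close>

theorem campbell:
  fixes I :: "nat set"
  assumes I: "finite I" and h [measurable]: "h \<in> borel_measurable (PiM I (\<lambda>_. Q))"
  shows "(\<integral>\<^sup>+\<omega>. (\<Sum>js\<in>inj_tuples I (idx \<omega>). h (\<lambda>i\<in>I. X (js i) \<omega>)) \<partial>M)
    = ennreal t ^ card I * (\<integral>\<^sup>+x. h x \<partial>PiM I (\<lambda>_. Q))"
proof -
  let ?P = "PiM I (\<lambda>_. Q)"
  define F where "F n \<omega> = (\<integral>\<^sup>+js. h (\<lambda>i\<in>I. X (js i) \<omega>) * of_bool (separated n I (\<lambda>i\<in>I. X (js i) \<omega>))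
      \<partial>count_space (inj_tuples I UNIV))" for n \<omega>
  have mono: "of_bool (separated n I x) \<le> (of_bool (separated n' I x) :: ennreal)" if "n \<le> n'" for n n' x
    using separated_mono[OF _ that] by auto
  have F_mono: "F n \<omega> \<le> F n' \<omega>" if "n \<le> n'" for n n' \<omega>
    unfolding F_def by (intro nn_integral_mono mult_left_mono mono that) auto
  have "AE \<omega> in M. (\<Sum>js\<in>inj_tuples I (idx \<omega>). h (\<lambda>i\<in>I. X (js i) \<omega>)) = (SUP n. F n \<omega>)"
    using AE_separated_idx AE_finite_idx
  proof eventually_elim
    case (elim \<omega>)
    then obtain n0 where n0: "separated n0 (idx \<omega>) (\<lambda>i. X i \<omega>)" by blast
    \<comment> \<open>For a fixed outcome the finitely many points are separated from level
      \<open>n0\<close> on, so the sum with the indicator is constant from there.\<close>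
    have F: "F n \<omega> = (\<Sum>js\<in>inj_tuples I (idx \<omega>). h (\<lambda>i\<in>I. X (js i) \<omega>))" if "n0 \<le> n" for n
    proof -
      have sep: "separated n (idx \<omega>) (\<lambda>i. X i \<omega>)" using separated_mono[OF n0 that] .
      have "F n \<omega> = (\<Sum>js\<in>inj_tuples I (idx \<omega>). h (\<lambda>i\<in>I. X (js i) \<omega>) * of_bool (separated n I (\<lambda>i\<in>I. X (js i) \<omega>)))"
        unfolding F_def
      proof (rule nn_integral_inj_tuples[OF I])
        show "finite (idx \<omega>)" using elim by simp
        fix js :: "nat \<Rightarrow> nat" assume "\<not> js ` I \<subseteq> idx \<omega>"
        then show "h (\<lambda>i\<in>I. X (js i) \<omega>) * of_bool (separated n I (\<lambda>i\<in>I. X (js i) \<omega>)) = 0"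
          by (auto simp: separated_def idx_def)
      qed
      also have "\<dots> = (\<Sum>js\<in>inj_tuples I (idx \<omega>). h (\<lambda>i\<in>I. X (js i) \<omega>))"
      proof (rule sum.cong)
        fix js assume js: "js \<in> inj_tuples I (idx \<omega>)"
        have "separated n I (\<lambda>i\<in>I. X (js i) \<omega>)"
          unfolding separated_def inj_on_def
        proof (intro conjI ballI impI)
          fix i assume "i \<in> I" then show "(\<lambda>i\<in>I. X (js i) \<omega>) i \<in> W"
            using js by (auto simp: inj_tuples_def idx_def)
        next
          fix i j assume ij: "i \<in> I" "j \<in> I" "cell n ((\<lambda>i\<in>I. X (js i) \<omega>) i) = cell n ((\<lambda>i\<in>I. X (js i) \<omega>) j)"
          then have "js i \<in> idx \<omega>" "js j \<in> idx \<omega>" using js by (auto simp: inj_tuples_def)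
          then have "js i = js j" using sep ij by (auto simp: separated_def dest: inj_onD)
          then show "i = j" using js ij by (auto simp: inj_tuples_def dest: inj_onD)
        qed
        then show "h (\<lambda>i\<in>I. X (js i) \<omega>) * of_bool (separated n I (\<lambda>i\<in>I. X (js i) \<omega>)) = h (\<lambda>i\<in>I. X (js i) \<omega>)"
          by simp
      qed simp
      finally show ?thesis .
    qed
    show ?case
    proof (rule antisym)
      show "(\<Sum>js\<in>inj_tuples I (idx \<omega>). h (\<lambda>i\<in>I. X (js i) \<omega>)) \<le> (SUP n. F n \<omega>)"
        using F[of n0] by (intro SUP_upper2[of n0]) auto
      show "(SUP n. F n \<omega>) \<le> (\<Sum>js\<in>inj_tuples I (idx \<omega>). h (\<lambda>i\<in>I. X (js i) \<omega>))"
      proof (rule SUP_least)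
        fix n
        have "F n \<omega> \<le> F (max n n0) \<omega>" by (rule F_mono) simp
        also have "\<dots> = (\<Sum>js\<in>inj_tuples I (idx \<omega>). h (\<lambda>i\<in>I. X (js i) \<omega>))" by (rule F) simp
        finally show "F n \<omega> \<le> (\<Sum>js\<in>inj_tuples I (idx \<omega>). h (\<lambda>i\<in>I. X (js i) \<omega>))" .
      qed
    qed
  qed
  then have "(\<integral>\<^sup>+\<omega>. (\<Sum>js\<in>inj_tuples I (idx \<omega>). h (\<lambda>i\<in>I. X (js i) \<omega>)) \<partial>M) = (\<integral>\<^sup>+\<omega>. (SUP n. F n \<omega>) \<partial>M)"
    by (rule nn_integral_cong_AE)
  also have "\<dots> = (SUP n. \<integral>\<^sup>+\<omega>. F n \<omega> \<partial>M)"
  proof (rule nn_integral_monotone_convergence_SUP)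
    show "incseq F" using F_mono by (auto simp: incseq_def le_fun_def)
    show "F n \<in> borel_measurable M" for n
      unfolding F_def[abs_def]
      by (rule tuple_sum_measurable[OF I, where g="\<lambda>x. h x * of_bool (separated n I x)"]) (use I in measurable)
  qed
  also have "\<dots> = (SUP n. ennreal t ^ card I * (\<integral>\<^sup>+x. h x * of_bool (separated n I x) \<partial>?P))"
    unfolding F_def by (simp add: campbell_separated I)
  also have "\<dots> = ennreal t ^ card I * (SUP n. \<integral>\<^sup>+x. h x * of_bool (separated n I x) \<partial>?P)"
    by (rule SUP_mult_left_ennreal[symmetric])
  also have "(SUP n. \<integral>\<^sup>+x. h x * of_bool (separated n I x) \<partial>?P) = (\<integral>\<^sup>+x. (SUP n. h x * of_bool (separated n I x)) \<partial>?P)"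
  proof (rule nn_integral_monotone_convergence_SUP[symmetric])
    show "incseq (\<lambda>n x. h x * of_bool (separated n I x))"
      using mono by (auto simp: incseq_def le_fun_def intro!: mult_left_mono)
    show "(\<lambda>x. h x * of_bool (separated n I x)) \<in> borel_measurable ?P" for n using I by measurable
  qed
  also have "\<dots> = (\<integral>\<^sup>+x. h x \<partial>?P)"
  proof (rule nn_integral_cong_AE)
    show "AE x in ?P. (SUP n. h x * of_bool (separated n I x)) = h x"
      using AE_separated_PiM[OF I]
    proof eventually_elim
      case (elim x)
      then obtain n where "separated n I x" ..
      then have "h x \<le> (SUP n. h x * of_bool (separated n I x))" by (intro SUP_upper2[of n]) auto
      moreover have "(SUP n. h x * of_bool (separated n I x)) \<le> h x" by (intro SUP_least) auto
      ultimately show ?case by (rule antisym[rotated])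
    qed
  qed
  finally show ?thesis .
qed

end

section \<open>Pairs of index sets with prescribed overlap\<close>

lemma card_inj_tuples:
  assumes "finite I" "finite A" shows "card (inj_tuples I A) = (\<Prod>i<card I. card A - i)"
  using card_inj_on_subset_funcset[OF assms order_refl] by (simp add: inj_tuples_def lessThan_atLeast0)

lemma card_inj_tuples_fact:
  assumes "finite I" "finite A" "card I = card A" shows "card (inj_tuples I A) = fact (card I)"
proof -
  have "(\<Prod>i<card I. card A - i) = fact (card I)"
    unfolding assms(3) by (simp add: fact_prod_rev lessThan_atLeast0)
  then show ?thesis using card_inj_tuples[OF assms(1,2)] by simp
qed

definition set_pairs :: "nat \<Rightarrow> nat \<Rightarrow> nat \<Rightarrow> 'i set \<Rightarrow> ('i set \<times> 'i set) set"
  where "set_pairs a b l A = {(J1, J2). J1 \<subseteq> A \<and> J2 \<subseteq> A \<and> card J1 = a \<and> card J2 = b \<and> card (J1 \<inter> J2) = l}"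

lemma finite_set_pairs: "finite A \<Longrightarrow> finite (set_pairs a b l A)"
  by (rule finite_subset[of _ "Pow A \<times> Pow A"]) (auto simp: set_pairs_def)

text \<open>An injection that carries \<open>I1\<close> onto \<open>J1\<close> and \<open>I2\<close>
  onto \<open>J2\<close> is the same as three bijections chosen independently, one between the
  intersections and one between each pair of differences; this gives the three factorials.\<close>

lemma card_inj_tuples_images:
  assumes fin: "finite I1" "finite I2" "finite A" "J1 \<subseteq> A" "J2 \<subseteq> A"
    and card: "card J1 = card I1" "card J2 = card I2" "card (J1 \<inter> J2) = card (I1 \<inter> I2)"
  shows "card {js \<in> inj_tuples (I1 \<union> I2) A. js ` I1 = J1 \<and> js ` I2 = J2}
    = fact (card (I1 \<inter> I2)) * fact (card I1 - card (I1 \<inter> I2)) * fact (card I2 - card (I1 \<inter> I2))"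
proof -
  let ?D = "I1 \<inter> I2" and ?E1 = "I1 - I2" and ?E2 = "I2 - I1"
  let ?D' = "J1 \<inter> J2" and ?E1' = "J1 - J2" and ?E2' = "J2 - J1"
  have finJ: "finite J1" "finite J2" using fin by (auto intro: finite_subset)
  have cE: "card ?E1 = card I1 - card ?D" "card ?E2 = card I2 - card ?D"
    "card ?E1' = card I1 - card ?D" "card ?E2' = card I2 - card ?D"
    using fin finJ card
    by (simp_all add: card_Diff_subset_Int Int_commute)
  let ?L = "{js \<in> inj_tuples (I1 \<union> I2) A. js ` I1 = J1 \<and> js ` I2 = J2}"
  let ?R = "inj_tuples ?D ?D' \<times> inj_tuples ?E1 ?E1' \<times> inj_tuples ?E2 ?E2'"
  let ?f = "\<lambda>js. (restrict js ?D, restrict js ?E1, restrict js ?E2)"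
  let ?g = "\<lambda>(f, g, h). (\<lambda>i\<in>I1 \<union> I2. if i \<in> ?D then f i else if i \<in> I1 then g i else h i)"
  have surj: "f ` I = J" if "f \<in> inj_tuples I J" "finite J" "card I = card J" for f :: "'a \<Rightarrow> 'b" and I J
    using that by (intro card_subset_eq) (auto simp: inj_tuples_def card_image)
  have "bij_betw ?f ?L ?R"
  proof (rule bij_betw_byWitness[where f' = ?g])
    show "\<forall>js\<in>?L. ?g (?f js) = js"
      by (auto simp: inj_tuples_def fun_eq_iff PiE_iff extensional_def)
    show "\<forall>p\<in>?R. ?f (?g p) = p"
      by (auto simp: inj_tuples_def fun_eq_iff PiE_iff extensional_def)
    show "?f ` ?L \<subseteq> ?R"
    proof
      fix p assume "p \<in> ?f ` ?L"
      then obtain js where js: "js \<in> ?L" and p: "p = ?f js" by blast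
      have inj: "inj_on js (I1 \<union> I2)" and im: "js ` I1 = J1" "js ` I2 = J2"
        using js by (auto simp: inj_tuples_def)
      \<comment> \<open>Injectivity on the whole of \<open>I1 \<union> I2\<close> makes each image
        mark exactly its own labels, so the three blocks are respected.\<close>
      have "js i \<in> J1 \<longleftrightarrow> i \<in> I1" "js i \<in> J2 \<longleftrightarrow> i \<in> I2" if "i \<in> I1 \<union> I2" for i
        using inj that unfolding im[symmetric] by (auto dest: inj_onD)
      then show "p \<in> ?R"
        unfolding p using inj by (auto simp: inj_tuples_def inj_on_def)
    qed
    show "?g ` ?R \<subseteq> ?L"
    proof
      fix js assume "js \<in> ?g ` ?R"
      then obtain f g h where f: "f \<in> inj_tuples ?D ?D'" and g: "g \<in> inj_tuples ?E1 ?E1'"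
        and h: "h \<in> inj_tuples ?E2 ?E2'" and js: "js = ?g (f, g, h)" by blast
      have v: "js i = f i" if "i \<in> ?D" for i using that by (simp add: js)
      have v1: "js i = g i" if "i \<in> ?E1" for i using that by (simp add: js)
      have v2: "js i = h i" if "i \<in> ?E2" for i using that by (simp add: js)
      have im: "f ` ?D = ?D'" "g ` ?E1 = ?E1'" "h ` ?E2 = ?E2'"
        using surj[OF f] surj[OF g] surj[OF h] finJ card(3) cE by auto
      have im': "js ` ?D = ?D'" "js ` ?E1 = ?E1'" "js ` ?E2 = ?E2'"
        using im v v1 v2 by (auto simp: image_def)
      have I: "I1 = ?D \<union> ?E1" "I2 = ?D \<union> ?E2" by auto
      have im1: "js ` I1 = J1" by (subst I(1)) (auto simp: image_Un im' simp del: js)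
      have im2: "js ` I2 = J2" by (subst I(2)) (auto simp: image_Un im' simp del: js)
      have injs: "inj_on js ?D" "inj_on js ?E1" "inj_on js ?E2"
        using f g h v v1 v2 by (auto simp: inj_tuples_def inj_on_def)
      have "inj_on js (?D \<union> (?E1 \<union> ?E2))"
        using im' injs by (subst inj_on_Un, subst inj_on_Un) blast
      moreover have "?D \<union> (?E1 \<union> ?E2) = I1 \<union> I2" by auto
      ultimately have "inj_on js (I1 \<union> I2)" by simp
      moreover have "js \<in> extensional (I1 \<union> I2)" by (simp add: js)
      moreover have "js ` (I1 \<union> I2) \<subseteq> A" using im1 im2 fin by (auto simp: image_Un)
      ultimately show "js \<in> ?L" using im1 im2 by (auto simp: inj_tuples_def PiE_iff)
    qed
  qed
  then have "card ?L = card ?R" by (rule bij_betw_same_card)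
  then show ?thesis using fin finJ card cE by (simp add: card_cartesian_product card_inj_tuples_fact)
qed

text \<open>Translates between tuples, to which the Campbell formula applies, and pairs of index
  sets, over which products of U-statistics run. Every pair has the same number of
  preimages.\<close>

lemma sum_inj_tuples_images:
  fixes \<phi> :: "'i set \<Rightarrow> 'i set \<Rightarrow> 'c::comm_semiring_1"
  assumes fin: "finite I1" "finite I2" "finite A"
  shows "(\<Sum>js\<in>inj_tuples (I1 \<union> I2) A. \<phi> (js ` I1) (js ` I2))
    = of_nat (fact (card (I1 \<inter> I2)) * fact (card I1 - card (I1 \<inter> I2)) * fact (card I2 - card (I1 \<inter> I2)))
      * (\<Sum>(J1, J2)\<in>set_pairs (card I1) (card I2) (card (I1 \<inter> I2)) A. \<phi> J1 J2)"
proof -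
  let ?T = "set_pairs (card I1) (card I2) (card (I1 \<inter> I2)) A"
  let ?c = "fact (card (I1 \<inter> I2)) * fact (card I1 - card (I1 \<inter> I2)) * fact (card I2 - card (I1 \<inter> I2)) :: nat"
  have sub: "(\<lambda>js. (js ` I1, js ` I2)) ` inj_tuples (I1 \<union> I2) A \<subseteq> ?T"
  proof (rule image_subsetI)
    fix js assume js: "js \<in> inj_tuples (I1 \<union> I2) A"
    then have inj: "inj_on js (I1 \<union> I2)" by (simp add: inj_tuples_def)
    have "card (js ` I1) = card I1" "card (js ` I2) = card I2" "card (js ` (I1 \<inter> I2)) = card (I1 \<inter> I2)"
      by (intro card_image inj_on_subset[OF inj]; blast)+
    moreover have "js ` (I1 \<inter> I2) = js ` I1 \<inter> js ` I2"
      using inj by (intro inj_on_image_Int[of js "I1 \<union> I2"]) auto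
    ultimately show "(js ` I1, js ` I2) \<in> ?T"
      using js by (auto simp: set_pairs_def inj_tuples_def)
  qed
  have "(\<Sum>js\<in>inj_tuples (I1 \<union> I2) A. \<phi> (js ` I1) (js ` I2))
    = (\<Sum>p\<in>?T. \<Sum>js\<in>{js\<in>inj_tuples (I1 \<union> I2) A. (js ` I1, js ` I2) = p}. \<phi> (js ` I1) (js ` I2))"
    using fin sub by (intro sum.group[symmetric] finite_inj_tuples finite_set_pairs) auto
  also have "\<dots> = (\<Sum>p\<in>?T. of_nat ?c * (case p of (J1, J2) \<Rightarrow> \<phi> J1 J2))"
  proof (rule sum.cong)
    fix p assume p: "p \<in> ?T"
    obtain J1 J2 where [simp]: "p = (J1, J2)" by fastforce
    have "(\<Sum>js\<in>{js\<in>inj_tuples (I1 \<union> I2) A. (js ` I1, js ` I2) = p}. \<phi> (js ` I1) (js ` I2))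
      = (\<Sum>js\<in>{js\<in>inj_tuples (I1 \<union> I2) A. js ` I1 = J1 \<and> js ` I2 = J2}. \<phi> J1 J2)"
      by (rule sum.cong) auto
    also have "\<dots> = of_nat ?c * \<phi> J1 J2"
      using p fin by (simp add: card_inj_tuples_images set_pairs_def)
    finally show "(\<Sum>js\<in>{js\<in>inj_tuples (I1 \<union> I2) A. (js ` I1, js ` I2) = p}. \<phi> (js ` I1) (js ` I2))
      = of_nat ?c * (case p of (J1, J2) \<Rightarrow> \<phi> J1 J2)" by simp
  qed simp
  also have "\<dots> = of_nat ?c * (\<Sum>(J1, J2)\<in>?T. \<phi> J1 J2)" by (simp add: sum_distrib_left split_beta)
  finally show ?thesis .
qed

text \<open>Two m-sets that share at least two elements have a union of at most 2m - 2 elements. The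
  pair is encoded by a list of that length and two sets of positions, with 2^(2(2m-2)) \<le> 16^m
  choices for the positions.\<close>

lemma card_set_pairs_overlap:
  assumes A: "finite A"
  shows "card {(J1, J2). J1 \<subseteq> A \<and> J2 \<subseteq> A \<and> card J1 = m \<and> card J2 = m \<and> 2 \<le> card (J1 \<inter> J2)}
    \<le> 16 ^ m * card A ^ (2 * m - 2)" (is "card ?P \<le> _")
proof (cases "A = {}")
  case True
  then have "?P = {}" by auto
  then show ?thesis by (simp only: card.empty)
next
  case False
  let ?n = "2 * m - 2"
  let ?X = "{xs. set xs \<subseteq> A \<and> length xs = ?n} \<times> Pow {..<?n} \<times> Pow {..<?n}"
  let ?f = "\<lambda>(xs, S, T). ((!) xs ` S, (!) xs ` T)"
  have finX: "finite ?X" using A by (auto intro: finite_lists_length_eq)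
  have "?P \<subseteq> ?f ` ?X"
  proof
    fix p assume "p \<in> ?P"
    then obtain J1 J2 where p: "p = (J1, J2)"
      and J: "J1 \<subseteq> A" "J2 \<subseteq> A" "card J1 = m" "card J2 = m" "2 \<le> card (J1 \<inter> J2)" by auto
    have fin: "finite J1" "finite J2" using J A by (auto intro: finite_subset)
    have "card (J1 \<union> J2) \<le> ?n" using card_Un_Int[OF fin] J by linarith
    obtain ys where ys: "set ys = J1 \<union> J2" "distinct ys" using fin finite_distinct_list[of "J1 \<union> J2"] by auto
    then have len: "length ys \<le> ?n" using \<open>card (J1 \<union> J2) \<le> ?n\<close> distinct_card[of ys] by simp
    obtain a where a: "a \<in> A" using False by auto
    \<comment> \<open>Padding with a fixed element makes all lists equally long; the positions
      chosen below avoid the padding.\<close>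
    define xs where "xs = ys @ replicate (?n - length ys) a"
    have xs: "set xs \<subseteq> A" "length xs = ?n" using ys J len a by (auto simp: xs_def)
    have "\<exists>S\<subseteq>{..<?n}. (!) xs ` S = J" if "J \<subseteq> J1 \<union> J2" for J
    proof (intro exI conjI)
      show "{i. i < length ys \<and> ys ! i \<in> J} \<subseteq> {..<?n}" using len by auto
      have "(!) xs ` {i. i < length ys \<and> ys ! i \<in> J} = (!) ys ` {i. i < length ys \<and> ys ! i \<in> J}"
        by (rule image_cong) (auto simp: xs_def nth_append)
      also have "\<dots> = J" using that ys(1) by (auto simp: in_set_conv_nth image_iff subset_iff) (metis in_set_conv_nth Un_iff)
      finally show "(!) xs ` {i. i < length ys \<and> ys ! i \<in> J} = J" .
    qed
    from this[of J1] this[of J2] obtain S T where "S \<subseteq> {..<?n}" "T \<subseteq> {..<?n}" "(!) xs ` S = J1" "(!) xs ` T = J2"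
      by auto
    then show "p \<in> ?f ` ?X" using xs p by (intro image_eqI[of _ _ "(xs, S, T)"]) auto
  qed
  then have "card ?P \<le> card ?X" using finX by (meson card_image_le card_mono finite_imageI order_trans)
  also have "\<dots> = card A ^ ?n * (2 ^ ?n * 2 ^ ?n)"
    using A by (simp add: card_cartesian_product card_lists_length_eq card_Pow)
  also have "2 ^ ?n * 2 ^ ?n = (2 ^ (?n + ?n) :: nat)" by (simp add: power_add)
  also have "\<dots> \<le> 2 ^ (4 * m)" by (intro power_increasing) auto
  also have "(2 :: nat) ^ (4 * m) = 16 ^ m" by (simp add: power_mult)
  finally show ?thesis by (simp add: mult.commute)
qed

text \<open>The Campbell formula computes factorial moments, while integrability calls for powers.
  If \<open>A\<close> has at least 2j elements, each factor \<open>card A - i\<close> is at least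
  half of \<open>card A\<close>; otherwise the constant term takes over.\<close>

lemma power_le_card_inj_tuples:
  assumes "finite A"
  shows "card A ^ j \<le> 2 ^ j * card (inj_tuples {..<j} A) + (2 * j) ^ j"
proof (cases "card A \<ge> 2 * j")
  case True
  have "card A ^ j = (\<Prod>i<j. card A)" by simp
  also have "\<dots> \<le> (\<Prod>i<j. 2 * (card A - i))" using True by (intro prod_mono) auto
  also have "\<dots> = 2 ^ j * card (inj_tuples {..<j} A)"
    using assms by (simp add: card_inj_tuples prod.distrib)
  finally show ?thesis by simp
next
  case False
  then have "card A ^ j \<le> (2 * j) ^ j" by (intro power_mono) auto
  then show ?thesis by simp
qed

section \<open>Moments of Poisson U-statistics\<close>

context poisson_window
begin

(* On the null event of infinitely many points in the window, pts is set to the empty set, so that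
   sums over pts and over its subsets are always finite. *)
definition pts :: "'w \<Rightarrow> nat set" where "pts \<omega> = (if finite (idx \<omega>) then idx \<omega> else {})"

lemma finite_pts [simp]: "finite (pts \<omega>)" by (simp add: pts_def)

lemma AE_pts: "AE \<omega> in M. pts \<omega> = idx \<omega>"
  using AE_finite_idx by eventually_elim (simp add: pts_def)

text \<open>Finiteness of \<open>idx\<close> is the event that the window count is not infinite, so
  membership of a single index is a measurable event, and a fibre of \<open>pts\<close> is a
  countable intersection of such events.\<close>

lemma pts_measurable: "pts \<in> measurable M (count_space {A. finite A})"
proof (subst measurable_count_space_eq_countable)
  show "countable {A :: nat set. finite A}" by (rule countable_Collect_finite)
  have fin: "finite (idx \<omega>) \<longleftrightarrow> point_count X W \<omega> \<noteq> \<infinity>" for \<omega>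
    using point_count_infinite[of X \<omega> W] cnt_point_count[of \<omega> W] by (auto simp: idx_def)
  have mem: "j \<in> pts \<omega> \<longleftrightarrow> X j \<omega> \<in> W \<and> point_count X W \<omega> \<noteq> \<infinity>" for j \<omega>
    unfolding pts_def fin[symmetric] by (simp add: idx_def)
  have "pts -` {A} \<inter> space M \<in> events" for A
  proof -
    have "pts -` {A} \<inter> space M = {\<omega>\<in>space M. \<forall>j. (X j \<omega> \<in> W \<and> point_count X W \<omega> \<noteq> \<infinity>) = (j \<in> A)}"
      unfolding mem[symmetric] by (auto simp: set_eq_iff)
    also have "\<dots> \<in> events" by measurable
    finally show ?thesis .
  qed
  then show "pts \<in> space M \<rightarrow> {A. finite A} \<and> (\<forall>a\<in>{A. finite A}. pts -` {a} \<inter> space M \<in> events)" by simp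
qed

text \<open>The finite sets of naturals are countable, so measurability can be checked with the
  random index set held fixed.\<close>

lemma fun_pts_measurable:
  assumes "\<And>A. finite A \<Longrightarrow> f A \<in> measurable M N"
  shows "(\<lambda>\<omega>. f (pts \<omega>) \<omega>) \<in> measurable M N"
  by (rule measurable_compose_countable'[OF _ pts_measurable countable_Collect_finite]) (use assms in auto)

text \<open>Depending on a set of points, a kernel is symmetric by construction. The bounds hold for
  every set, so that sums over the points are bounded path by path; measurability is asked only of
  evaluations at a labelled points.\<close>

definition kernel :: "nat \<Rightarrow> real \<Rightarrow> ('a set \<Rightarrow> real) \<Rightarrow> bool"
  where "kernel a C F \<longleftrightarrow> (\<forall>Y. 0 \<le> F Y \<and> F Y \<le> C) \<and>
    (\<forall>J :: nat set. finite J \<and> card J = a \<longrightarrow> (\<lambda>x. F (x ` J)) \<in> borel_measurable (PiM J (\<lambda>_. Q)))"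

lemma kernel_bound: "kernel a C F \<Longrightarrow> 0 \<le> F Y" "kernel a C F \<Longrightarrow> F Y \<le> C"
  by (auto simp: kernel_def)

lemma kernel_nonneg: "kernel a C F \<Longrightarrow> 0 \<le> C" using kernel_bound[of a C F undefined] by linarith

lemma kernel_measurable:
  fixes I J :: "nat set"
  assumes F: "kernel a C F" and J: "finite J" "card J = a" "J \<subseteq> I"
  shows "(\<lambda>x. F (x ` J)) \<in> borel_measurable (PiM I (\<lambda>_. Q))"
proof -
  have "(\<lambda>x. F (restrict x J ` J)) \<in> borel_measurable (PiM I (\<lambda>_. Q))"
    using F J by (intro measurable_compose[OF measurable_restrict_subset[OF J(3)]]) (auto simp: kernel_def)
  then show ?thesis by simp
qed

definition img :: "nat set \<Rightarrow> 'w \<Rightarrow> 'a set" where "img J \<omega> = (\<lambda>j. X j \<omega>) ` J"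

lemma kernel_img_measurable:
  assumes F: "kernel a C F" and J: "finite J" "card J = a"
  shows "(\<lambda>\<omega>. F (img J \<omega>)) \<in> borel_measurable M"
proof -
  have "(\<lambda>\<omega>. \<lambda>i\<in>J. X i \<omega>) \<in> measurable M (PiM J (\<lambda>_. Q))" by (rule measurable_restrict) simp
  from measurable_compose[OF this kernel_measurable[OF F J order_refl]]
  show ?thesis by (simp add: img_def)
qed

lemma campbell_bounded:
  fixes I :: "nat set" and h :: "(nat \<Rightarrow> 'a) \<Rightarrow> real"
  assumes I: "finite I" and h [measurable]: "h \<in> borel_measurable (PiM I (\<lambda>_. Q))"
    and bd: "\<And>x. 0 \<le> h x" "\<And>x. h x \<le> C"
  shows "has_bochner_integral M (\<lambda>\<omega>. \<Sum>js\<in>inj_tuples I (pts \<omega>). h (\<lambda>i\<in>I. X (js i) \<omega>))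
    (t ^ card I * (\<integral>x. h x \<partial>PiM I (\<lambda>_. Q)))"
proof (rule has_bochner_integral_nn_integral)
  let ?P = "PiM I (\<lambda>_. Q)"
  interpret P: prob_space ?P by (intro prob_space_PiM) (rule Q.prob_space_axioms)
  show "(\<lambda>\<omega>. \<Sum>js\<in>inj_tuples I (pts \<omega>). h (\<lambda>i\<in>I. X (js i) \<omega>)) \<in> borel_measurable M"
  proof (rule fun_pts_measurable)
    fix A :: "nat set" assume "finite A"
    show "(\<lambda>\<omega>. \<Sum>js\<in>inj_tuples I A. h (\<lambda>i\<in>I. X (js i) \<omega>)) \<in> borel_measurable M"
      by (intro borel_measurable_sum measurable_compose[OF _ h] measurable_restrict) simp
  qed
  have int: "integrable ?P h"
    by (rule P.integrable_const_bound[where B=C]) (use bd in auto)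
  have "(\<integral>\<^sup>+\<omega>. ennreal (\<Sum>js\<in>inj_tuples I (pts \<omega>). h (\<lambda>i\<in>I. X (js i) \<omega>)) \<partial>M)
    = (\<integral>\<^sup>+\<omega>. (\<Sum>js\<in>inj_tuples I (idx \<omega>). ennreal (h (\<lambda>i\<in>I. X (js i) \<omega>))) \<partial>M)"
    using AE_pts by (intro nn_integral_cong_AE) (auto simp: bd)
  also have "\<dots> = ennreal t ^ card I * (\<integral>\<^sup>+x. ennreal (h x) \<partial>?P)"
    by (rule campbell[OF I, where h="\<lambda>x. ennreal (h x)"]) simp
  also have "\<dots> = ennreal (t ^ card I * (\<integral>x. h x \<partial>?P))"
    using t bd int by (simp add: nn_integral_eq_integral ennreal_power ennreal_mult)
  finally show "(\<integral>\<^sup>+\<omega>. ennreal (\<Sum>js\<in>inj_tuples I (pts \<omega>). h (\<lambda>i\<in>I. X (js i) \<omega>)) \<partial>M)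
    = ennreal (t ^ card I * (\<integral>x. h x \<partial>?P))" .
qed (use t bd in \<open>auto intro!: sum_nonneg mult_nonneg_nonneg integral_nonneg_AE\<close>)

definition pairsum :: "nat \<Rightarrow> nat \<Rightarrow> nat \<Rightarrow> ('a set \<Rightarrow> real) \<Rightarrow> ('a set \<Rightarrow> real) \<Rightarrow> 'w \<Rightarrow> real"
  where "pairsum a b l F G \<omega> = (\<Sum>(J1, J2)\<in>set_pairs a b l (pts \<omega>). F (img J1 \<omega>) * G (img J2 \<omega>))"

text \<open>The union of the index sets carries a + b - l labels, hence the power of t, and every
  pair of sets with overlap l arises from l! (a-l)! (b-l)! tuples. \<open>I1\<close> and
  \<open>I2\<close> are representatives that may be chosen at convenience.\<close>

lemma pairsum_integral:
  fixes I1 I2 :: "nat set"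
  assumes F: "kernel a C F" and G: "kernel b D G" and I: "finite I1" "finite I2" "card I1 = a" "card I2 = b"
    and l: "card (I1 \<inter> I2) = l"
  shows "has_bochner_integral M (pairsum a b l F G)
    (t ^ (a + b - l) / (fact l * fact (a - l) * fact (b - l)) * (\<integral>x. F (x ` I1) * G (x ` I2) \<partial>PiM (I1 \<union> I2) (\<lambda>_. Q)))"
proof -
  let ?c = "fact l * fact (a - l) * fact (b - l) :: real"
  have [measurable]: "(\<lambda>x. F (x ` I1)) \<in> borel_measurable (PiM (I1 \<union> I2) (\<lambda>_. Q))"
    "(\<lambda>x. G (x ` I2)) \<in> borel_measurable (PiM (I1 \<union> I2) (\<lambda>_. Q))"
    using F G I by (auto intro!: kernel_measurable)
  have card: "card (I1 \<union> I2) = a + b - l" using card_Un_Int[OF I(1,2)] I l by simp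
  have img: "(\<lambda>i\<in>I1 \<union> I2. X (js i) \<omega>) ` I1 = img (js ` I1) \<omega>" "(\<lambda>i\<in>I1 \<union> I2. X (js i) \<omega>) ` I2 = img (js ` I2) \<omega>" for js \<omega>
    by (auto simp: img_def)
  have "has_bochner_integral M (\<lambda>\<omega>. \<Sum>js\<in>inj_tuples (I1 \<union> I2) (pts \<omega>). F ((\<lambda>i\<in>I1 \<union> I2. X (js i) \<omega>) ` I1) * G ((\<lambda>i\<in>I1 \<union> I2. X (js i) \<omega>) ` I2))
    (t ^ card (I1 \<union> I2) * (\<integral>x. F (x ` I1) * G (x ` I2) \<partial>PiM (I1 \<union> I2) (\<lambda>_. Q)))"
  proof (rule campbell_bounded[where C="C * D"])
    show "0 \<le> F (x ` I1) * G (x ` I2)" for x using kernel_bound[OF F] kernel_bound[OF G] by simp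
    show "F (x ` I1) * G (x ` I2) \<le> C * D" for x
      using kernel_bound[OF F] kernel_bound[OF G] kernel_nonneg[OF F] by (intro mult_mono) auto
  qed (use I in auto)
  also have "(\<lambda>\<omega>. \<Sum>js\<in>inj_tuples (I1 \<union> I2) (pts \<omega>). F ((\<lambda>i\<in>I1 \<union> I2. X (js i) \<omega>) ` I1) * G ((\<lambda>i\<in>I1 \<union> I2. X (js i) \<omega>) ` I2))
    = (\<lambda>\<omega>. ?c * pairsum a b l F G \<omega>)"
    unfolding img pairsum_def
    by (subst sum_inj_tuples_images[where \<phi>="\<lambda>J1 J2. F (img J1 _) * G (img J2 _)"]) (use I l in \<open>auto simp: fun_eq_iff\<close>)
  finally have "has_bochner_integral M (\<lambda>\<omega>. ?c * pairsum a b l F G \<omega>)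
    (t ^ (a + b - l) * (\<integral>x. F (x ` I1) * G (x ` I2) \<partial>PiM (I1 \<union> I2) (\<lambda>_. Q)))"
    unfolding card .
  from has_bochner_integral_mult_right[OF this, of "1 / ?c"] show ?thesis by simp
qed

text \<open>With the constant function 1 the Campbell formula gives the factorial moment
  \<open>t ^ j\<close> exactly. The resulting bound on powers is the integrable majorant for
  products of U-statistics and estimates the overlaps of size at least two.\<close>

lemma card_pts_power:
  "integrable M (\<lambda>\<omega>. real (card (pts \<omega>)) ^ j)"
  "expectation (\<lambda>\<omega>. real (card (pts \<omega>)) ^ j) \<le> 2 ^ j * t ^ j + (2 * real j) ^ j"
proof -
  interpret P: prob_space "PiM {..<j} (\<lambda>_. Q)" by (intro prob_space_PiM) (rule Q.prob_space_axioms)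
  have "has_bochner_integral M (\<lambda>\<omega>. \<Sum>js\<in>inj_tuples {..<j} (pts \<omega>). 1 :: real)
    (t ^ card {..<j} * (\<integral>x. 1 \<partial>PiM {..<j} (\<lambda>_. Q)))"
    by (rule campbell_bounded[where h="\<lambda>_. 1" and C=1]) auto
  then have F: "has_bochner_integral M (\<lambda>\<omega>. real (card (inj_tuples {..<j} (pts \<omega>)))) (t ^ j)"
    by (simp add: P.prob_space)
  have le: "real (card (pts \<omega>)) ^ j \<le> 2 ^ j * real (card (inj_tuples {..<j} (pts \<omega>))) + (2 * real j) ^ j" for \<omega>
  proof -
    have "real (card (pts \<omega>) ^ j) \<le> real (2 ^ j * card (inj_tuples {..<j} (pts \<omega>)) + (2 * j) ^ j)"
      by (intro of_nat_mono power_le_card_inj_tuples) simp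
    then show ?thesis by simp
  qed
  have B: "integrable M (\<lambda>\<omega>. 2 ^ j * real (card (inj_tuples {..<j} (pts \<omega>))) + (2 * real j) ^ j)"
    using F by (auto simp: has_bochner_integral_iff)
  show int: "integrable M (\<lambda>\<omega>. real (card (pts \<omega>)) ^ j)"
  proof (rule Bochner_Integration.integrable_bound[OF B])
    show "(\<lambda>\<omega>. real (card (pts \<omega>)) ^ j) \<in> borel_measurable M"
      by (rule fun_pts_measurable[where f="\<lambda>A _. real (card A) ^ j"]) simp
    show "AE \<omega> in M. norm (real (card (pts \<omega>)) ^ j) \<le>
      norm (2 ^ j * real (card (inj_tuples {..<j} (pts \<omega>))) + (2 * real j) ^ j)"
      using le by (intro AE_I2) (simp add: abs_of_nonneg del: of_nat_power)
  qed
  have "expectation (\<lambda>\<omega>. real (card (pts \<omega>)) ^ j) \<le> expectation (\<lambda>\<omega>. 2 ^ j * real (card (inj_tuples {..<j} (pts \<omega>))) + (2 * real j) ^ j)"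
    using le by (intro integral_mono int B) auto
  also have "\<dots> = 2 ^ j * t ^ j + (2 * real j) ^ j"
    using F by (simp add: has_bochner_integral_iff prob_space)
  finally show "expectation (\<lambda>\<omega>. real (card (pts \<omega>)) ^ j) \<le> 2 ^ j * t ^ j + (2 * real j) ^ j" .
qed

text \<open>Summing over sets instead of ordered tuples absorbs the factor 1 / a!.\<close>

definition ustat :: "nat \<Rightarrow> ('a set \<Rightarrow> real) \<Rightarrow> 'w \<Rightarrow> real"
  where "ustat a F \<omega> = (\<Sum>J | J \<subseteq> pts \<omega> \<and> card J = a. F (img J \<omega>))"

lemma ustat_measurable [measurable (raw)]:
  assumes "kernel a C F" shows "ustat a F \<in> borel_measurable M"
  unfolding ustat_def[abs_def]
proof (rule fun_pts_measurable)
  fix A :: "nat set" assume "finite A"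
  then show "(\<lambda>\<omega>. \<Sum>J | J \<subseteq> A \<and> card J = a. F (img J \<omega>)) \<in> borel_measurable M"
    using assms by (intro borel_measurable_sum kernel_img_measurable) (auto intro: finite_subset)
qed

lemma ustat_bound:
  assumes F: "kernel a C F" shows "0 \<le> ustat a F \<omega>" "ustat a F \<omega> \<le> C * real (card (pts \<omega>)) ^ a"
proof -
  show "0 \<le> ustat a F \<omega>" unfolding ustat_def by (intro sum_nonneg kernel_bound[OF F])
  have "ustat a F \<omega> \<le> (\<Sum>J | J \<subseteq> pts \<omega> \<and> card J = a. C)"
    unfolding ustat_def by (intro sum_mono kernel_bound[OF F])
  also have "\<dots> = C * real (card (pts \<omega>) choose a)" by (simp add: n_subsets)
  also have "\<dots> \<le> C * real (card (pts \<omega>) ^ a)"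
    using kernel_nonneg[OF F] binomial_le_pow[of a "card (pts \<omega>)"]
    by (intro mult_left_mono of_nat_mono) (cases "a \<le> card (pts \<omega>)"; auto simp: binomial_eq_0)+
  finally show "ustat a F \<omega> \<le> C * real (card (pts \<omega>)) ^ a" by simp
qed

lemma ustat_integrable:
  assumes F: "kernel a C F" and G: "kernel b D G"
  shows "integrable M (ustat a F)" "integrable M (\<lambda>\<omega>. ustat a F \<omega> * ustat b G \<omega>)"
proof -
  show "integrable M (ustat a F)"
    by (rule Bochner_Integration.integrable_bound[OF integrable_mult_right[OF card_pts_power(1)[of a], of C]])
      (use ustat_bound[OF F] ustat_measurable[OF F] in \<open>auto intro!: order_trans[OF ustat_bound(2)[OF F] abs_ge_self]\<close>)
  have le: "ustat a F \<omega> * ustat b G \<omega> \<le> C * D * real (card (pts \<omega>)) ^ (a + b)" for \<omega>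
    using mult_mono[OF ustat_bound(2)[OF F] ustat_bound(2)[OF G] _ ustat_bound(1)[OF G], of \<omega> \<omega>] kernel_nonneg[OF F]
    by (simp add: power_add mult_ac)
  show "integrable M (\<lambda>\<omega>. ustat a F \<omega> * ustat b G \<omega>)"
    by (rule Bochner_Integration.integrable_bound[OF integrable_mult_right[OF card_pts_power(1)[of "a + b"], of "C * D"]])
      (use le ustat_bound(1)[OF F] ustat_bound(1)[OF G] ustat_measurable[OF F] ustat_measurable[OF G]
        kernel_nonneg[OF F] kernel_nonneg[OF G] in \<open>auto simp: abs_mult intro!: AE_I2\<close>)
qed

lemma ustat_mult:
  "ustat a F \<omega> * ustat b G \<omega> = pairsum a b 0 F G \<omega> + pairsum a b 1 F G \<omega> +
    (\<Sum>(J1, J2) | J1 \<subseteq> pts \<omega> \<and> J2 \<subseteq> pts \<omega> \<and> card J1 = a \<and> card J2 = b \<and> 2 \<le> card (J1 \<inter> J2).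
      F (img J1 \<omega>) * G (img J2 \<omega>))"
proof -
  let ?S = "\<lambda>P. {(J1, J2). J1 \<subseteq> pts \<omega> \<and> J2 \<subseteq> pts \<omega> \<and> card J1 = a \<and> card J2 = b \<and> P (card (J1 \<inter> J2))}"
  let ?f = "\<lambda>(J1, J2). F (img J1 \<omega>) * G (img J2 \<omega>)"
  have fin: "finite (?S P)" for P by (rule finite_subset[of _ "Pow (pts \<omega>) \<times> Pow (pts \<omega>)"]) auto
  have "ustat a F \<omega> * ustat b G \<omega> = (\<Sum>p\<in>{J. J \<subseteq> pts \<omega> \<and> card J = a} \<times> {J. J \<subseteq> pts \<omega> \<and> card J = b}. ?f p)"
    unfolding ustat_def by (simp add: sum_product sum.cartesian_product)
  also have "{J. J \<subseteq> pts \<omega> \<and> card J = a} \<times> {J. J \<subseteq> pts \<omega> \<and> card J = b} = (?S (\<lambda>l. l = 0) \<union> ?S (\<lambda>l. l = 1)) \<union> ?S (\<lambda>l. 2 \<le> l)"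
    by auto
  also have "(\<Sum>p\<in>\<dots>. ?f p) = (\<Sum>p\<in>?S (\<lambda>l. l = 0). ?f p) + (\<Sum>p\<in>?S (\<lambda>l. l = 1). ?f p) + (\<Sum>p\<in>?S (\<lambda>l. 2 \<le> l). ?f p)"
  proof -
    have d: "?S (\<lambda>l. l = 0) \<inter> ?S (\<lambda>l. l = 1) = {}" "(?S (\<lambda>l. l = 0) \<union> ?S (\<lambda>l. l = 1)) \<inter> ?S (\<lambda>l. 2 \<le> l) = {}"
      by auto
    show ?thesis
      using sum.union_disjoint[OF finite_UnI[OF fin fin] fin d(2), of ?f] sum.union_disjoint[OF fin fin d(1), of ?f]
      by simp
  qed
  finally show ?thesis by (simp add: pairsum_def set_pairs_def)
qed

section \<open>Integrals of kernels and their projections\<close>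

lemma prob_space_PQ: "prob_space (PiM (I :: nat set) (\<lambda>_. Q))"
  by (intro prob_space_PiM) (rule Q.prob_space_axioms)

lemma integrable_PQ:
  assumes "h \<in> borel_measurable (PiM (I :: nat set) (\<lambda>_. Q))" "\<And>x. \<bar>h x\<bar> \<le> (C :: real)"
  shows "integrable (PiM I (\<lambda>_. Q)) h"
proof -
  interpret P: prob_space "PiM I (\<lambda>_. Q)" by (rule prob_space_PQ)
  show ?thesis by (rule P.integrable_const_bound[where B=C]) (use assms in auto)
qed

text \<open>A bijection of the labels carries one product of copies of \<open>Q\<close> to the
  other, so only the number of labels matters.\<close>

lemma integral_image_reindex:
  fixes \<phi> :: "'a set \<Rightarrow> real" and I K :: "nat set"
  assumes "finite I" "finite K" "card I = card K"
    and \<phi>: "(\<lambda>x. \<phi> (x ` I)) \<in> borel_measurable (PiM I (\<lambda>_. Q))"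
  shows "(\<integral>x. \<phi> (x ` K) \<partial>PiM K (\<lambda>_. Q)) = (\<integral>x. \<phi> (x ` I) \<partial>PiM I (\<lambda>_. Q))"
proof -
  obtain f where f: "bij_betw f I K" using finite_same_card_bij assms(1-3) by blast
  have d: "distr (PiM K (\<lambda>_. Q)) (PiM I (\<lambda>_. Q)) (\<lambda>x. \<lambda>n\<in>I. x (f n)) = PiM I (\<lambda>_. Q)"
    using f by (intro distr_PiM_reindex Q.prob_space_axioms) (auto simp: bij_betw_def)
  have im: "(\<lambda>n\<in>I. x (f n)) ` I = x ` K" for x :: "nat \<Rightarrow> 'a"
    using f by (force simp: bij_betw_def)
  have "(\<lambda>x. \<lambda>n\<in>I. x (f n)) \<in> measurable (PiM K (\<lambda>_. Q)) (PiM I (\<lambda>_. Q))"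
    using f by (intro measurable_restrict measurable_component_singleton) (auto simp: bij_betw_def)
  from integral_distr[OF this \<phi>] show ?thesis unfolding d im by (rule sym)
qed

text \<open>The first Hoeffding projection: the mean of the kernel with one argument held at
  \<open>x\<close>. The labels \<open>{1..<m}\<close> leave \<open>m\<close> free for that
  argument.\<close>

definition proj :: "nat \<Rightarrow> ('a set \<Rightarrow> real) \<Rightarrow> 'a \<Rightarrow> real"
  where "proj m F x = (\<integral>y. F (insert x (y ` {1..<m})) \<partial>PiM {1..<m} (\<lambda>_. Q))"

lemma kernel_insert_measurable:
  assumes F: "kernel m C F" and J: "finite J" "card J = m - 1" and m: "1 \<le> m"
  shows "(\<lambda>(x, y). F (insert x (y ` J))) \<in> borel_measurable (Q \<Otimes>\<^sub>M PiM J (\<lambda>_ :: nat. Q))"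
proof -
  \<comment> \<open>A fresh label for \<open>x\<close> turns the insertion into an ordinary
    evaluation of the kernel on m labels.\<close>
  obtain i where i: "i \<notin> J" using J(1) ex_new_if_finite infinite_UNIV_nat by blast
  have "(\<lambda>p. (\<lambda>(f, y). f(i := y)) (snd p, fst p)) \<in> measurable (Q \<Otimes>\<^sub>M PiM J (\<lambda>_. Q)) (PiM (insert i J) (\<lambda>_. Q))"
    by measurable
  moreover have "(\<lambda>x. F (x ` insert i J)) \<in> borel_measurable (PiM (insert i J) (\<lambda>_. Q))"
    using i J m by (intro kernel_measurable[OF F]) auto
  ultimately have "(\<lambda>p. F (((\<lambda>(f, y). f(i := y)) (snd p, fst p)) ` insert i J)) \<in> borel_measurable (Q \<Otimes>\<^sub>M PiM J (\<lambda>_. Q))"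
    by (rule measurable_compose)
  moreover have "((\<lambda>(f, y). f(i := y)) (snd p, fst p)) ` insert i J = insert (fst p) (snd p ` J)" for p :: "'a \<times> (nat \<Rightarrow> 'a)"
    using i by (auto simp: split_beta)
  ultimately show ?thesis by (simp add: split_beta)
qed

context
  fixes m C F
  assumes F: "kernel m C F" and m: "1 \<le> m"
begin

lemma proj_measurable [measurable]: "proj m F \<in> borel_measurable Q"
proof -
  interpret P: prob_space "PiM {1..<m} (\<lambda>_. Q)" by (rule prob_space_PQ)
  have "(\<lambda>(x, y). F (insert x (y ` {1..<m}))) \<in> borel_measurable (Q \<Otimes>\<^sub>M PiM {1..<m} (\<lambda>_ :: nat. Q))"
    using m by (intro kernel_insert_measurable[OF F]) auto
  then show ?thesis unfolding proj_def[abs_def]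
    by (intro P.borel_measurable_lebesgue_integral) (simp add: split_beta)
qed

lemma proj_bound: "0 \<le> proj m F x" "proj m F x \<le> C"
proof -
  interpret P: prob_space "PiM {1..<m} (\<lambda>_. Q)" by (rule prob_space_PQ)
  show "0 \<le> proj m F x" unfolding proj_def by (intro integral_nonneg_AE) (use kernel_bound[OF F] in auto)
  show "proj m F x \<le> C"
  \<comment> \<open>The bound is claimed for every \<open>x\<close>, also outside
    \<open>space Q\<close>; if the section is not integrable there, its integral has the default
    value 0.\<close>
  proof (cases "integrable (PiM {1..<m} (\<lambda>_. Q)) (\<lambda>y. F (insert x (y ` {1..<m})))")
    case True
    then show ?thesis unfolding proj_def by (intro P.integral_le_const) (use kernel_bound[OF F] in auto)
  next
    case False
    then show ?thesis unfolding proj_def using kernel_nonneg[OF F] by (simp add: not_integrable_integral_eq)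
  qed
qed

lemma proj_eq:
  fixes J :: "nat set"
  assumes J: "finite J" "card J = m - 1" and x: "x \<in> space Q"
  shows "(\<integral>y. F (insert x (y ` J)) \<partial>PiM J (\<lambda>_. Q)) = proj m F x"
  unfolding proj_def
proof (rule integral_image_reindex[where \<phi>="\<lambda>Y. F (insert x Y)"])
  have "(\<lambda>(x, y). F (insert x (y ` {1..<m}))) \<in> borel_measurable (Q \<Otimes>\<^sub>M PiM {1..<m} (\<lambda>_ :: nat. Q))"
    using m by (intro kernel_insert_measurable[OF F]) auto
  from measurable_Pair2[OF this x] show "(\<lambda>y. F (insert x (y ` {1..<m}))) \<in> borel_measurable (PiM {1..<m} (\<lambda>_. Q))"
    by simp
qed (use J in auto)

text \<open>Fubini with the coordinate \<open>m\<close> outermost. The weight 1 gives the mean of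
  the kernel, the weight \<open>proj m F\<close> the integral of the squared projection.\<close>

lemma integral_proj:
  assumes w [measurable]: "w \<in> borel_measurable Q" and wb: "\<And>x. \<bar>w x\<bar> \<le> D"
  shows "(\<integral>x. F (x ` {1..m}) * w (x m) \<partial>PiM {1..m} (\<lambda>_. Q)) = (\<integral>x. proj m F x * w x \<partial>Q)"
proof -
  have un: "{1..m} = {m} \<union> {1..<m}" using m by auto
  have mm: "m \<in> {1..m}" using m by simp
  have [measurable]: "(\<lambda>x. F (x ` {1..m})) \<in> borel_measurable (PiM {1..m} (\<lambda>_. Q))"
    by (rule kernel_measurable[OF F]) auto
  have [measurable]: "(\<lambda>x. w (x m)) \<in> borel_measurable (PiM {1..m} (\<lambda>_. Q))"
    by (rule measurable_compose[OF measurable_component_singleton[OF mm] w])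
  have int: "integrable (PiM {1..m} (\<lambda>_. Q)) (\<lambda>x. F (x ` {1..m}) * w (x m))"
  proof (rule integrable_PQ[where C="C * D"])
    show "\<bar>F (x ` {1..m}) * w (x m)\<bar> \<le> C * D" for x
      using kernel_bound[OF F] wb kernel_nonneg[OF F] unfolding abs_mult by (intro mult_mono) auto
  qed measurable
  have merge: "merge {m} {1..<m} (x, y) ` {1..m} = insert (x m) (y ` {1..<m})" "merge {m} {1..<m} (x, y) m = x m" for x y :: "nat \<Rightarrow> 'a"
    unfolding un image_Un by (auto simp: merge_def)
  have "(\<integral>x. F (x ` {1..m}) * w (x m) \<partial>PiM {1..m} (\<lambda>_. Q)) =
    (\<integral>x. (\<integral>y. F (merge {m} {1..<m} (x, y) ` {1..m}) * w (merge {m} {1..<m} (x, y) m) \<partial>PiM {1..<m} (\<lambda>_. Q)) \<partial>PiM {m} (\<lambda>_. Q))"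
    using int unfolding un by (subst QP.product_integral_fold) auto
  also have "\<dots> = (\<integral>x. proj m F (x m) * w (x m) \<partial>PiM {m} (\<lambda>_. Q))"
    unfolding merge by (simp add: proj_def)
  also have "\<dots> = (\<integral>x. proj m F x * w x \<partial>Q)"
    by (rule QP.product_integral_singleton[where f="\<lambda>x. proj m F x * w x"]) simp
  finally show ?thesis .
qed

lemma integral_kernel:
  fixes I :: "nat set"
  assumes "finite I" "card I = m"
  shows "(\<integral>x. F (x ` I) \<partial>PiM I (\<lambda>_. Q)) = (\<integral>x. proj m F x \<partial>Q)"
proof -
  have "(\<integral>x. F (x ` I) \<partial>PiM I (\<lambda>_. Q)) = (\<integral>x. F (x ` {1..m}) \<partial>PiM {1..m} (\<lambda>_. Q))"
    using assms by (intro integral_image_reindex[where \<phi>=F] kernel_measurable[OF F]) auto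
  then show ?thesis using integral_proj[of "\<lambda>_. 1" 1] by simp
qed

text \<open>The two blocks share only the label \<open>m\<close>. Integrating out the labels above
  \<open>m\<close> turns the second factor into the projection at \<open>x m\<close>, and
  \<open>integral_proj\<close> does the same for the first. The left-hand side is the form in which
  the limiting variance is given.\<close>

lemma integral_overlap_one:
  "(\<integral>x. F (x ` {1..m}) * F (x ` {m..2*m-1}) \<partial>PiM {1..2*m-1} (\<lambda>_. Q)) = (\<integral>x. (proj m F x)^2 \<partial>Q)"
proof -
  let ?J = "{m+1..2*m-1}"
  have un: "{1..2*m-1} = {1..m} \<union> ?J" using m by auto
  have [measurable]: "(\<lambda>x. F (x ` {1..m})) \<in> borel_measurable (PiM {1..2*m-1} (\<lambda>_. Q))"
    "(\<lambda>x. F (x ` {m..2*m-1})) \<in> borel_measurable (PiM {1..2*m-1} (\<lambda>_. Q))"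
    using m by (auto intro!: kernel_measurable[OF F])
  have int: "integrable (PiM {1..2*m-1} (\<lambda>_. Q)) (\<lambda>x. F (x ` {1..m}) * F (x ` {m..2*m-1}))"
  proof (rule integrable_PQ[where C="C * C"])
    show "\<bar>F (x ` {1..m}) * F (x ` {m..2*m-1})\<bar> \<le> C * C" for x :: "nat \<Rightarrow> 'a"
      using kernel_bound[OF F] kernel_nonneg[OF F] unfolding abs_mult by (intro mult_mono) auto
  qed measurable
  have un': "{m..2*m-1} = insert m ?J" using m by auto
  have merge: "merge {1..m} ?J (x, y) ` {1..m} = x ` {1..m}" for x y :: "nat \<Rightarrow> 'a"
    by (auto simp: merge_def)
  have merge': "merge {1..m} ?J (x, y) ` {m..2*m-1} = insert (x m) (y ` ?J)" for x y :: "nat \<Rightarrow> 'a"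
    unfolding un' using m by (auto simp: merge_def)
  have "(\<integral>x. F (x ` {1..m}) * F (x ` {m..2*m-1}) \<partial>PiM {1..2*m-1} (\<lambda>_. Q)) =
    (\<integral>x. (\<integral>y. F (merge {1..m} ?J (x, y) ` {1..m}) * F (merge {1..m} ?J (x, y) ` {m..2*m-1}) \<partial>PiM ?J (\<lambda>_. Q)) \<partial>PiM {1..m} (\<lambda>_. Q))"
    using int unfolding un by (subst QP.product_integral_fold) auto
  also have "\<dots> = (\<integral>x. F (x ` {1..m}) * (\<integral>y. F (insert (x m) (y ` ?J)) \<partial>PiM ?J (\<lambda>_. Q)) \<partial>PiM {1..m} (\<lambda>_. Q))"
    unfolding merge merge' by simp
  also have "\<dots> = (\<integral>x. F (x ` {1..m}) * proj m F (x m) \<partial>PiM {1..m} (\<lambda>_. Q))"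
    using m by (intro Bochner_Integration.integral_cong refl arg_cong2[where f="(*)"] proj_eq) (auto simp: space_PiM)
  also have "\<dots> = (\<integral>x. proj m F x * proj m F x \<partial>Q)"
    by (rule integral_proj[where D=C]) (use proj_bound in \<open>auto simp: abs_le_iff intro: order_trans[OF _ kernel_nonneg[OF F]]\<close>)
  finally show ?thesis by (simp add: power2_eq_square)
qed

end

lemma integral_disjoint:
  fixes I J :: "nat set"
  assumes F: "kernel a C F" and G: "kernel b D G" and I: "finite I" "card I = a" and J: "finite J" "card J = b"
    and IJ: "I \<inter> J = {}"
  shows "(\<integral>x. F (x ` I) * G (x ` J) \<partial>PiM (I \<union> J) (\<lambda>_. Q)) =
    (\<integral>x. F (x ` I) \<partial>PiM I (\<lambda>_. Q)) * (\<integral>x. G (x ` J) \<partial>PiM J (\<lambda>_. Q))"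
proof -
  have [measurable]: "(\<lambda>x. F (x ` I)) \<in> borel_measurable (PiM (I \<union> J) (\<lambda>_. Q))"
    "(\<lambda>x. G (x ` J)) \<in> borel_measurable (PiM (I \<union> J) (\<lambda>_. Q))"
    using I J by (auto intro!: kernel_measurable[OF F] kernel_measurable[OF G])
  have int: "integrable (PiM (I \<union> J) (\<lambda>_. Q)) (\<lambda>x. F (x ` I) * G (x ` J))"
  proof (rule integrable_PQ[where C="C * D"])
    show "\<bar>F (x ` I) * G (x ` J)\<bar> \<le> C * D" for x :: "nat \<Rightarrow> 'a"
      using kernel_bound[OF F] kernel_bound[OF G] kernel_nonneg[OF F] unfolding abs_mult by (intro mult_mono) auto
  qed measurable
  have merge: "merge I J (x, y) ` I = x ` I" "merge I J (x, y) ` J = y ` J" for x y :: "nat \<Rightarrow> 'a"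
    using IJ by (auto simp: merge_def)
  have "(\<integral>x. F (x ` I) * G (x ` J) \<partial>PiM (I \<union> J) (\<lambda>_. Q)) =
    (\<integral>x. (\<integral>y. F (merge I J (x, y) ` I) * G (merge I J (x, y) ` J) \<partial>PiM J (\<lambda>_. Q)) \<partial>PiM I (\<lambda>_. Q))"
    using int IJ I J by (subst QP.product_integral_fold) auto
  then show ?thesis unfolding merge by simp
qed

section \<open>Linearization in mean square\<close>

definition lin :: "('a \<Rightarrow> real) \<Rightarrow> 'w \<Rightarrow> real" where "lin g \<omega> = (\<Sum>i\<in>pts \<omega>. g (X i \<omega>))"

text \<open>Viewed as a U-statistic of order 1, the linear statistic falls under the same product
  formula; \<open>the_elem\<close> reads off the only point of a singleton.\<close>

lemma lin_eq_ustat: "lin g = ustat 1 (\<lambda>Y. g (the_elem Y))"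
proof
  fix \<omega>
  have eq: "{J. J \<subseteq> pts \<omega> \<and> card J = 1} = (\<lambda>i. {i}) ` pts \<omega>" by (auto simp: card_1_singleton_iff)
  show "lin g \<omega> = ustat 1 (\<lambda>Y. g (the_elem Y)) \<omega>"
    unfolding ustat_def lin_def eq by (subst sum.reindex) (auto simp: img_def)
qed

lemma kernel_singleton:
  assumes [measurable]: "g \<in> borel_measurable Q" and "\<And>x. 0 \<le> g x" "\<And>x. g x \<le> C"
  shows "kernel 1 C (\<lambda>Y. g (the_elem Y))"
  unfolding kernel_def
proof safe
  fix J :: "nat set" assume "finite J" "card J = 1"
  then obtain j where J: "J = {j}" by (auto simp: card_1_singleton_iff)
  have "(\<lambda>x. g (x j)) \<in> borel_measurable (PiM J (\<lambda>_. Q))" unfolding J by measurable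
  then show "(\<lambda>x. g (the_elem (x ` J))) \<in> borel_measurable (PiM J (\<lambda>_. Q))" unfolding J by simp
qed (use assms in auto)

text \<open>With c = t^(m-1) / (m-1)! and s the integral of g^2, the overlap-one terms of the
  squared U-statistic, the mixed product and the squared linear statistic are c^2 t s, c t s and t
  s. They cancel in the expectation of Y^2, as do the squared means, and only the overlaps of size
  at least two remain.\<close>

theorem ustat_linearization:
  fixes F
  assumes F: "kernel m C F" and m: "1 \<le> m" and t1: "1 \<le> t"
  defines "g \<equiv> proj m F"
  defines "p \<equiv> \<integral>x. g x \<partial>Q"
  defines "Y \<equiv> \<lambda>\<omega>. ustat m F \<omega> - t^m / fact m * p - t^(m-1) / fact (m-1) * (lin g \<omega> - t * p)"
  shows "integrable M (ustat m F)" "expectation (ustat m F) = t^m / fact m * p"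
    and "integrable M (\<lambda>\<omega>. (Y \<omega>)^2)"
    and "expectation (\<lambda>\<omega>. (Y \<omega>)^2) \<le> C^2 * 16^m * (2^(2*m-2) + (2 * real (2*m-2))^(2*m-2)) * t^(2*m-2)"
proof -
  let ?G = "\<lambda>Y. g (the_elem Y)"
  have g [measurable]: "g \<in> borel_measurable Q" unfolding g_def by (rule proj_measurable[OF F m])
  have gb: "0 \<le> g x" "g x \<le> C" for x unfolding g_def using proj_bound[OF F m] by auto
  have gb': "\<bar>g x\<bar> \<le> C" for x using gb by (simp add: abs_of_nonneg)
  have G: "kernel 1 C ?G" by (rule kernel_singleton[OF g gb])
  define s where "s = (\<integral>x. (g x)^2 \<partial>Q)"
  define c where "c = t^(m-1) / fact (m-1)"
  define e where "e = t^m / fact m * p"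
  have mean1: "(\<integral>x. ?G (x ` I) \<partial>PiM I (\<lambda>_. Q)) = p" if I: "card I = 1" for I :: "nat set"
  proof -
    from I obtain j where J: "I = {j}" by (auto simp: card_1_singleton_iff)
    show ?thesis unfolding J p_def using QP.product_integral_singleton[of g j] by simp
  qed
  have meanF: "(\<integral>x. F (x ` I) \<partial>PiM I (\<lambda>_. Q)) = p" if "finite I" "card I = m" for I :: "nat set"
    unfolding p_def g_def by (rule integral_kernel[OF F m that])
  have [simp]: "the_elem ((\<lambda>j. x j) ` {i}) = x i" for x :: "nat \<Rightarrow> 'a" and i by simp
  \<comment> \<open>The constant statistic of order 0 makes first moments a special case of the
    product formula.\<close>
  have K0: "kernel 0 1 (\<lambda>_. 1)" by (simp add: kernel_def)
  have U0: "ustat 0 (\<lambda>_. 1) \<omega> = 1" for \<omega>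
  proof -
    have "{J. J \<subseteq> pts \<omega> \<and> card J = 0} = {{}}" by (auto dest: finite_subset[OF _ finite_pts])
    then show ?thesis by (simp add: ustat_def)
  qed
  \<comment> \<open>A set of at most one index leaves no overlap of size two, so products with the
    constant and the linear statistic are computed exactly.\<close>
  have over0: "(\<Sum>(J1, J2) | J1 \<subseteq> pts \<omega> \<and> J2 \<subseteq> pts \<omega> \<and> card J1 = a \<and> card J2 = b \<and> 2 \<le> card (J1 \<inter> J2). f J1 J2) = (0::real)"
    if b: "b \<le> 1" for a b f \<omega>
  proof -
    have "\<not> 2 \<le> card (J1 \<inter> J2)" if "J2 \<subseteq> pts \<omega>" "card J2 = b" for J1 J2
    proof -
      have "card (J1 \<inter> J2) \<le> card J2" using that by (intro card_mono) (auto intro: finite_subset)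
      then show ?thesis using that b by linarith
    qed
    then have "{(J1, J2). J1 \<subseteq> pts \<omega> \<and> J2 \<subseteq> pts \<omega> \<and> card J1 = a \<and> card J2 = b \<and> 2 \<le> card (J1 \<inter> J2)} = {}"
      by blast
    then show ?thesis by (simp only: sum.empty)
  qed
  \<comment> \<open>Disjoint index sets give the product of the two means; both are p, because the
    projection preserves the mean of the kernel.\<close>
  have pair0: "has_bochner_integral M (pairsum a b 0 F1 F2) (t^(a+b) / (fact a * fact b) * (p * p))"
    if K: "kernel a C F1" "kernel b C F2" and I: "\<And>I :: nat set. finite I \<Longrightarrow> card I = a \<Longrightarrow> (\<integral>x. F1 (x ` I) \<partial>PiM I (\<lambda>_. Q)) = p"
      "\<And>I :: nat set. finite I \<Longrightarrow> card I = b \<Longrightarrow> (\<integral>x. F2 (x ` I) \<partial>PiM I (\<lambda>_. Q)) = p" for a b F1 F2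
  proof -
    have "has_bochner_integral M (pairsum a b 0 F1 F2) (t^(a+b-0) / (fact 0 * fact (a-0) * fact (b-0)) *
      (\<integral>x. F1 (x ` {..<a}) * F2 (x ` {a..<a+b}) \<partial>PiM ({..<a} \<union> {a..<a+b}) (\<lambda>_. Q)))"
      by (rule pairsum_integral[OF K]) auto
    also have "(\<integral>x. F1 (x ` {..<a}) * F2 (x ` {a..<a+b}) \<partial>PiM ({..<a} \<union> {a..<a+b}) (\<lambda>_. Q)) = p * p"
      by (subst integral_disjoint[OF K]) (auto simp: I)
    finally show ?thesis by simp
  qed
  have hb: "expectation f = v" "integrable M f" if "has_bochner_integral M f v" for f and v :: real
    using that by (auto simp: has_bochner_integral_iff)

  have intF: "integrable M (ustat m F)" and intG: "integrable M (lin g)"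
    and intFF: "integrable M (\<lambda>\<omega>. ustat m F \<omega> * ustat m F \<omega>)"
    and intFG: "integrable M (\<lambda>\<omega>. ustat m F \<omega> * lin g \<omega>)"
    and intGG: "integrable M (\<lambda>\<omega>. lin g \<omega> * lin g \<omega>)"
    unfolding lin_eq_ustat using ustat_integrable[OF F F] ustat_integrable[OF F G] ustat_integrable[OF G G] by auto

  have "has_bochner_integral M (pairsum m 0 0 F (\<lambda>_. 1)) (t^(m+0-0) / (fact 0 * fact (m-0) * fact (0-0)) *
      (\<integral>x. F (x ` {..<m}) * 1 \<partial>PiM ({..<m} \<union> {}) (\<lambda>_. Q)))"
    by (rule pairsum_integral[OF F K0]) auto
  moreover have "ustat m F = pairsum m 0 0 F (\<lambda>_. 1)"
  proof
    fix \<omega>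
    have "set_pairs m 0 1 (pts \<omega>) = {}"
      by (auto simp: set_pairs_def dest: finite_subset[OF _ finite_pts])
    then show "ustat m F \<omega> = pairsum m 0 0 F (\<lambda>_. 1) \<omega>" using ustat_mult[of m F \<omega> 0 "\<lambda>_. 1"] over0[of 0 "\<lambda>J1 J2. F (img J1 \<omega>) * 1" \<omega> m]
      by (simp add: U0 pairsum_def)
  qed
  ultimately have EF: "expectation (ustat m F) = e"
    using meanF[of "{..<m}"] by (simp add: e_def has_bochner_integral_iff)
  show "integrable M (ustat m F)" "expectation (ustat m F) = t^m / fact m * p"
    using intF EF by (simp_all add: e_def)

  have "has_bochner_integral M (pairsum 1 0 0 ?G (\<lambda>_. 1)) (t^(1+0-0) / (fact 0 * fact (1-0) * fact (0-0)) *
      (\<integral>x. ?G (x ` {0::nat}) * 1 \<partial>PiM ({0::nat} \<union> {}) (\<lambda>_. Q)))"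
    by (rule pairsum_integral[OF G K0]) auto
  moreover have "lin g = pairsum 1 0 0 ?G (\<lambda>_. 1)"
  proof
    fix \<omega>
    have "set_pairs 1 0 1 (pts \<omega>) = {}"
      by (auto simp: set_pairs_def dest: finite_subset[OF _ finite_pts])
    then show "lin g \<omega> = pairsum 1 0 0 ?G (\<lambda>_. 1) \<omega>" using ustat_mult[of 1 ?G \<omega> 0 "\<lambda>_. 1"] over0[of 0 "\<lambda>J1 J2. ?G (img J1 \<omega>) * 1" \<omega> 1]
      by (simp add: U0 pairsum_def lin_eq_ustat)
  qed
  ultimately have EG: "expectation (lin g) = t * p"
    using mean1[of "{0::nat}"] by (simp add: has_bochner_integral_iff)

  have EGG: "expectation (\<lambda>\<omega>. lin g \<omega> * lin g \<omega>) = (t * p)^2 + t * s"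
  proof -
    have 0: "has_bochner_integral M (pairsum 1 1 0 ?G ?G) (t^(1+1) / (fact 1 * fact 1) * (p * p))"
      by (rule pair0[OF G G]) (auto intro!: mean1)
    have "has_bochner_integral M (pairsum 1 1 1 ?G ?G) (t^(1+1-1) / (fact 1 * fact (1-1) * fact (1-1)) *
      (\<integral>x. ?G (x ` {0::nat}) * ?G (x ` {0::nat}) \<partial>PiM ({0::nat} \<union> {0::nat}) (\<lambda>_. Q)))"
      by (rule pairsum_integral[OF G G]) auto
    also have "(\<integral>x. ?G (x ` {0::nat}) * ?G (x ` {0::nat}) \<partial>PiM ({0::nat} \<union> {0::nat}) (\<lambda>_. Q)) = s"
      using QP.product_integral_singleton[of "\<lambda>x. g x * g x" "0::nat"] by (simp add: s_def power2_eq_square)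
    finally have 1: "has_bochner_integral M (pairsum 1 1 1 ?G ?G) (t * s)" by simp
    have "lin g \<omega> * lin g \<omega> = pairsum 1 1 0 ?G ?G \<omega> + pairsum 1 1 1 ?G ?G \<omega>" for \<omega>
      using ustat_mult[of 1 ?G \<omega> 1 ?G] over0[of 1 "\<lambda>J1 J2. ?G (img J1 \<omega>) * ?G (img J2 \<omega>)" \<omega> 1]
      by (simp add: lin_eq_ustat)
    then show ?thesis
      using hb[OF 0] hb[OF 1] by (simp add: power2_eq_square algebra_simps)
  qed

  have EFG: "expectation (\<lambda>\<omega>. ustat m F \<omega> * lin g \<omega>) = e * (t * p) + c * t * s"
  proof -
    have 0: "has_bochner_integral M (pairsum m 1 0 F ?G) (t^(m+1) / (fact m * fact 1) * (p * p))"
      by (rule pair0[OF F G]) (auto intro!: mean1 meanF)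
    \<comment> \<open>The sets \<open>{1..m}\<close> and \<open>{m}\<close> share one label, and the
      weight at that label is the projection itself, which produces s.\<close>
    have "has_bochner_integral M (pairsum m 1 1 F ?G) (t^(m+1-1) / (fact 1 * fact (m-1) * fact (1-1)) *
      (\<integral>x. F (x ` {1..m}) * ?G (x ` {m}) \<partial>PiM ({1..m} \<union> {m}) (\<lambda>_. Q)))"
      by (rule pairsum_integral[OF F G]) (use m in auto)
    also have "{1..m} \<union> {m} = {1..m}" using m by auto
    also have "(\<integral>x. F (x ` {1..m}) * ?G (x ` {m}) \<partial>PiM {1..m} (\<lambda>_. Q)) = s"
      using integral_proj[OF F m g gb'] by (simp add: s_def g_def power2_eq_square)
    finally have 1: "has_bochner_integral M (pairsum m 1 1 F ?G) (t^m / fact (m-1) * s)" by simp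
    have "ustat m F \<omega> * lin g \<omega> = pairsum m 1 0 F ?G \<omega> + pairsum m 1 1 F ?G \<omega>" for \<omega>
      using ustat_mult[of m F \<omega> 1 ?G] over0[of 1 "\<lambda>J1 J2. F (img J1 \<omega>) * ?G (img J2 \<omega>)" \<omega> m]
      by (simp add: lin_eq_ustat)
    moreover have "t^m = t^(m-1) * t" using m by (cases m) auto
    ultimately show ?thesis
      using hb[OF 0] hb[OF 1] by (simp add: e_def c_def field_simps)
  qed

  define R where "R = C^2 * 16^m * (2^(2*m-2) + (2 * real (2*m-2))^(2*m-2)) * t^(2*m-2)"
  have EFF: "expectation (\<lambda>\<omega>. ustat m F \<omega> * ustat m F \<omega>) \<le> e^2 + c^2 * t * s + R"
  proof -
    have 0: "has_bochner_integral M (pairsum m m 0 F F) (t^(m+m) / (fact m * fact m) * (p * p))"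
      by (rule pair0[OF F F]) (auto intro!: meanF)
    have "has_bochner_integral M (pairsum m m 1 F F) (t^(m+m-1) / (fact 1 * fact (m-1) * fact (m-1)) *
      (\<integral>x. F (x ` {1..m}) * F (x ` {m..2*m-1}) \<partial>PiM ({1..m} \<union> {m..2*m-1}) (\<lambda>_. Q)))"
    proof (rule pairsum_integral[OF F F])
      have "{1..m} \<inter> {m..2*m-1} = {m}" using m by auto
      then show "card ({1..m} \<inter> {m..2*m-1}) = 1" by simp
    qed (use m in auto)
    also have "{1..m} \<union> {m..2*m-1} = {1..2*m-1}" using m by auto
    also have "(\<integral>x. F (x ` {1..m}) * F (x ` {m..2*m-1}) \<partial>PiM {1..2*m-1} (\<lambda>_. Q)) = s"
      unfolding s_def g_def by (rule integral_overlap_one[OF F m])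
    finally have 1: "has_bochner_integral M (pairsum m m 1 F F) (t^(m+m-1) / (fact (m-1) * fact (m-1)) * s)" by simp
    have le: "ustat m F \<omega> * ustat m F \<omega> \<le> pairsum m m 0 F F \<omega> + pairsum m m 1 F F \<omega> +
        C^2 * 16^m * real (card (pts \<omega>)) ^ (2*m-2)" for \<omega>
    proof -
      let ?S = "{(J1, J2). J1 \<subseteq> pts \<omega> \<and> J2 \<subseteq> pts \<omega> \<and> card J1 = m \<and> card J2 = m \<and> 2 \<le> card (J1 \<inter> J2)}"
      have "(\<Sum>(J1, J2)\<in>?S. F (img J1 \<omega>) * F (img J2 \<omega>)) \<le> (\<Sum>p\<in>?S. C^2)"
        using kernel_bound[OF F] kernel_nonneg[OF F]
        by (intro sum_mono) (auto simp: power2_eq_square intro!: mult_mono)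
      also have "\<dots> = C^2 * real (card ?S)" by simp
      also have "\<dots> \<le> C^2 * real (16^m * card (pts \<omega>) ^ (2*m-2))"
        by (intro mult_left_mono of_nat_mono card_set_pairs_overlap) auto
      finally show ?thesis using ustat_mult[of m F \<omega> m F] by simp
    qed
    have "expectation (\<lambda>\<omega>. ustat m F \<omega> * ustat m F \<omega>) \<le>
      expectation (\<lambda>\<omega>. pairsum m m 0 F F \<omega> + pairsum m m 1 F F \<omega> + C^2 * 16^m * real (card (pts \<omega>)) ^ (2*m-2))"
      using hb[OF 0] hb[OF 1] card_pts_power(1) le intFF by (intro integral_mono) auto
    also have "\<dots> = t^(m+m) / (fact m * fact m) * (p * p) + t^(m+m-1) / (fact (m-1) * fact (m-1)) * s +
      C^2 * 16^m * expectation (\<lambda>\<omega>. real (card (pts \<omega>)) ^ (2*m-2))"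
      using hb[OF 0] hb[OF 1] card_pts_power(1) by simp
    also have "t^(m+m) / (fact m * fact m) * (p * p) = e^2"
      by (simp add: e_def power2_eq_square power_add)
    also have "t^(m+m-1) / (fact (m-1) * fact (m-1)) * s = c^2 * t * s"
    proof -
      have "m + m - 1 = (m - 1) + (m - 1) + 1" using m by simp
      then have "t^(m+m-1) = t^(m-1) * t^(m-1) * t" by (simp only: power_add power_one_right)
      then show ?thesis by (simp add: c_def power2_eq_square)
    qed
    also have "C^2 * 16^m * expectation (\<lambda>\<omega>. real (card (pts \<omega>)) ^ (2*m-2)) \<le>
      C^2 * 16^m * ((2^(2*m-2) + (2 * real (2*m-2))^(2*m-2)) * t^(2*m-2))"
    proof (intro mult_left_mono)
      \<comment> \<open>As t \<ge> 1, the constant part of the moment bound is absorbed into the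
        power of t.\<close>
      have "(2 * real (2*m-2))^(2*m-2) * 1 \<le> (2 * real (2*m-2))^(2*m-2) * t^(2*m-2)"
        using t1 by (intro mult_left_mono one_le_power) auto
      then show "expectation (\<lambda>\<omega>. real (card (pts \<omega>)) ^ (2*m-2)) \<le> (2^(2*m-2) + (2 * real (2*m-2))^(2*m-2)) * t^(2*m-2)"
        using card_pts_power(2)[of "2*m-2"] unfolding distrib_right by linarith
    qed auto
    finally show ?thesis by (simp add: R_def mult.assoc)
  qed

  let ?d = "e - c * (t * p)"
  have Y: "(Y \<omega>)^2 = ustat m F \<omega> * ustat m F \<omega> + c^2 * (lin g \<omega> * lin g \<omega>) - 2 * c * (ustat m F \<omega> * lin g \<omega>)
      - 2 * ?d * ustat m F \<omega> + 2 * ?d * c * lin g \<omega> + ?d^2" for \<omega>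
    unfolding Y_def e_def[symmetric] c_def[symmetric] by (simp add: power2_eq_square algebra_simps)
  show "integrable M (\<lambda>\<omega>. (Y \<omega>)^2)"
    unfolding Y using intF intG intFF intFG intGG by auto
  have "expectation (\<lambda>\<omega>. (Y \<omega>)^2) = expectation (\<lambda>\<omega>. ustat m F \<omega> * ustat m F \<omega>) + c^2 * ((t * p)^2 + t * s)
    - 2 * c * (e * (t * p) + c * t * s) - 2 * ?d * e + 2 * ?d * c * (t * p) + ?d^2"
    unfolding Y using intF intG intFF intFG intGG by (simp add: EF EG EFG EGG prob_space)
  also have "\<dots> \<le> e^2 + c^2 * t * s + R + c^2 * ((t * p)^2 + t * s)
    - 2 * c * (e * (t * p) + c * t * s) - 2 * ?d * e + 2 * ?d * c * (t * p) + ?d^2"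
    using EFF by simp
  also have "\<dots> = R" by (simp add: power2_eq_square algebra_simps)
  finally show "expectation (\<lambda>\<omega>. (Y \<omega>)^2) \<le> C^2 * 16^m * (2^(2*m-2) + (2 * real (2*m-2))^(2*m-2)) * t^(2*m-2)"
    by (simp only: R_def)
qed

end

section \<open>Characteristic functions\<close>

text \<open>The derivative of exp is bounded by 1 on the convex half-plane of nonpositive real part.
  The estimate serves for the exponents of the Poisson formula and, on the imaginary axis, for the
  characters \<open>iexp\<close>.\<close>

lemma norm_exp_diff_le:
  fixes a b :: complex
  assumes "Re a \<le> 0" "Re b \<le> 0"
  shows "cmod (exp a - exp b) \<le> cmod (a - b)"
proof -
  have "cmod (exp a - exp b) \<le> 1 * cmod (a - b)"
  proof (rule field_differentiable_bound)
    show "convex {z :: complex. Re z \<le> 0}" by (rule convex_halfspace_Re_le)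
    show "(exp has_field_derivative exp z) (at z within {z. Re z \<le> 0})" for z :: complex
      by (intro derivative_eq_intros) auto
    show "cmod (exp z) \<le> 1" if "z \<in> {z. Re z \<le> 0}" for z using that by (simp add: norm_exp_eq_Re)
  qed (use assms in auto)
  then show ?thesis by simp
qed

context poisson_window
begin

text \<open>The weights of the Poisson law times the powers of \<open>iexp c\<close> form an
  exponential series in \<open>l * iexp c\<close>.\<close>

lemma expectation_iexp_cnt:
  assumes B [measurable]: "B \<in> sets Q" and "B \<subseteq> W"
  shows "(CLINT \<omega>|M. iexp (c * real (cnt B \<omega>))) = exp (t * Q.prob B * (iexp c - 1))"
proof -
  define l where "l = t * Q.prob B"
  have l: "0 \<le> l" unfolding l_def using t by simp
  let ?p = "\<lambda>n. l^n / fact n * exp (-l)"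
  have sum: "(\<lambda>n. ?p n *\<^sub>R iexp (c * real n)) sums exp (l * (iexp c - 1))"
  proof -
    have "(\<lambda>n. (complex_of_real l * iexp c) ^ n /\<^sub>R fact n * exp (- complex_of_real l)) sums
      (exp (complex_of_real l * iexp c) * exp (- complex_of_real l))"
      by (intro sums_mult2 exp_converges)
    also have "exp (complex_of_real l * iexp c) * exp (- complex_of_real l) = exp (l * (iexp c - 1))"
      by (simp add: exp_add[symmetric] algebra_simps)
    also have "(\<lambda>n. (complex_of_real l * iexp c) ^ n /\<^sub>R fact n * exp (- complex_of_real l)) = (\<lambda>n. ?p n *\<^sub>R iexp (c * real n))"
    proof
      fix n
      have "iexp c ^ n = iexp (c * real n)" by (simp add: exp_of_nat_mult[symmetric] mult_ac)
      then show "(complex_of_real l * iexp c) ^ n /\<^sub>R fact n * exp (- complex_of_real l) = ?p n *\<^sub>R iexp (c * real n)"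
        by (simp add: power_mult_distrib scaleR_conv_of_real exp_of_real[symmetric] divide_inverse)
    qed
    finally show ?thesis .
  qed
  have nrm: "norm (?p n *\<^sub>R iexp (c * real n)) = ?p n" for n using l by (simp add: abs_mult)
  have summ: "summable (\<lambda>n. norm (?p n *\<^sub>R iexp (c * real n)))"
    unfolding nrm using summable_mult2[OF summable_exp_generic[of l], of "exp (-l)"]
    by (simp add: divide_inverse mult_ac)
  have "(CLINT \<omega>|M. iexp (c * real (cnt B \<omega>))) = (CLINT n|distr M (count_space UNIV) (cnt B). iexp (c * real n))"
    by (subst integral_distr) auto
  also have "\<dots> = (\<integral>n. ?p n *\<^sub>R iexp (c * real n) \<partial>count_space UNIV)"
    unfolding distr_cnt[OF assms] l_def[symmetric] using l by (subst integral_density) auto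
  also have "\<dots> = (\<Sum>n. ?p n *\<^sub>R iexp (c * real n))"
    by (rule integral_count_space_nat) (simp only: integrable_count_space_nat_iff summ)
  also have "\<dots> = exp (l * (iexp c - 1))" using sum by (rule sums_unique[symmetric])
  finally show ?thesis by (simp add: l_def)
qed

lemma lin_measurable [measurable]:
  assumes [measurable]: "g \<in> borel_measurable Q" shows "lin g \<in> borel_measurable M"
  unfolding lin_def[abs_def] by (rule fun_pts_measurable[where f="\<lambda>A \<omega>. \<Sum>i\<in>A. g (X i \<omega>)"])
    (intro borel_measurable_sum measurable_compose[OF X assms])

text \<open>The statistic is the sum over the finitely many values v of v times the number of points
  with g = v. These counts are independent Poisson variables, so the characteristic function is a
  product of Poisson ones.\<close>

lemma char_lin_finite_range:
  assumes g [measurable]: "g \<in> borel_measurable Q" and fin: "finite (range g)"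
  shows "(CLINT \<omega>|M. iexp (lin g \<omega>)) = exp (t * (CLINT x|Q. iexp (g x) - 1))"
proof -
  define V where "V = range g"
  have V: "finite V" using fin by (simp add: V_def)
  define B where "B v = {x\<in>space Q. x \<in> W \<and> g x = v}" for v
  have [measurable]: "B v \<in> sets Q" for v unfolding B_def by measurable
  have BW: "B v \<subseteq> W" for v by (auto simp: B_def)
  \<comment> \<open>Values are coded by naturals, because independence is stated for sequences of
    sets.\<close>
  obtain e :: "real \<Rightarrow> nat" where e: "inj_on e V" using V finite_imp_inj_to_nat_seg by blast
  define B' where "B' j = (if j \<in> e ` V then B (the_inv_into V e j) else {})" for j
  have B'_e: "B' (e v) = B v" if "v \<in> V" for v using that e by (simp add: B'_def the_inv_into_f_f)
  have "indep_vars (\<lambda>_. borel) (\<lambda>j. point_count X (B' j)) UNIV"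
  proof (rule indep)
    show "range B' \<subseteq> Q.events" by (auto simp: B'_def)
    show "disjoint_family B'"
      unfolding disjoint_family_on_def
    proof (safe)
      fix i j x assume "i \<noteq> j" "x \<in> B' i" "x \<in> B' j"
      then obtain v w where "i = e v" "j = e w" "v \<in> V" "w \<in> V" "x \<in> B v" "x \<in> B w"
        by (auto simp: B'_def B'_e the_inv_into_f_f[OF e] split: if_splits)
      with \<open>i \<noteq> j\<close> show "x \<in> {}" by (auto simp: B_def)
    qed
  qed
  \<comment> \<open>\<open>inv_into V e\<close> recovers the value from its code, so the variable
    with code j is that value times the count of its level set.\<close>
  then have "indep_vars (\<lambda>_. borel) (\<lambda>j \<omega>. (enn2real (point_count X (B' j) \<omega>) * inv_into V e j)) UNIV"
    by (rule indep_vars_compose2) measurable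
  then have ind: "indep_vars (\<lambda>_. borel) (\<lambda>j \<omega>. (enn2real (point_count X (B' j) \<omega>) * inv_into V e j)) (e ` V)"
    by (rule indep_vars_subset) auto
  let ?Y = "\<lambda>j \<omega>. enn2real (point_count X (B' j) \<omega>) * inv_into V e j"
  have Y: "AE \<omega> in M. ?Y (e v) \<omega> = v * real (cnt (B v) \<omega>)" if "v \<in> V" for v
    using AE_cnt[OF BW[of v]] by eventually_elim (use that e in \<open>simp add: B'_e\<close>)
  have "AE \<omega> in M. lin g \<omega> = (\<Sum>j\<in>e ` V. ?Y j \<omega>)"
    using AE_pts AE_finite_idx AE_space
  proof eventually_elim
    case (elim \<omega>)
    have sp: "X i \<omega> \<in> space Q" for i using measurable_space[OF X elim(3)] .
    have "lin g \<omega> = (\<Sum>v\<in>V. \<Sum>i\<in>{i\<in>idx \<omega>. g (X i \<omega>) = v}. g (X i \<omega>))"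
      unfolding lin_def using elim V by (subst sum.group) (auto simp: V_def)
    also have "\<dots> = (\<Sum>v\<in>V. v * real (cnt (B v) \<omega>))"
    proof (rule sum.cong)
      fix v
      have eq: "{i\<in>idx \<omega>. g (X i \<omega>) = v} = {i. X i \<omega> \<in> B v}" using sp by (auto simp: idx_def B_def)
      have "(\<Sum>i\<in>{i\<in>idx \<omega>. g (X i \<omega>) = v}. g (X i \<omega>)) = (\<Sum>i\<in>{i\<in>idx \<omega>. g (X i \<omega>) = v}. v)"
        by (rule sum.cong) auto
      then show "(\<Sum>i\<in>{i\<in>idx \<omega>. g (X i \<omega>) = v}. g (X i \<omega>)) = v * real (cnt (B v) \<omega>)"
        by (simp add: cnt_def eq)
    qed simp
    also have "\<dots> = (\<Sum>v\<in>V. ?Y (e v) \<omega>)"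
      using elim e by (intro sum.cong) (auto simp: B'_e cnt_point_count[OF _ BW])
    also have "\<dots> = (\<Sum>j\<in>e ` V. ?Y j \<omega>)" using e by (simp add: sum.reindex)
    finally show ?case .
  qed
  moreover have Ym: "?Y j \<in> borel_measurable M" if "j \<in> e ` V" for j
    using ind that by (auto simp: indep_vars_def2)
  have [measurable]: "(\<lambda>\<omega>. \<Sum>j\<in>e ` V. ?Y j \<omega>) \<in> borel_measurable M"
    by (rule borel_measurable_sum[OF Ym])
  ultimately have "(CLINT \<omega>|M. iexp (lin g \<omega>)) = (CLINT \<omega>|M. iexp (\<Sum>j\<in>e ` V. ?Y j \<omega>))"
    by (intro integral_cong_AE) (measurable, auto)
  also have "\<dots> = char (distr M borel (\<lambda>\<omega>. \<Sum>j\<in>e ` V. ?Y j \<omega>)) 1"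
    unfolding char_def by (subst integral_distr) simp_all
  also have "\<dots> = (\<Prod>j\<in>e ` V. char (distr M borel (?Y j)) 1)"
    by (rule char_distr_sum[OF ind])
  also have "\<dots> = (\<Prod>v\<in>V. char (distr M borel (?Y (e v))) 1)" using e by (simp add: prod.reindex)
  also have "\<dots> = (\<Prod>v\<in>V. exp (t * Q.prob (B v) * (iexp v - 1)))"
  proof (rule prod.cong)
    fix v assume v: "v \<in> V"
    have [measurable]: "?Y (e v) \<in> borel_measurable M" using v by (intro Ym) simp
    have "char (distr M borel (?Y (e v))) 1 = (CLINT \<omega>|M. iexp (?Y (e v) \<omega>))"
      unfolding char_def by (subst integral_distr) simp_all
    also have "\<dots> = (CLINT \<omega>|M. iexp (v * real (cnt (B v) \<omega>)))"
    proof (rule integral_cong_AE)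
      show "AE \<omega> in M. iexp (?Y (e v) \<omega>) = iexp (v * real (cnt (B v) \<omega>))"
        using Y[OF v] by eventually_elim (simp only:)
      show "(\<lambda>\<omega>. iexp (?Y (e v) \<omega>)) \<in> borel_measurable M"
        by (rule measurable_compose[OF Ym]) (use v in auto)
    qed measurable
    finally show "char (distr M borel (?Y (e v))) 1 = exp (t * Q.prob (B v) * (iexp v - 1))"
      using expectation_iexp_cnt[of "B v" v] BW by simp
  qed simp
  also have "\<dots> = exp (t * (\<Sum>v\<in>V. Q.prob (B v) * (iexp v - 1)))"
    using V by (simp add: exp_sum sum_distrib_left mult.assoc)
  \<comment> \<open>The level sets lie in the window, which has full measure, so together they
    recover the integral over \<open>Q\<close>.\<close>
  also have "(\<Sum>v\<in>V. Q.prob (B v) * (iexp v - 1)) = (CLINT x|Q. iexp (g x) - 1)"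
  proof -
    have "(CLINT x|Q. iexp (g x) - 1) = (CLINT x|Q. (\<Sum>v\<in>V. indicator (B v) x *\<^sub>R (iexp v - 1)))"
    proof (rule integral_cong_AE)
      show "AE x in Q. iexp (g x) - 1 = (\<Sum>v\<in>V. indicator (B v) x *\<^sub>R (iexp v - 1))"
        using Q_W AE_space
      proof eventually_elim
        case (elim x)
        have "(\<Sum>v\<in>V. indicator (B v) x *\<^sub>R (iexp v - 1)) = (\<Sum>v\<in>{g x}. indicator (B v) x *\<^sub>R (iexp v - 1))"
          using V by (intro sum.mono_neutral_right) (auto simp: V_def B_def)
        then show ?case using elim by (simp add: B_def)
      qed
    qed measurable
    also have "\<dots> = (\<Sum>v\<in>V. Q.prob (B v) *\<^sub>R (iexp v - 1))"
      by (subst Bochner_Integration.integral_sum) (auto simp: Q.emeasure_eq_measure)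
    finally show ?thesis by (simp add: scaleR_conv_of_real)
  qed
  finally show ?thesis .
qed

text \<open>Rounding \<open>g\<close> down to multiples of 1 / (n + 1) gives functions of finite
  range that converge to \<open>g\<close>; dominated convergence applies on both sides, as
  characters have modulus 1.\<close>

theorem char_lin:
  assumes g [measurable]: "g \<in> borel_measurable Q" and bd: "\<And>x. \<bar>g x\<bar> \<le> C"
  shows "(CLINT \<omega>|M. iexp (lin g \<omega>)) = exp (t * (CLINT x|Q. iexp (g x) - 1))"
proof -
  define h where "h n x = real_of_int \<lfloor>real (Suc n) * g x\<rfloor> / real (Suc n)" for n x
  have [measurable]: "h n \<in> borel_measurable Q" for n unfolding h_def by measurable
  have fin: "finite (range (h n))" for n
  proof -
    have "range (h n) \<subseteq> (\<lambda>z. real_of_int z / real (Suc n)) ` {\<lfloor>- (real (Suc n) * C)\<rfloor>..\<lfloor>real (Suc n) * C\<rfloor>}"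
    proof (rule image_subsetI)
      fix x
      have "- (real (Suc n) * C) \<le> real (Suc n) * g x" "real (Suc n) * g x \<le> real (Suc n) * C"
        using bd[of x] mult_left_mono[of "- C" "g x" "real (Suc n)"] by (auto simp: abs_le_iff)
      then show "h n x \<in> (\<lambda>z. real_of_int z / real (Suc n)) ` {\<lfloor>- (real (Suc n) * C)\<rfloor>..\<lfloor>real (Suc n) * C\<rfloor>}"
        unfolding h_def by (intro imageI) (simp add: floor_mono del: of_nat_Suc)
    qed
    then show ?thesis by (rule finite_subset) simp
  qed
  have conv: "(\<lambda>n. h n x) \<longlonglongrightarrow> g x" for x
  proof -
    have "\<bar>h n x - g x\<bar> \<le> 1 / real (Suc n)" for n
    proof -
      have "\<bar>h n x - g x\<bar> = \<bar>real_of_int \<lfloor>real (Suc n) * g x\<rfloor> - real (Suc n) * g x\<bar> / real (Suc n)"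
        by (simp add: h_def field_simps abs_divide[symmetric] del: of_nat_Suc)
      also have "\<dots> \<le> 1 / real (Suc n)" by (intro divide_right_mono) linarith+
      finally show ?thesis .
    qed
    then show ?thesis
      by (intro LIM_zero_cancel[OF Lim_null_comparison[OF _ LIMSEQ_inverse_real_of_nat]] always_eventually)
        (simp add: inverse_eq_divide)
  qed
  have "(\<lambda>n. CLINT \<omega>|M. iexp (lin (h n) \<omega>)) \<longlonglongrightarrow> (CLINT \<omega>|M. iexp (lin g \<omega>))"
  proof (rule integral_dominated_convergence[where w="\<lambda>_. 1"])
    show "AE \<omega> in M. (\<lambda>n. iexp (lin (h n) \<omega>)) \<longlonglongrightarrow> iexp (lin g \<omega>)"
      unfolding lin_def by (intro AE_I2 tendsto_intros conv)
  qed auto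
  moreover have "(\<lambda>n. CLINT x|Q. iexp (h n x) - 1) \<longlonglongrightarrow> (CLINT x|Q. iexp (g x) - 1)"
  proof (rule integral_dominated_convergence[where w="\<lambda>_. 2"])
    show "AE x in Q. (\<lambda>n. iexp (h n x) - 1) \<longlonglongrightarrow> iexp (g x) - 1"
      by (intro AE_I2 tendsto_intros conv)
    show "AE x in Q. norm (iexp (h n x) - 1) \<le> 2" for n
      by (intro AE_I2 order_trans[OF norm_triangle_ineq4]) simp
  qed auto
  then have "(\<lambda>n. exp (t * (CLINT x|Q. iexp (h n x) - 1))) \<longlonglongrightarrow> exp (t * (CLINT x|Q. iexp (g x) - 1))"
    by (intro tendsto_intros)
  ultimately show ?thesis
    unfolding char_lin_finite_range[OF \<open>h _ \<in> _\<close> fin] by (rule LIMSEQ_unique)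
qed

end

context poisson_window
begin

text \<open>With \<theta> = u / sqrt t the centred exponent is t times the integral of exp (i
  \<theta> g) - 1 - i \<theta> g. Its quadratic part is exactly the Gaussian exponent with the
  uncentred second moment of g, and the cubic remainder contributes at most t (|\<theta>| C)^3 /
  6.\<close>

lemma char_lin_approx:
  assumes g [measurable]: "g \<in> borel_measurable Q" and bd: "\<And>x. \<bar>g x\<bar> \<le> C"
  shows "cmod ((CLINT \<omega>|M. iexp (u * ((lin g \<omega> - t * (\<integral>x. g x \<partial>Q)) / sqrt t))) -
    exp (- (u^2 * (\<integral>x. (g x)^2 \<partial>Q) / 2))) \<le> \<bar>u\<bar>^3 * C^3 / (6 * sqrt t)"
proof -
  define p where "p = (\<integral>x. g x \<partial>Q)"
  define s where "s = (\<integral>x. (g x)^2 \<partial>Q)"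
  define \<theta> where "\<theta> = u / sqrt t"
  have C: "0 \<le> C" using bd[of undefined] by linarith
  have int: "integrable Q g" by (rule Q.integrable_const_bound[where B=C]) (use bd in auto)
  have int2: "integrable Q (\<lambda>x. (g x)^2)"
    by (rule Q.integrable_const_bound[where B="C^2"]) (use bd C in \<open>auto simp: abs_le_square_iff[symmetric] power2_abs\<close>)
  have inti: "integrable Q (\<lambda>x. iexp (\<theta> * g x))"
    by (rule Q.integrable_const_bound[where B=1]) auto
  let ?E = "CLINT x|Q. iexp (\<theta> * g x) - 1 - \<i> * (\<theta> * g x)"
  have E: "?E = (CLINT x|Q. iexp (\<theta> * g x) - 1) - \<i> * (\<theta> * p)"
    using int inti by (simp add: p_def Q.prob_space)
  have lin: "lin (\<lambda>x. \<theta> * g x) \<omega> = \<theta> * lin g \<omega>" for \<omega> by (simp add: lin_def sum_distrib_left)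
  have "(CLINT \<omega>|M. iexp (u * ((lin g \<omega> - t * p) / sqrt t))) =
    (CLINT \<omega>|M. iexp (lin (\<lambda>x. \<theta> * g x) \<omega>) * exp (- (\<i> * (\<theta> * (t * p)))))"
    unfolding lin by (intro Bochner_Integration.integral_cong refl) (simp add: \<theta>_def exp_add[symmetric] diff_divide_distrib algebra_simps)
  also have "\<dots> = exp (t * (CLINT x|Q. iexp (\<theta> * g x) - 1)) * exp (- (\<i> * (\<theta> * (t * p))))"
  proof -
    have "\<bar>\<theta> * g x\<bar> \<le> \<bar>\<theta>\<bar> * C" for x using bd by (simp add: abs_mult mult_left_mono)
    from char_lin[OF _ this] show ?thesis by simp
  qed
  also have "\<dots> = exp (t * ?E)" unfolding E by (simp add: exp_add[symmetric] algebra_simps)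
  finally have 1: "(CLINT \<omega>|M. iexp (u * ((lin g \<omega> - t * p) / sqrt t))) = exp (t * ?E)" .
  have 2: "- (u^2 * s / 2) = t * (\<integral>x. - ((\<theta> * g x)^2 / 2) \<partial>Q)"
    using t by (simp add: s_def \<theta>_def power_mult_distrib power_divide field_simps)
  have inth: "integrable Q (\<lambda>x. complex_of_real (- ((\<theta> * g x)^2 / 2)))"
  proof -
    have "integrable Q (\<lambda>x. - ((\<theta> * g x)^2 / 2))" using int2 by (simp add: power_mult_distrib)
    then show ?thesis by (rule integrable_of_real)
  qed
  have intE: "integrable Q (\<lambda>x. iexp (\<theta> * g x) - 1 - \<i> * (\<theta> * g x))"
    using int inti by auto
  \<comment> \<open>The real part is an integral of cos - 1, so both exponents lie in the half-plane
    where exp is 1-Lipschitz.\<close>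
  have ReE: "Re ?E \<le> 0"
  proof -
    have "Re ?E = (\<integral>x. Re (iexp (\<theta> * g x) - 1 - \<i> * (\<theta> * g x)) \<partial>Q)"
      using intE by (rule integral_Re[symmetric])
    also have "\<dots> \<le> (\<integral>x. 0 \<partial>Q)"
      using integrable_Re[OF intE] by (intro integral_mono) (auto simp: Re_exp)
    finally show ?thesis by simp
  qed
  have s0: "0 \<le> s" unfolding s_def by simp
  have "cmod (exp (t * ?E) - exp (complex_of_real (- (u^2 * s / 2)))) \<le> cmod (t * ?E - complex_of_real (- (u^2 * s / 2)))"
    by (rule norm_exp_diff_le) (use ReE t s0 in \<open>auto simp: mult_nonneg_nonpos\<close>)
  also have "t * ?E - complex_of_real (- (u^2 * s / 2)) =
    t * (CLINT x|Q. (iexp (\<theta> * g x) - 1 - \<i> * (\<theta> * g x)) - complex_of_real (- ((\<theta> * g x)^2 / 2)))"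
  proof -
    have "complex_of_real (- (u^2 * s / 2)) = t * (CLINT x|Q. complex_of_real (- ((\<theta> * g x)^2 / 2)))"
      unfolding 2 by (simp only: of_real_mult integral_complex_of_real)
    then show ?thesis unfolding Bochner_Integration.integral_diff[OF intE inth] by (simp only: right_diff_distrib)
  qed
  also have "cmod \<dots> = t * cmod (CLINT x|Q. (iexp (\<theta> * g x) - 1 - \<i> * (\<theta> * g x)) - complex_of_real (- ((\<theta> * g x)^2 / 2)))"
    using t by (simp add: norm_mult)
  also have "\<dots> \<le> t * ((\<bar>\<theta>\<bar> * C)^3 / 6)"
  proof (intro mult_left_mono)
    show "cmod (CLINT x|Q. (iexp (\<theta> * g x) - 1 - \<i> * (\<theta> * g x)) - complex_of_real (- ((\<theta> * g x)^2 / 2))) \<le> (\<bar>\<theta>\<bar> * C)^3 / 6"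
    proof (rule order_trans[OF integral_norm_bound Q.integral_le_const])
      show "integrable Q (\<lambda>x. cmod ((iexp (\<theta> * g x) - 1 - \<i> * (\<theta> * g x)) - complex_of_real (- ((\<theta> * g x)^2 / 2))))"
        using intE inth by auto
      have est: "cmod ((iexp y - 1 - \<i> * y) - complex_of_real (- (y^2 / 2))) \<le> (\<bar>\<theta>\<bar> * C)^3 / 6" if "\<bar>y\<bar> \<le> \<bar>\<theta>\<bar> * C" for y
      proof -
        have "(iexp y - 1 - \<i> * y) - complex_of_real (- (y^2 / 2)) = iexp y - (\<Sum>k\<le>2. (\<i> * y)^k / fact k)"
          by (simp add: numeral_2_eq_2 power2_eq_square) (simp add: mult_ac flip: mult.assoc[of \<i> \<i>])
        also have "cmod \<dots> \<le> \<bar>y\<bar>^(Suc 2) / fact (Suc 2)" by (rule iexp_approx1)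
        also have "\<dots> = \<bar>y\<bar>^3 / 6" by (simp add: numeral_3_eq_3 fact_numeral)
        also have "\<dots> \<le> (\<bar>\<theta>\<bar> * C)^3 / 6" using that by (intro divide_right_mono power_mono) auto
        finally show ?thesis .
      qed
      show "AE x in Q. cmod ((iexp (\<theta> * g x) - 1 - \<i> * (\<theta> * g x)) - complex_of_real (- ((\<theta> * g x)^2 / 2))) \<le> (\<bar>\<theta>\<bar> * C)^3 / 6"
        unfolding of_real_mult[symmetric] using bd by (intro AE_I2 est) (simp add: abs_mult mult_left_mono)
    qed
  qed (use t in auto)
  also have "\<dots> = \<bar>u\<bar>^3 * C^3 / (6 * sqrt t)"
  proof -
    have "\<bar>\<theta>\<bar> = \<bar>u\<bar> / sqrt t" using t by (simp add: \<theta>_def)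
    moreover have "sqrt t ^ 3 = t * sqrt t" using t by (simp add: power3_eq_cube)
    ultimately show ?thesis using t by (simp add: power_mult_distrib power_divide)
  qed
  finally show ?thesis unfolding p_def[symmetric] s_def[symmetric] 1 by (simp add: exp_of_real[symmetric])
qed

text \<open>Two errors add up. Replacing the U-statistic by its linear part costs at most |u| times
  the mean of |Z - L|, and the linear part is compared with the Gaussian by
  \<open>char_lin_approx\<close>. The equation for \<open>Z\<close> is asked only almost surely,
  since flat sums equal U-statistics outside a null set.\<close>

theorem char_ustat:
  fixes F
  assumes F: "kernel m C F" and m: "1 \<le> m" and t1: "1 \<le> t"
    and Z [measurable]: "Z \<in> borel_measurable M"
    and Z_eq: "AE \<omega> in M. Z \<omega> = fact (m-1) / t powr (real m - 1/2) * (ustat m F \<omega> - expectation (ustat m F))"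
  shows "cmod (char (distr M borel Z) u -
      exp (- (u^2 * (\<integral>x. F (x ` {1..m}) * F (x ` {m..2*m-1}) \<partial>PiM {1..2*m-1} (\<lambda>_. Q)) / 2)))
    \<le> (\<bar>u\<bar> * (fact (m-1) * sqrt (C^2 * 16^m * (2^(2*m-2) + (2 * real (2*m-2))^(2*m-2)))) + \<bar>u\<bar>^3 * C^3 / 6) / sqrt t"
proof -
  define g where "g = proj m F"
  define p where "p = (\<integral>x. g x \<partial>Q)"
  define K where "K = C^2 * 16^m * (2^(2*m-2) + (2 * real (2*m-2))^(2*m-2))"
  define a where "a = fact (m-1) / t powr (real m - 1/2)"
  define Y where "Y \<omega> = ustat m F \<omega> - t^m / fact m * p - t^(m-1) / fact (m-1) * (lin g \<omega> - t * p)" for \<omega>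
  define L where "L \<omega> = (lin g \<omega> - t * p) / sqrt t" for \<omega>
  note main = ustat_linearization[OF F m t1, folded g_def, folded p_def, folded Y_def K_def]
  have g [measurable]: "g \<in> borel_measurable Q" unfolding g_def by (rule proj_measurable[OF F m])
  have gb: "\<bar>g x\<bar> \<le> C" for x using proj_bound[OF F m] by (simp add: g_def abs_of_nonneg)
  have [measurable]: "Y \<in> borel_measurable M" "L \<in> borel_measurable M"
    unfolding Y_def[abs_def] L_def[abs_def] using ustat_measurable[OF F] by measurable
  have pw: "t powr (real m - 1/2) = t^(m-1) * sqrt t"
  proof -
    have "t powr (real m - 1/2) = t powr (real (m-1) + 1/2)" using m by (simp add: of_nat_diff)
    also have "\<dots> = t^(m-1) * sqrt t" using t by (simp add: powr_add powr_realpow powr_half_sqrt)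
    finally show ?thesis .
  qed
  have "AE \<omega> in M. Z \<omega> - L \<omega> = a * Y \<omega>"
    using Z_eq
  proof eventually_elim
    case (elim \<omega>)
    have "a * (t^(m-1) / fact (m-1)) = 1 / sqrt t" using t by (simp add: a_def pw)
    then have "a * (t^(m-1) / fact (m-1) * (lin g \<omega> - t * p)) = L \<omega>"
      unfolding mult.assoc[symmetric] by (simp add: L_def)
    moreover have "Z \<omega> = a * (ustat m F \<omega> - t^m / fact m * p)"
      using elim unfolding main(2) a_def .
    moreover have "a * Y \<omega> = a * (ustat m F \<omega> - t^m / fact m * p) - a * (t^(m-1) / fact (m-1) * (lin g \<omega> - t * p))"
      unfolding Y_def by (rule right_diff_distrib)
    ultimately show ?case by (simp only:)
  qed
  then have ZL: "AE \<omega> in M. cmod (iexp (u * Z \<omega>) - iexp (u * L \<omega>)) \<le> \<bar>u\<bar> * a * \<bar>Y \<omega>\<bar>"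
  proof eventually_elim
    case (elim \<omega>)
    have "cmod (iexp (u * Z \<omega>) - iexp (u * L \<omega>)) \<le> cmod (\<i> * (u * Z \<omega>) - \<i> * (u * L \<omega>))"
      by (rule norm_exp_diff_le) auto
    also have "\<i> * (u * Z \<omega>) - \<i> * (u * L \<omega>) = \<i> * complex_of_real (u * (Z \<omega> - L \<omega>))"
      by (simp add: algebra_simps)
    also have "cmod \<dots> = \<bar>u\<bar> * \<bar>Z \<omega> - L \<omega>\<bar>" by (simp only: norm_mult norm_ii norm_of_real abs_mult mult_1_left)
    also have "\<dots> = \<bar>u\<bar> * a * \<bar>Y \<omega>\<bar>" using elim t by (simp add: abs_mult a_def)
    finally show ?case .
  qed
  have intY: "integrable M Y"
    by (rule square_integrable_imp_integrable) (use main(3) in auto)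
  \<comment> \<open>Nonnegativity of the variance of |Y| bounds the mean of |Y| by the root of the
    second moment.\<close>
  have EY: "expectation (\<lambda>\<omega>. \<bar>Y \<omega>\<bar>) \<le> sqrt (K * t^(2*m-2))"
  proof (rule real_le_rsqrt)
    have "0 \<le> variance (\<lambda>\<omega>. \<bar>Y \<omega>\<bar>)" by simp
    also have "\<dots> = expectation (\<lambda>\<omega>. \<bar>Y \<omega>\<bar>^2) - (expectation (\<lambda>\<omega>. \<bar>Y \<omega>\<bar>))^2"
      using intY main(3) by (intro variance_eq) auto
    finally show "(expectation (\<lambda>\<omega>. \<bar>Y \<omega>\<bar>))^2 \<le> K * t^(2*m-2)" using main(4) by simp
  qed
  have "cmod (char (distr M borel Z) u - (CLINT \<omega>|M. iexp (u * L \<omega>))) = cmod (CLINT \<omega>|M. iexp (u * Z \<omega>) - iexp (u * L \<omega>))"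
  proof -
    have "integrable M (\<lambda>\<omega>. iexp (u * Z \<omega>))" "integrable M (\<lambda>\<omega>. iexp (u * L \<omega>))"
      by (rule integrable_const_bound[where B=1]; auto)+
    then show ?thesis unfolding char_def by (subst integral_distr) auto
  qed
  also have "\<dots> \<le> expectation (\<lambda>\<omega>. \<bar>u\<bar> * a * \<bar>Y \<omega>\<bar>)"
  proof (rule order_trans[OF integral_norm_bound integral_mono_AE[OF _ _ ZL]])
    show "integrable M (\<lambda>\<omega>. cmod (iexp (u * Z \<omega>) - iexp (u * L \<omega>)))"
      by (rule integrable_const_bound[where B=2]) (auto intro!: AE_I2 order_trans[OF norm_triangle_ineq4])
  qed (use intY in auto)
  also have "\<dots> = \<bar>u\<bar> * a * expectation (\<lambda>\<omega>. \<bar>Y \<omega>\<bar>)" by simp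
  also have "\<dots> \<le> \<bar>u\<bar> * a * sqrt (K * t^(2*m-2))"
    using EY t by (intro mult_left_mono) (auto simp: a_def)
  \<comment> \<open>The remainder is of order t^(m-1) and the normalization of order t^(m-1/2); the
    ratio is 1 / sqrt t.\<close>
  also have "\<dots> = \<bar>u\<bar> * (fact (m-1) * sqrt K) / sqrt t"
  proof -
    have "t^(2*m-2) = (t^(m-1))^2" by (simp add: power_mult[symmetric] diff_mult_distrib2 mult.commute)
    then have "sqrt (K * t^(2*m-2)) = sqrt K * t^(m-1)" using t by (simp add: real_sqrt_mult)
    then show ?thesis using t by (simp add: a_def pw)
  qed
  finally have A: "cmod (char (distr M borel Z) u - (CLINT \<omega>|M. iexp (u * L \<omega>))) \<le> \<bar>u\<bar> * (fact (m-1) * sqrt K) / sqrt t" .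
  have B: "cmod ((CLINT \<omega>|M. iexp (u * L \<omega>)) - exp (- (u^2 * (\<integral>x. (g x)^2 \<partial>Q) / 2))) \<le> \<bar>u\<bar>^3 * C^3 / (6 * sqrt t)"
    unfolding L_def p_def by (rule char_lin_approx[OF g gb])
  have s: "(\<integral>x. F (x ` {1..m}) * F (x ` {m..2*m-1}) \<partial>PiM {1..2*m-1} (\<lambda>_. Q)) = (\<integral>x. (g x)^2 \<partial>Q)"
    unfolding g_def by (rule integral_overlap_one[OF F m])
  show ?thesis
    unfolding s K_def[symmetric]
    using norm_triangle_le[OF add_mono[OF A B]] by (simp add: add_divide_distrib)
qed

end

section \<open>Gaussian limits and the continuity theorem\<close>

lemma real_distribution_gaussian: "0 \<le> v \<Longrightarrow> real_distribution (gaussian 0 v)"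
proof -
  assume v: "0 \<le> v"
  have "prob_space (gaussian 0 v)"
    using v by (auto simp: gaussian_def intro!: prob_space_return prob_space_normal_density)
  then show ?thesis
    unfolding real_distribution_def real_distribution_axioms_def by (simp add: gaussian_def)
qed

text \<open>Variance 0 is the point mass at 0; otherwise the law is that of \<open>sqrt v\<close>
  times a standard normal variable.\<close>

lemma char_gaussian:
  assumes v: "0 \<le> v" shows "char (gaussian 0 v) u = exp (- (u^2 * v / 2))"
proof (cases "v = 0")
  case True
  then show ?thesis by (simp add: gaussian_def char_def integral_return)
next
  case False
  with v have v: "0 < v" by simp
  interpret N: prob_space std_normal_distribution by (rule prob_space_normal_density) simp
  have "distributed std_normal_distribution lborel (\<lambda>x. x) std_normal_density"
    unfolding distributed_def by (auto simp: distr_id2)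
  from N.normal_density_affine[OF this _ , of "sqrt v" 0] v
  have "distributed std_normal_distribution lborel (\<lambda>x. sqrt v * x) (normal_density 0 (sqrt v))" by simp
  then have "distr std_normal_distribution lborel (\<lambda>x. sqrt v * x) = gaussian 0 v"
    using v by (simp add: distributed_def gaussian_def)
  then have "char (gaussian 0 v) u = char std_normal_distribution (u * sqrt v)"
    unfolding char_def by (subst \<open>_ = gaussian 0 v\<close>[symmetric], subst integral_distr) (auto simp: mult_ac)
  also have "\<dots> = exp (- (u^2 * v / 2))"
    using v by (simp add: char_std_normal_distribution power_mult_distrib)
  finally show ?thesis .
qed

text \<open>The continuity theorem concerns sequences; a limit at infinity along the reals follows
  from all sequences of radii that tend to infinity.\<close>

lemma converges_in_distribution_char:
  assumes M: "prob_space M" and Z: "\<And>r. 0 < r \<Longrightarrow> Z r \<in> borel_measurable M" and v: "0 \<le> v"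
    and conv: "\<And>u. ((\<lambda>r. char (distr M borel (Z r)) u) \<longlongrightarrow> exp (- (u^2 * v / 2))) at_top"
  shows "converges_in_distribution M Z (gaussian 0 v)"
  unfolding converges_in_distribution_def
proof (intro allI impI)
  fix x assume x: "isCont (cdf (gaussian 0 v)) x"
  interpret prob_space M by fact
  show "((\<lambda>r. cdf (distr M borel (Z r)) x) \<longlongrightarrow> cdf (gaussian 0 v) x) at_top"
  proof (rule tendsto_at_topI_sequentially)
    fix R :: "nat \<Rightarrow> real" assume R: "filterlim R at_top sequentially"
    \<comment> \<open>Changing finitely many terms makes all radii positive, where measurability is
      assumed.\<close>
    define R' where "R' n = (if 0 < R n then R n else 1)" for n
    have ev: "\<forall>\<^sub>F n in sequentially. R' n = R n"
      using filterlim_at_top_dense[THEN iffD1, OF R, rule_format, of 0] by eventually_elim (simp add: R'_def)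
    have R'_lim: "filterlim R' at_top sequentially"
      by (rule filterlim_cong[OF refl refl ev, THEN iffD2, OF R])
    have "weak_conv_m (\<lambda>n. distr M borel (Z (R' n))) (gaussian 0 v)"
    proof (rule levy_continuity)
      fix n
      have "Z (R' n) \<in> borel_measurable M" by (rule Z) (simp add: R'_def)
      then show "real_distribution (distr M borel (Z (R' n)))" by simp
    next
      fix u
      show "(\<lambda>n. char (distr M borel (Z (R' n))) u) \<longlonglongrightarrow> char (gaussian 0 v) u"
        unfolding char_gaussian[OF v] using filterlim_compose[OF conv R'_lim] by simp
    qed (rule real_distribution_gaussian[OF v])
    then have "(\<lambda>n. cdf (distr M borel (Z (R' n))) x) \<longlonglongrightarrow> cdf (gaussian 0 v) x"
      using x by (simp add: weak_conv_m_def weak_conv_def)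
    then show "(\<lambda>n. cdf (distr M borel (Z (R n))) x) \<longlonglongrightarrow> cdf (gaussian 0 v) x"
      by (rule Lim_transform_eventually) (use ev in eventually_elim, simp)
  qed
qed

section \<open>Hausdorff measure of flats in a ball\<close>

definition covers :: "'a::metric_space set \<Rightarrow> real \<Rightarrow> (nat \<Rightarrow> 'a set) set"
  where "covers A \<delta> = {U. A \<subseteq> (\<Union>i. U i) \<and> (\<forall>i. bounded (U i) \<and> diameter (U i) \<le> \<delta>)}"

definition cover_sum :: "nat \<Rightarrow> (nat \<Rightarrow> 'a::metric_space set) \<Rightarrow> ennreal"
  where "cover_sum k U = (\<Sum>i. ennreal (unit_ball_vol (real k) * (diameter (U i) / 2) ^ k))"

lemma nu_eq_covers: "0 < k \<Longrightarrow> nu k A = (SUP \<delta>\<in>{0<..}. INF U\<in>covers A \<delta>. cover_sum k U)"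
  by (simp add: nu_def covers_def cover_sum_def)

section \<open>Open covers and measurability of Hausdorff measure\<close>

lemma thickening_radius:
  fixes d c e \<delta> :: real
  assumes "0 < e" "0 < \<delta>"
  shows "\<exists>\<eta>>0. 2 * \<eta> \<le> \<delta> \<and> c * ((d + 2 * \<eta>) / 2) ^ k \<le> c * (d / 2) ^ k + e"
proof -
  have "((\<lambda>\<eta>. c * ((d + 2 * \<eta>) / 2) ^ k) \<longlongrightarrow> c * ((d + 2 * 0) / 2) ^ k) (at_right 0)"
    by (intro tendsto_intros) auto
  then have "\<forall>\<^sub>F \<eta> in at_right 0. c * ((d + 2 * \<eta>) / 2) ^ k < c * (d / 2) ^ k + e"
    using assms by (intro order_tendstoD(2)) auto
  moreover have "\<forall>\<^sub>F \<eta> in at_right 0. \<eta> < \<delta> / 2" using assms by (intro order_tendstoD(2)[OF tendsto_ident_at]) auto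
  moreover have "\<forall>\<^sub>F \<eta> in at_right (0::real). 0 < \<eta>" by (rule eventually_at_right_less)
  ultimately have "\<forall>\<^sub>F \<eta> in at_right 0. 0 < \<eta> \<and> 2 * \<eta> \<le> \<delta> \<and> c * ((d + 2 * \<eta>) / 2) ^ k \<le> c * (d / 2) ^ k + e"
    by eventually_elim auto
  then show ?thesis using eventually_happens[of _ "at_right (0::real)"] trivial_limit_at_right_real by blast
qed

lemma diameter_thickening:
  fixes U :: "'a::euclidean_space set"
  assumes "bounded U" "0 < \<eta>"
  shows "bounded (\<Union>u\<in>U. ball u \<eta>)" "diameter (\<Union>u\<in>U. ball u \<eta>) \<le> diameter U + 2 * \<eta>"
proof -
  have d: "norm (x - y) \<le> diameter U + 2 * \<eta>" if "x \<in> (\<Union>u\<in>U. ball u \<eta>)" "y \<in> (\<Union>u\<in>U. ball u \<eta>)" for x y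
  proof -
    from that obtain u v where uv: "u \<in> U" "v \<in> U" "dist u x < \<eta>" "dist v y < \<eta>" by auto
    have "norm (x - y) \<le> dist x u + (dist u v + dist v y)"
      using dist_triangle[of x y u] dist_triangle[of u y v] by (simp add: dist_norm)
    moreover have "dist u v \<le> diameter U" using diameter_bounded_bound[OF assms(1) uv(1,2)] .
    ultimately show ?thesis using uv by (simp add: dist_commute)
  qed
  show "diameter (\<Union>u\<in>U. ball u \<eta>) \<le> diameter U + 2 * \<eta>"
    using d diameter_ge_0[OF assms(1)] assms(2) by (intro diameter_le) auto
  show "bounded (\<Union>u\<in>U. ball u \<eta>)"
  proof (cases "U = {}")
    case False
    then obtain u where "u \<in> U" by auto
    then have "u \<in> (\<Union>u\<in>U. ball u \<eta>)" using assms(2) by (intro UN_I) auto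
    then show ?thesis unfolding bounded_def dist_norm using d by blast
  qed simp
qed

text \<open>Each covering set is thickened by a radius small enough to raise its summand by at most
  e / 2^(i+1), so the total grows by at most e. Mesh bounds of the form 1 / (n + 1) suffice because
  the infimum grows as the mesh shrinks.\<close>

lemma nu_eq_open_covers:
  fixes A :: "'a::euclidean_space set"
  assumes k: "0 < k"
  shows "nu k A = (SUP n::nat. INF U\<in>{U\<in>covers A (1 / real (Suc n)). \<forall>i. open (U i)}. cover_sum k U)"
    (is "_ = (SUP n. ?H n)")
proof (rule antisym)
  show "nu k A \<le> (SUP n. ?H n)"
    unfolding nu_eq_covers[OF k]
  proof (rule SUP_least)
    fix \<delta> :: real assume "\<delta> \<in> {0<..}"
    then obtain n where n: "1 / real (Suc n) < \<delta>"
      using reals_Archimedean[of \<delta>] by (auto simp: inverse_eq_divide)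
    have "(INF U\<in>covers A \<delta>. cover_sum k U) \<le> ?H n"
    proof (rule INF_superset_mono)
      show "{U\<in>covers A (1 / real (Suc n)). \<forall>i. open (U i)} \<subseteq> covers A \<delta>"
        using n unfolding covers_def by (auto intro: order_trans less_imp_le)
    qed simp
    also have "\<dots> \<le> (SUP n. ?H n)" by (rule SUP_upper) simp
    finally show "(INF U\<in>covers A \<delta>. cover_sum k U) \<le> (SUP n. ?H n)" .
  qed
  show "(SUP n. ?H n) \<le> nu k A"
  proof (rule SUP_least)
    fix n :: nat
    \<comment> \<open>Half of the mesh 1 / (n + 1) is reserved for the thickening.\<close>
    define \<delta> where "\<delta> = 1 / (2 * real (Suc n))"
    have \<delta>: "0 < \<delta>" "2 * \<delta> = 1 / real (Suc n)" by (auto simp: \<delta>_def field_simps)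
    have "?H n \<le> cover_sum k U" if U: "U \<in> covers A \<delta>" for U
    proof (rule ennreal_le_epsilon)
      fix e :: real assume e: "0 < e"
      let ?c = "unit_ball_vol (real k)"
      have "\<exists>\<eta>>0. 2 * \<eta> \<le> \<delta> \<and> ?c * ((diameter (U i) + 2 * \<eta>) / 2) ^ k \<le> ?c * (diameter (U i) / 2) ^ k + e * (1/2) ^ Suc i" for i
        using e \<delta> by (intro thickening_radius) auto
      then obtain \<eta> where \<eta>: "\<And>i. 0 < \<eta> i" "\<And>i. 2 * \<eta> i \<le> \<delta>"
        "\<And>i. ?c * ((diameter (U i) + 2 * \<eta> i) / 2) ^ k \<le> ?c * (diameter (U i) / 2) ^ k + e * (1/2) ^ Suc i" by metis
      define V where "V i = (\<Union>u\<in>U i. ball u (\<eta> i))" for i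
      have bU: "bounded (U i)" and dU: "diameter (U i) \<le> \<delta>" for i using U by (auto simp: covers_def)
      have bV: "bounded (V i)" "diameter (V i) \<le> diameter (U i) + 2 * \<eta> i" for i
        unfolding V_def by (rule diameter_thickening[OF bU \<eta>(1)])+
      have "U i \<subseteq> V i" for i unfolding V_def using \<eta>(1)[of i] by (intro subsetI UN_I) auto
      then have "(\<Union>i. U i) \<subseteq> (\<Union>i. V i)" by (intro UN_mono) auto
      moreover have "A \<subseteq> (\<Union>i. U i)" using U by (simp add: covers_def)
      ultimately have "A \<subseteq> (\<Union>i. V i)" by (rule order_trans[rotated])
      moreover have "diameter (V i) \<le> 1 / real (Suc n)" for i
        using bV(2)[of i] dU[of i] \<eta>(2)[of i] \<delta>(2) by linarith
      ultimately have "V \<in> {U\<in>covers A (1 / real (Suc n)). \<forall>i. open (U i)}"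
        using bV by (auto simp: covers_def V_def)
      then have "?H n \<le> cover_sum k V" by (rule INF_lower)
      also have "\<dots> \<le> (\<Sum>i. ennreal (?c * (diameter (U i) / 2) ^ k) + ennreal (e * (1/2) ^ Suc i))"
        unfolding cover_sum_def
      proof (rule suminf_le)
        fix i
        have "?c * (diameter (V i) / 2) ^ k \<le> ?c * ((diameter (U i) + 2 * \<eta> i) / 2) ^ k"
          using bV(2)[of i] diameter_ge_0[OF bV(1)] by (intro mult_left_mono power_mono) auto
        also note \<eta>(3)
        finally have le: "?c * (diameter (V i) / 2) ^ k \<le> ?c * (diameter (U i) / 2) ^ k + e * (1/2) ^ Suc i" .
        have pos: "0 \<le> ?c * (diameter (U i) / 2) ^ k" "0 \<le> e * (1/2) ^ Suc i"
          using e diameter_ge_0[OF bU] by auto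
        show "ennreal (?c * (diameter (V i) / 2) ^ k) \<le> ennreal (?c * (diameter (U i) / 2) ^ k) + ennreal (e * (1/2) ^ Suc i)"
          unfolding ennreal_plus[OF pos, symmetric] by (rule ennreal_leI[OF le])
      qed auto
      also have "\<dots> = cover_sum k U + (\<Sum>i. ennreal (e * (1/2) ^ Suc i))"
        unfolding cover_sum_def by (rule suminf_add[symmetric]) auto
      also have "(\<Sum>i. ennreal (e * (1/2) ^ Suc i)) = ennreal (e * 1)"
        using e by (intro suminf_ennreal_eq sums_mult power_half_series) auto
      finally show "?H n \<le> cover_sum k U + ennreal e" by simp
    qed
    then have "?H n \<le> (INF U\<in>covers A \<delta>. cover_sum k U)" by (rule INF_greatest)
    also have "\<dots> \<le> nu k A" unfolding nu_eq_covers[OF k] using \<delta> by (intro SUP_upper) auto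
    finally show "?H n \<le> nu k A" .
  qed
qed

text \<open>The hypothesis is upper semicontinuity of the set-valued map. The infimum over covers is
  below y when some open cover of small sum contains \<open>f x\<close>; this is a union of open
  conditions, and openness survives uncountable unions.\<close>

lemma borel_measurable_nu_usc:
  fixes f :: "'c::topological_space \<Rightarrow> 'a::euclidean_space set"
  assumes k: "0 < k" and usc: "\<And>T. open T \<Longrightarrow> open {x. f x \<subseteq> T}"
  shows "(\<lambda>x. nu k (f x)) \<in> borel_measurable borel"
proof -
  have "(\<lambda>x. INF U\<in>{U\<in>covers (f x) (1 / real (Suc n)). \<forall>i. open (U i)}. cover_sum k U) \<in> borel_measurable borel" for n
  proof (rule borel_measurableI_less)
    fix y
    have "{x\<in>space borel. (INF U\<in>{U\<in>covers (f x) (1 / real (Suc n)). \<forall>i. open (U i)}. cover_sum k U) < y} =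
      (\<Union>U\<in>{U. (\<forall>i. open (U i)) \<and> (\<forall>i. bounded (U i) \<and> diameter (U i) \<le> 1 / real (Suc n)) \<and> cover_sum k U < y}.
        {x. f x \<subseteq> (\<Union>i. U i)})"
      by (auto simp: INF_less_iff covers_def)
    also have "open \<dots>" by (intro open_UN ballI usc) auto
    finally show "{x\<in>space borel. (INF U\<in>{U\<in>covers (f x) (1 / real (Suc n)). \<forall>i. open (U i)}. cover_sum k U) < y} \<in> sets borel"
      by (simp add: borel_open)
  qed
  then show ?thesis unfolding nu_eq_open_covers[OF k] by (intro borel_measurable_SUP) auto
qed

text \<open>A convex set has no point, one point, or a whole segment and hence infinitely many
  points.\<close>

lemma nu_0: "convex A \<Longrightarrow> nu 0 (A :: 'a::euclidean_space set) = (if A = {} then 0 else if \<exists>x\<in>A. \<exists>y\<in>A. x \<noteq> y then \<infinity> else 1)"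
proof -
  assume c: "convex A"
  consider "A = {}" | x where "A = {x}" | x y where "x \<in> A" "y \<in> A" "x \<noteq> y" by blast
  then show ?thesis
  proof cases
    case (3 x y)
    have "infinite (closed_segment x y)" using 3(3) by (simp add: finite_closed_segment)
    moreover have "closed_segment x y \<subseteq> A" using 3 c by (simp add: closed_segment_subset)
    ultimately have "infinite A" using finite_subset by blast
    then show ?thesis using 3 by (auto simp: nu_def)
  qed (auto simp: nu_def)
qed

text \<open>Distinct points lie in disjoint closed balls of radius 1 / (n + 1) with centres in the
  dense set. With a countable dense set this expresses the left-hand side by countably many events
  of hitting a closed set.\<close>

lemma two_points_iff:
  fixes A :: "'a::euclidean_space set"
  assumes D: "\<And>x::'a. \<And>e. 0 < e \<Longrightarrow> \<exists>q\<in>D. dist q x < e"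
  shows "(\<exists>x\<in>A. \<exists>y\<in>A. x \<noteq> y) \<longleftrightarrow>
    (\<exists>p\<in>D. \<exists>q\<in>D. \<exists>n::nat. cball p (1 / real (Suc n)) \<inter> cball q (1 / real (Suc n)) = {} \<and>
      A \<inter> cball p (1 / real (Suc n)) \<noteq> {} \<and> A \<inter> cball q (1 / real (Suc n)) \<noteq> {})" (is "?L = ?R")
proof
  assume ?L
  then obtain x y where xy: "x \<in> A" "y \<in> A" "x \<noteq> y" by blast
  then obtain n where n: "1 / real (Suc n) < dist x y / 4"
    using reals_Archimedean[of "dist x y / 4"] by (auto simp: inverse_eq_divide)
  obtain p q where pq: "p \<in> D" "q \<in> D" "dist p x < 1 / real (Suc n)" "dist q y < 1 / real (Suc n)"
    using D[of "1 / real (Suc n)"] by (meson of_nat_0_less_iff zero_less_Suc zero_less_divide_1_iff)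
  have "cball p (1 / real (Suc n)) \<inter> cball q (1 / real (Suc n)) = {}"
  proof (rule ccontr)
    assume "\<not> ?thesis"
    then obtain z where z: "dist p z \<le> 1 / real (Suc n)" "dist q z \<le> 1 / real (Suc n)" by auto
    have "dist x y \<le> dist x p + dist p z + (dist z q + dist q y)"
      using dist_triangle[of x y p] dist_triangle[of p y z] dist_triangle[of z y q] dist_triangle[of x z p] dist_triangle[of x y z] by linarith
    then show False using z pq(3,4) n by (simp add: dist_commute)
  qed
  then show ?R using pq xy by (intro bexI[of _ p] bexI[of _ q] exI[of _ n]) auto
next
  assume ?R
  then obtain p q n x y where "cball p (1 / real (Suc n)) \<inter> cball q (1 / real (Suc n)) = {}"
    "x \<in> A" "x \<in> cball p (1 / real (Suc n))" "y \<in> A" "y \<in> cball q (1 / real (Suc n))"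
    by (elim bexE exE conjE) (meson IntE ex_in_conv)
  then have "x \<noteq> y" by (metis disjoint_iff)
  then show ?L using \<open>x \<in> A\<close> \<open>y \<in> A\<close> by (intro bexI)
qed

lemma borel_measurable_nu_0:
  fixes f :: "'c::topological_space \<Rightarrow> 'a::euclidean_space set"
  assumes cl: "\<And>T. closed T \<Longrightarrow> closed {x. f x \<inter> T \<noteq> {}}" and conv: "\<And>x. convex (f x)"
  shows "(\<lambda>x. nu 0 (f x)) \<in> borel_measurable borel"
proof -
  obtain D :: "'a set" where D: "countable D" "\<And>X. open X \<Longrightarrow> X \<noteq> {} \<Longrightarrow> \<exists>d\<in>D. d \<in> X"
    using countable_dense_exists by blast
  have D': "\<exists>q\<in>D. dist q x < e" if "0 < e" for x e
    using D(2)[of "ball x e"] that by (auto simp: dist_commute intro: centre_in_ball[THEN iffD2])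
  have hit: "{x. f x \<inter> T \<noteq> {}} \<in> sets borel" if "closed T" for T using cl[OF that] by (rule borel_closed)
  have [measurable]: "Measurable.pred borel (\<lambda>x. f x \<inter> cball p e \<noteq> {})" for p e
    using hit[of "cball p e"] by (simp add: pred_def)
  have [measurable]: "Measurable.pred borel (\<lambda>x. \<exists>y\<in>f x. \<exists>z\<in>f x. y \<noteq> z)"
  proof -
    let ?c = "\<lambda>p (n::nat). cball p (1 / real (Suc n))"
    let ?B = "\<lambda>p q n. {x. ?c p n \<inter> ?c q n = {} \<and> f x \<inter> ?c p n \<noteq> {} \<and> f x \<inter> ?c q n \<noteq> {}}"
    have B: "?B p q n \<in> sets borel" for p q n
    proof -
      have "Measurable.pred borel (\<lambda>x. ?c p n \<inter> ?c q n = {} \<and> f x \<inter> ?c p n \<noteq> {} \<and> f x \<inter> ?c q n \<noteq> {})"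
        by measurable
      then show ?thesis by (simp add: pred_def)
    qed
    have "{x. \<exists>p\<in>D. \<exists>q\<in>D. \<exists>n. ?c p n \<inter> ?c q n = {} \<and> f x \<inter> ?c p n \<noteq> {} \<and> f x \<inter> ?c q n \<noteq> {}} =
      (\<Union>p\<in>D. \<Union>q\<in>D. \<Union>n. ?B p q n)" by (simp only: set_eq_iff UN_iff mem_Collect_eq) simp
    also have "\<dots> \<in> sets borel" by (intro sets.countable_UN' sets.countable_UN D(1) image_subsetI B) auto
    finally have "Measurable.pred borel (\<lambda>x. \<exists>p\<in>D. \<exists>q\<in>D. \<exists>n. ?c p n \<inter> ?c q n = {} \<and> f x \<inter> ?c p n \<noteq> {} \<and> f x \<inter> ?c q n \<noteq> {})"
      by (simp add: pred_def)
    then show ?thesis using two_points_iff[OF D', where A="f _"] by simp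
  qed
  have [measurable]: "Measurable.pred borel (\<lambda>x. f x \<noteq> {})" using hit[of UNIV] by (simp add: pred_def)
  have "Measurable.pred borel (\<lambda>x. \<not> f x \<noteq> {})" by measurable
  then have [measurable]: "Measurable.pred borel (\<lambda>x. f x = {})" by simp
  show ?thesis unfolding nu_0[OF conv] by measurable
qed

section \<open>Bounds and scaling of Hausdorff measure\<close>

lemma nu_le_finite_cover:
  fixes A :: "'a::euclidean_space set"
  assumes k: "0 < k" and S: "finite S" and A: "A \<subseteq> (\<Union>s\<in>S. U s)"
    and U: "\<And>s. s \<in> S \<Longrightarrow> bounded (U s)" "\<And>s. s \<in> S \<Longrightarrow> diameter (U s) \<le> d"
    and d: "0 \<le> d" "d \<le> \<delta>"
  shows "(INF V\<in>covers A \<delta>. cover_sum k V) \<le> ennreal (real (card S) * (unit_ball_vol (real k) * (d / 2) ^ k))"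
proof -
  obtain h where h: "bij_betw h {..<card S} S"
    using ex_bij_betw_nat_finite[OF S] by (auto simp: lessThan_atLeast0)
  \<comment> \<open>Padding with empty sets makes a sequence of the finite cover; they contribute 0
    because k is positive.\<close>
  define V where "V i = (if i < card S then U (h i) else {})" for i
  have hS: "h i \<in> S" if "i < card S" for i using h that by (auto simp: bij_betw_def)
  have dV: "bounded (V i)" "diameter (V i) \<le> d" for i
    using U hS d by (auto simp: V_def)
  have "A \<subseteq> (\<Union>i. V i)"
  proof
    fix x assume "x \<in> A"
    then obtain s where s: "s \<in> S" "x \<in> U s" using A by auto
    then obtain i where "i < card S" "h i = s" using h by (metis bij_betw_imp_surj_on imageE lessThan_iff)
    then show "x \<in> (\<Union>i. V i)" using s by (auto simp: V_def intro!: exI[of _ i])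
  qed
  then have "V \<in> covers A \<delta>" using dV d by (auto simp: covers_def intro: order_trans)
  then have "(INF V\<in>covers A \<delta>. cover_sum k V) \<le> cover_sum k V" by (rule INF_lower)
  also have "\<dots> = (\<Sum>i<card S. ennreal (unit_ball_vol (real k) * (diameter (V i) / 2) ^ k))"
    unfolding cover_sum_def by (rule suminf_finite) (use k in \<open>auto simp: V_def\<close>)
  also have "\<dots> \<le> (\<Sum>i<card S. ennreal (unit_ball_vol (real k) * (d / 2) ^ k))"
    using dV diameter_ge_0[OF dV(1)] by (intro sum_mono ennreal_leI mult_left_mono power_mono) auto
  also have "\<dots> = ennreal (real (card S) * (unit_ball_vol (real k) * (d / 2) ^ k))"
    using d by (simp add: ennreal_mult ennreal_of_nat_eq_real_of_nat)
  finally show ?thesis .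
qed

lemma nu_empty: "nu k ({} :: 'a::euclidean_space set) = 0"
proof (cases "k = 0")
  case False
  have "(INF V\<in>covers ({} :: 'a set) \<delta>. cover_sum k V) \<le> 0" if "0 < \<delta>" for \<delta>
    using nu_le_finite_cover[of k "{}" "{}" "\<lambda>_. {}" 0 \<delta>] False that by simp
  then have "nu k ({} :: 'a set) \<le> 0"
    using False by (subst nu_eq_covers) (auto intro!: SUP_least)
  then show ?thesis by simp
qed (simp add: nu_def)

text \<open>In an orthonormal basis of \<open>L\<close> the set lies in a cube of side 2R, which is
  cut into a grid. The diameter of a cell is estimated by the sum of its side lengths, and (1 + N) /
  N \<le> 2 keeps the total bounded for every mesh. The constant is crude, but it scales as the
  volume does.\<close>

lemma nu_subspace_bound:
  fixes A L :: "'a::euclidean_space set"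
  assumes L: "subspace L" and A: "\<And>x. x \<in> A \<Longrightarrow> x - a \<in> L \<and> norm (x - a) \<le> R" and R: "0 < R"
  shows "nu (dim L) A \<le> ennreal (unit_ball_vol (real (dim L)) * (2 * real (dim L) * R) ^ dim L)"
proof (cases "dim L = 0")
  case True
  then have "L \<subseteq> {0}" by simp
  then have "A \<subseteq> {a}" using A by force
  then have "A = {} \<or> A = {a}" by blast
  then show ?thesis unfolding True by (auto simp: nu_def)
next
  case False
  then have k: "0 < dim L" by (rule neq0_conv[THEN iffD1])
  let ?k = "dim L"
  obtain B where B: "B \<subseteq> L" "pairwise orthogonal B" "\<And>x. x \<in> B \<Longrightarrow> norm x = 1" "independent B" "card B = ?k" "span B = L"
    using orthonormal_basis_subspace[OF L] by metis
  have finB: "finite B" using B(4) by (rule independent_imp_finite)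
  have ip: "b \<bullet> b' = (if b = b' then 1 else 0)" if "b \<in> B" "b' \<in> B" for b b'
    using B(2,3) that by (auto simp: pairwise_def orthogonal_def norm_eq_1)
  have expand: "z = (\<Sum>b\<in>B. (z \<bullet> b) *\<^sub>R b)" if "z \<in> L" for z
  proof -
    have "z \<in> range (\<lambda>u. \<Sum>b\<in>B. u b *\<^sub>R b)"
      using that unfolding B(6)[symmetric] span_finite[OF finB] .
    then obtain u where u: "z = (\<Sum>b\<in>B. u b *\<^sub>R b)" by auto
    have "z \<bullet> b = u b" if "b \<in> B" for b
    proof -
      have "z \<bullet> b = (\<Sum>b'\<in>B. u b' * (b' \<bullet> b))" by (simp add: u inner_sum_left)
      also have "\<dots> = (\<Sum>b'\<in>B. if b' = b then u b' else 0)"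
        using that by (intro sum.cong) (auto simp: ip)
      finally show ?thesis using that finB by simp
    qed
    then show ?thesis using u by (metis (no_types, lifting) sum.cong)
  qed
  show ?thesis unfolding nu_eq_covers[OF k]
  proof (rule SUP_least)
    fix \<delta> :: real assume "\<delta> \<in> {0<..}"
    then have \<delta>: "0 < \<delta>" by simp
    \<comment> \<open>Fine enough for the diameter bound of a cell to fall below \<delta>.\<close>
    define N where "N = Suc (nat \<lceil>real ?k * (2 * R) / \<delta>\<rceil>)"
    have N: "0 < real N" by (simp add: N_def)
    have "real ?k * (2 * R) / \<delta> \<le> real N" unfolding N_def by linarith
    then have N\<delta>: "real ?k * (2 * R / real N) \<le> \<delta>" using \<delta> N by (simp add: field_simps)
    \<comment> \<open>There are \<open>Suc N\<close> values, because a coordinate at the right end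
      has the floor \<open>N\<close>.\<close>
    define S where "S = B \<rightarrow>\<^sub>E {..<Suc N}"
    define U where "U c = {x\<in>A. \<forall>b\<in>B. c b = nat \<lfloor>((x - a) \<bullet> b + R) * (real N / (2 * R))\<rfloor>}" for c
    show "(INF U\<in>covers A \<delta>. cover_sum ?k U) \<le> ennreal (unit_ball_vol (real ?k) * (2 * real ?k * R) ^ ?k)"
    proof (rule order_trans[OF nu_le_finite_cover[OF k]])
      have c_eq: "\<bar>(x - y) \<bullet> b\<bar> \<le> 2 * R / real N" if "x \<in> U c" "y \<in> U c" "b \<in> B" for x y c b
      proof -
        define q where "q = real N / (2 * R)"
        have q: "0 < q" using N R by (simp add: q_def)
        have nn: "0 \<le> ((z - a) \<bullet> b + R) * q" if "z \<in> A" for z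
        proof -
          have "\<bar>(z - a) \<bullet> b\<bar> \<le> norm (z - a) * norm b" by (rule Cauchy_Schwarz_ineq2)
          then have "0 \<le> (z - a) \<bullet> b + R" using A[OF that] B(3)[OF \<open>b \<in> B\<close>] by auto
          then show ?thesis using q by (intro mult_nonneg_nonneg) auto
        qed
        have "x \<in> A" "y \<in> A" using that by (auto simp: U_def)
        have "nat \<lfloor>((x - a) \<bullet> b + R) * q\<rfloor> = nat \<lfloor>((y - a) \<bullet> b + R) * q\<rfloor>" using that by (simp add: U_def q_def)
        then have "\<lfloor>((x - a) \<bullet> b + R) * q\<rfloor> = \<lfloor>((y - a) \<bullet> b + R) * q\<rfloor>"
          using nn[OF \<open>x \<in> A\<close>] nn[OF \<open>y \<in> A\<close>] by (subst (asm) eq_nat_nat_iff) auto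
        then have "\<bar>((x - a) \<bullet> b + R) * q - ((y - a) \<bullet> b + R) * q\<bar> \<le> 1" by linarith
        moreover have "((x - a) \<bullet> b + R) * q - ((y - a) \<bullet> b + R) * q = ((x - y) \<bullet> b) * q"
          by (simp add: inner_diff_left algebra_simps)
        ultimately have "\<bar>(x - y) \<bullet> b\<bar> * q \<le> 1"
          using q by (simp add: abs_mult)
        then show ?thesis using N R by (simp add: q_def field_simps)
      qed
      have le: "norm (x - y) \<le> real ?k * (2 * R / real N)" if "x \<in> U c" "y \<in> U c" for x y c
      proof -
        have "x - a \<in> L" "y - a \<in> L" using that A by (auto simp: U_def)
        then have "(x - a) - (y - a) \<in> L" by (rule subspace_diff[OF L])
        then have "x - y \<in> L" by simp
        then have "norm (x - y) = norm (\<Sum>b\<in>B. ((x - y) \<bullet> b) *\<^sub>R b)" using expand by simp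
        also have "\<dots> \<le> (\<Sum>b\<in>B. 2 * R / real N)"
          by (rule sum_norm_le) (use c_eq[OF that] B(3) in auto)
        finally show ?thesis by (simp add: B(5))
      qed
      show "finite S" unfolding S_def by (intro finite_PiE finB) auto
      show "A \<subseteq> (\<Union>c\<in>S. U c)"
      proof
        fix x assume x: "x \<in> A"
        define c where "c = (\<lambda>b\<in>B. nat \<lfloor>((x - a) \<bullet> b + R) * (real N / (2 * R))\<rfloor>)"
        have "c b \<le> N" if b: "b \<in> B" for b
        proof -
          have "\<bar>(x - a) \<bullet> b\<bar> \<le> norm (x - a) * norm b" by (rule Cauchy_Schwarz_ineq2)
          then have "(x - a) \<bullet> b + R \<le> 2 * R" using A[OF x] B(3)[OF b] by auto
          then have "((x - a) \<bullet> b + R) * (real N / (2 * R)) \<le> 2 * R * (real N / (2 * R))"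
            using R by (intro mult_right_mono) auto
          also have "\<dots> = real N" using R by simp
          finally show ?thesis using b unfolding c_def by simp linarith
        qed
        moreover have "c \<in> extensional B" by (simp add: c_def)
        ultimately have "c \<in> S" by (simp add: S_def PiE_iff less_Suc_eq_le)
        moreover have "x \<in> U c" using x by (simp add: U_def c_def)
        ultimately show "x \<in> (\<Union>c\<in>S. U c)" by blast
      qed
      show "bounded (U c)" for c
      proof (rule bounded_subset[of "cball a R"])
        show "U c \<subseteq> cball a R" using A by (auto simp: U_def dist_norm norm_minus_commute)
      qed simp
      show "diameter (U c) \<le> real ?k * (2 * R / real N)" for c
        using le[of _ c] R N by (intro diameter_le) auto
      show "0 \<le> real ?k * (2 * R / real N)" using R N by simp
      have "real (card S) * (real ?k * (2 * R / real N) / 2) ^ ?k = ((1 + real N) * (real ?k * R / real N)) ^ ?k"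
        unfolding S_def using finB by (simp add: card_PiE B(5) power_mult_distrib[symmetric] mult_ac)
      also have "\<dots> \<le> (2 * real ?k * R) ^ ?k"
      proof (rule power_mono)
        have "1 \<le> real N" by (simp add: N_def)
        then have "(1 + real N) / real N \<le> 2" by (simp add: field_simps)
        then have "(1 + real N) / real N * (real ?k * R) \<le> 2 * (real ?k * R)" using R by (intro mult_right_mono) auto
        then show "(1 + real N) * (real ?k * R / real N) \<le> 2 * real ?k * R" by (simp add: mult_ac)
      qed (use R N in auto)
      finally have "unit_ball_vol (real ?k) * (real (card S) * (real ?k * (2 * R / real N) / 2) ^ ?k) \<le>
        unit_ball_vol (real ?k) * (2 * real ?k * R) ^ ?k"
        by (intro mult_left_mono) auto
      then show "ennreal (real (card S) * (unit_ball_vol (real ?k) * (real ?k * (2 * R / real N) / 2) ^ ?k)) \<le>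
        ennreal (unit_ball_vol (real ?k) * (2 * real ?k * R) ^ ?k)"
        by (intro ennreal_leI) (simp only: mult.left_commute)
    qed (use N\<delta> in auto)
  qed
qed


text \<open>Scaling the covers proves one inequality for every positive factor and every set;
  applied to 1 / s and the scaled set it yields the other.\<close>

lemma nu_scaleR:
  fixes A :: "'a::euclidean_space set"
  assumes s: "0 < s" shows "nu k ((\<lambda>x. s *\<^sub>R x) ` A) = ennreal (s ^ k) * nu k A"
proof (cases "k = 0")
  case True
  have "inj_on (\<lambda>x. s *\<^sub>R x) A" using s by (auto simp: inj_on_def)
  then have "finite ((\<lambda>x. s *\<^sub>R x) ` A) = finite A" "card ((\<lambda>x. s *\<^sub>R x) ` A) = card A"
    by (auto simp: finite_image_iff card_image)
  then show ?thesis using True by (simp add: nu_def emeasure_count_space)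
next
  case False
  then have k: "0 < k" by simp
  have le: "nu k ((\<lambda>x. s *\<^sub>R x) ` A) \<le> ennreal (s ^ k) * nu k A" if s: "0 < s" for s and A :: "'a set"
    unfolding nu_eq_covers[OF k]
  proof (rule SUP_least)
    fix \<delta> :: real assume "\<delta> \<in> {0<..}"
    then have \<delta>: "0 < \<delta> / s" using s by simp
    have "(INF V\<in>covers ((\<lambda>x. s *\<^sub>R x) ` A) \<delta>. cover_sum k V) \<le> ennreal (s ^ k) * cover_sum k U" if U: "U \<in> covers A (\<delta> / s)" for U
    proof -
      define V where "V i = (\<lambda>x. s *\<^sub>R x) ` U i" for i
      have bU: "bounded (U i)" "diameter (U i) \<le> \<delta> / s" for i using U by (auto simp: covers_def)
      have dV: "diameter (V i) \<le> s * diameter (U i)" for i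
        unfolding V_def
        using diameter_bounded_bound[OF bU(1)[of i]] diameter_ge_0[OF bU(1)[of i]] s
        by (intro diameter_le) (auto simp: scaleR_diff_right[symmetric] dist_norm)
      have bV: "bounded (V i)" for i unfolding V_def by (rule bounded_scaling[OF bU(1)])
      have "diameter (V i) \<le> \<delta>" for i
        using dV[of i] mult_left_mono[OF bU(2)[of i], of s] s by simp
      then have "V \<in> covers ((\<lambda>x. s *\<^sub>R x) ` A) \<delta>"
      proof -
        have "(\<lambda>x. s *\<^sub>R x) ` A \<subseteq> (\<lambda>x. s *\<^sub>R x) ` (\<Union>i. U i)"
          using U by (intro image_mono) (simp add: covers_def)
        then have "(\<lambda>x. s *\<^sub>R x) ` A \<subseteq> (\<Union>i. V i)" by (simp add: V_def image_UN)
        then show ?thesis using bV \<open>\<And>i. diameter (V i) \<le> \<delta>\<close> by (simp add: covers_def)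
      qed
      then have "(INF V\<in>covers ((\<lambda>x. s *\<^sub>R x) ` A) \<delta>. cover_sum k V) \<le> cover_sum k V" by (rule INF_lower)
      also have "\<dots> \<le> (\<Sum>i. ennreal (s ^ k) * ennreal (unit_ball_vol (real k) * (diameter (U i) / 2) ^ k))"
        unfolding cover_sum_def
      proof (rule suminf_le)
        fix i
        have "unit_ball_vol (real k) * (diameter (V i) / 2) ^ k \<le> unit_ball_vol (real k) * (s * diameter (U i) / 2) ^ k"
          using dV diameter_ge_0[OF bV] by (intro mult_left_mono power_mono divide_right_mono) auto
        also have "\<dots> = s ^ k * (unit_ball_vol (real k) * (diameter (U i) / 2) ^ k)"
          by (simp add: power_mult_distrib power_divide)
        finally show "ennreal (unit_ball_vol (real k) * (diameter (V i) / 2) ^ k) \<le>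
          ennreal (s ^ k) * ennreal (unit_ball_vol (real k) * (diameter (U i) / 2) ^ k)"
          using s by (subst ennreal_mult'[symmetric]) (auto intro: ennreal_leI)
      qed auto
      also have "\<dots> = ennreal (s ^ k) * cover_sum k U" unfolding cover_sum_def by (rule ennreal_suminf_cmult)
      finally show ?thesis .
    qed
    note step = this
    let ?X = "INF V\<in>covers ((\<lambda>x. s *\<^sub>R x) ` A) \<delta>. cover_sum k V"
    \<comment> \<open>The scale factor is moved across the infimum by multiplying with its inverse
      on the other side.\<close>
    have inv: "ennreal ((1/s)^k) * (ennreal (s^k) * y) = y" "ennreal (s^k) * (ennreal ((1/s)^k) * y) = y" for y
      using s by (simp_all add: mult.assoc[symmetric] ennreal_mult''[symmetric] power_mult_distrib[symmetric])
    have "ennreal ((1/s)^k) * ?X \<le> (INF U\<in>covers A (\<delta> / s). cover_sum k U)"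
    proof (rule INF_greatest)
      fix U assume "U \<in> covers A (\<delta> / s)"
      from mult_left_mono[OF step[OF this], of "ennreal ((1/s)^k)"]
      show "ennreal ((1/s)^k) * ?X \<le> cover_sum k U" unfolding inv by simp
    qed
    from mult_left_mono[OF this, of "ennreal (s^k)"]
    have "?X \<le> ennreal (s ^ k) * (INF U\<in>covers A (\<delta> / s). cover_sum k U)" unfolding inv by simp
    also have "\<dots> \<le> ennreal (s ^ k) * (SUP \<delta>\<in>{0<..}. INF U\<in>covers A \<delta>. cover_sum k U)"
      using \<delta> by (intro mult_left_mono SUP_upper) auto
    finally show "(INF V\<in>covers ((\<lambda>x. s *\<^sub>R x) ` A) \<delta>. cover_sum k V) \<le> ennreal (s ^ k) * (SUP \<delta>\<in>{0<..}. INF U\<in>covers A \<delta>. cover_sum k U)" .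
  qed
  have "(\<lambda>x. (1/s) *\<^sub>R x) ` (\<lambda>x. s *\<^sub>R x) ` A = A" using s by (simp add: image_image)
  then have "nu k A \<le> ennreal ((1/s) ^ k) * nu k ((\<lambda>x. s *\<^sub>R x) ` A)"
    using le[of "1/s" "(\<lambda>x. s *\<^sub>R x) ` A"] s by simp
  then have "ennreal (s ^ k) * nu k A \<le> ennreal (s ^ k) * (ennreal ((1/s) ^ k) * nu k ((\<lambda>x. s *\<^sub>R x) ` A))"
    by (rule mult_left_mono) simp
  also have "\<dots> = nu k ((\<lambda>x. s *\<^sub>R x) ` A)"
    using s by (simp add: mult.assoc[symmetric] ennreal_mult''[symmetric] power_mult_distrib[symmetric])
  finally show ?thesis using le[OF s, of A] by (rule antisym[rotated])
qed

section \<open>Intersections of hyperplanes with a ball\<close>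

definition flat_ball :: "real \<Rightarrow> (real \<times> (real ^ 'n)) set \<Rightarrow> (real ^ 'n) set"
  where "flat_ball r Y = (\<Inter>y\<in>Y. hyperplane y) \<inter> cball 0 r"

lemma mem_flat_ball: "z \<in> flat_ball r Y \<longleftrightarrow> (\<forall>y\<in>Y. z \<bullet> snd y = fst y) \<and> norm z \<le> r"
  by (auto simp: flat_ball_def hyperplane_def split_beta)

lemma convex_flat_ball: "convex (flat_ball r Y)"
proof -
  have "convex (hyperplane y)" for y :: "real \<times> (real ^ 'n)"
  proof -
    have "hyperplane y = {x. snd y \<bullet> x = fst y}" by (auto simp: hyperplane_def split_beta inner_commute)
    then show ?thesis by (simp add: convex_hyperplane)
  qed
  then show ?thesis unfolding flat_ball_def by (intro convex_Int convex_INT) auto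
qed

text \<open>The pairs of a point z in the compact set \<open>cball 0 r \<inter> T\<close> and a
  family x whose hyperplanes with index in \<open>J\<close> all contain z form a closed set, and
  projection along a compact factor preserves closedness.\<close>

lemma closed_flat_ball_hits:
  fixes J :: "nat set"
  assumes T: "closed T"
  shows "closed {x :: nat \<Rightarrow> real \<times> (real ^ 'n). flat_ball r (x ` J) \<inter> T \<noteq> {}}"
proof -
  let ?K = "cball 0 r \<inter> T :: (real ^ 'n) set"
  define C where "C = {p :: (real ^ 'n) \<times> (nat \<Rightarrow> real \<times> (real ^ 'n)). fst p \<in> ?K \<and> (\<forall>i\<in>J. fst p \<bullet> snd (snd p i) = fst (snd p i))}"
  have comp: "compact ?K" using T by (intro compact_Int_closed) auto
  have cont: "continuous_on UNIV (\<lambda>p :: (real ^ 'n) \<times> (nat \<Rightarrow> real \<times> (real ^ 'n)). snd p i)" for i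
    using continuous_on_compose2[OF continuous_on_product_coordinates continuous_on_snd[OF continuous_on_id]] by auto
  have "closed C"
  proof -
    have "C = (fst -` ?K) \<inter> (\<Inter>i\<in>J. {p. fst p \<bullet> snd (snd p i) = fst (snd p i)})" by (auto simp: C_def)
    moreover have "closed (fst -` ?K :: ((real ^ 'n) \<times> (nat \<Rightarrow> real \<times> (real ^ 'n))) set)"
      by (rule closed_vimage) (use comp compact_imp_closed in \<open>auto intro: continuous_intros\<close>)
    moreover have "closed {p :: (real ^ 'n) \<times> (nat \<Rightarrow> real \<times> (real ^ 'n)). fst p \<bullet> snd (snd p i) = fst (snd p i)}" for i
      by (intro closed_Collect_eq continuous_intros cont)
    ultimately show ?thesis by (auto intro: closed_Int closed_INT)
  qed
  moreover have "closed_map (prod_topology (top_of_set ?K) euclidean) euclidean (snd :: (real ^ 'n) \<times> (nat \<Rightarrow> real \<times> (real ^ 'n)) \<Rightarrow> _)"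
    using comp by (intro Abstract_Topological_Spaces.closed_map_snd) (simp add: compact_space_subtopology)
  moreover have "closedin (prod_topology (top_of_set ?K) euclidean) C"
  proof -
    have "prod_topology (top_of_set ?K) (euclidean :: (nat \<Rightarrow> real \<times> (real ^ 'n)) topology) = top_of_set (?K \<times> UNIV)"
      by (simp add: prod_topology_subtopology(1))
    then show ?thesis using \<open>closed C\<close> by (auto simp: closedin_closed C_def intro!: exI[of _ C])
  qed
  ultimately have "closed (snd ` C)" by (auto simp: closed_map_def)
  moreover have "snd ` C = {x. flat_ball r (x ` J) \<inter> T \<noteq> {}}"
    by (force simp: C_def mem_flat_ball image_iff)
  ultimately show ?thesis by simp
qed

text \<open>Missing a closed set is an open condition, which is the upper semicontinuity required
  for positive k; for k = 0 the criterion for convex sets is used.\<close>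

lemma borel_measurable_nu_flat_ball:
  fixes J :: "nat set"
  shows "(\<lambda>x :: nat \<Rightarrow> real \<times> (real ^ 'n). nu k (flat_ball r (x ` J))) \<in> borel_measurable borel"
proof (cases "k = 0")
  case True
  then show ?thesis using borel_measurable_nu_0[OF closed_flat_ball_hits convex_flat_ball] by simp
next
  case False
  show ?thesis
  proof (rule borel_measurable_nu_usc)
    fix T :: "(real ^ 'n) set" assume "open T"
    then have "closed {x :: nat \<Rightarrow> real \<times> (real ^ 'n). flat_ball r (x ` J) \<inter> - T \<noteq> {}}"
      by (intro closed_flat_ball_hits) auto
    then have "open (- {x :: nat \<Rightarrow> real \<times> (real ^ 'n). flat_ball r (x ` J) \<inter> - T \<noteq> {}})" by (simp add: open_Compl)
    also have "- {x. flat_ball r (x ` J) \<inter> - T \<noteq> {}} = {x. flat_ball r (x ` J) \<subseteq> T}" by auto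
    finally show "open {x :: nat \<Rightarrow> real \<times> (real ^ 'n). flat_ball r (x ` J) \<subseteq> T}" .
  qed (use False in simp)
qed

lemma borel_measurable_chi_flat_ball:
  fixes J :: "nat set"
  shows "(\<lambda>x :: nat \<Rightarrow> real \<times> (real ^ 'n). chi (flat_ball r (x ` J))) \<in> borel_measurable borel"
proof -
  have [measurable]: "Measurable.pred borel (\<lambda>x :: nat \<Rightarrow> real \<times> (real ^ 'n). flat_ball r (x ` J) \<noteq> {})"
    using closed_flat_ball_hits[OF closed_UNIV, THEN borel_closed] by (simp add: pred_def)
  have "Measurable.pred borel (\<lambda>x :: nat \<Rightarrow> real \<times> (real ^ 'n). \<not> flat_ball r (x ` J) \<noteq> {})" by measurable
  then have [measurable]: "Measurable.pred borel (\<lambda>x :: nat \<Rightarrow> real \<times> (real ^ 'n). flat_ball r (x ` J) = {})" by simp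
  show ?thesis unfolding chi_def by measurable
qed

text \<open>With independent normals the flat lies in a translate of the orthogonal complement of
  their span, which has dimension k. Seen from any of its points, the part inside the ball has
  radius at most 2r.\<close>

lemma nu_flat_ball_bound:
  fixes Y :: "(real \<times> (real ^ 'n)) set"
  assumes ind: "independent (snd ` Y)" and card: "card (snd ` Y) = CARD('n) - k" and k: "k \<le> CARD('n)" and r: "0 < r"
  shows "nu k (flat_ball r Y) \<le> ennreal (unit_ball_vol (real k) * (2 * real k * (2 * r)) ^ k)"
proof (cases "flat_ball r Y = {}")
  case True
  then show ?thesis by (simp add: nu_empty)
next
  case False
  then obtain a where a: "a \<in> flat_ball r Y" by blast
  define L where "L = {x. \<forall>v\<in>span (snd ` Y). orthogonal v x}"
  have L: "subspace L" unfolding L_def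
    by (auto simp: subspace_def orthogonal_clauses)
  have "dim {y\<in>(UNIV :: (real ^ 'n) set). \<forall>x\<in>span (snd ` Y). orthogonal x y} + dim (span (snd ` Y)) = dim (UNIV :: (real ^ 'n) set)"
    by (rule dim_subspace_orthogonal_to_vectors) auto
  then have dim: "dim L = k"
    using k card by (simp add: L_def dim_eq_card_independent[OF ind])
  have "nu (dim L) (flat_ball r Y) \<le> ennreal (unit_ball_vol (real (dim L)) * (2 * real (dim L) * (2 * r)) ^ dim L)"
  proof (rule nu_subspace_bound[OF L])
    fix x assume x: "x \<in> flat_ball r Y"
    have "orthogonal (x - a) v" if v: "v \<in> snd ` Y" for v
    proof -
      obtain y where "y \<in> Y" "v = snd y" using v by blast
      then have "x \<bullet> v = fst y" "a \<bullet> v = fst y" using x a by (auto simp: mem_flat_ball)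
      then show ?thesis by (simp add: orthogonal_def inner_diff_left)
    qed
    then have "orthogonal (x - a) v" if "v \<in> span (snd ` Y)" for v using that by (rule orthogonal_to_span[rotated])
    then have "x - a \<in> L" unfolding L_def by (simp add: orthogonal_commute)
    moreover have "norm (x - a) \<le> 2 * r"
      using x a norm_triangle_ineq4[of x a] by (auto simp: mem_flat_ball)
    ultimately show "x - a \<in> L \<and> norm (x - a) \<le> 2 * r" ..
  qed (use r in simp)
  then show ?thesis unfolding dim .
qed

section \<open>The window of hyperplanes hitting a ball\<close>

text \<open>Linear dependence has to be a measurable event. The span is closed, so membership means
  approximation by combinations with rational coefficients, a condition in countable form.\<close>

lemma in_span_family_iff_rational:
  fixes v :: "'i \<Rightarrow> 'a::euclidean_space"
  assumes I: "finite I"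
  shows "w \<in> span (v ` I) \<longleftrightarrow> (\<forall>n::nat. \<exists>c\<in>I \<rightarrow>\<^sub>E \<rat>. norm (w - (\<Sum>i\<in>I. c i *\<^sub>R v i)) < 1 / real (Suc n))"
proof
  assume "w \<in> span (v ` I)"
  moreover have "span (v ` I) \<subseteq> {x. \<exists>r. x = (\<Sum>i\<in>I. r i *\<^sub>R v i)}"
  proof (rule span_minimal)
    show "v ` I \<subseteq> {x. \<exists>r. x = (\<Sum>i\<in>I. r i *\<^sub>R v i)}"
    proof (rule image_subsetI)
      fix i assume "i \<in> I"
      then have "v i = (\<Sum>j\<in>I. (if j = i then 1 else 0) *\<^sub>R v j)"
        using I by (simp add: if_distrib[of "\<lambda>c. c *\<^sub>R _"] cong: if_cong)
      then show "v i \<in> {x. \<exists>r. x = (\<Sum>i\<in>I. r i *\<^sub>R v i)}"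
        by (intro CollectI exI[of _ "\<lambda>j. if j = i then 1 else 0"])
    qed
    show "subspace {x. \<exists>r. x = (\<Sum>i\<in>I. r i *\<^sub>R v i)}"
      unfolding subspace_def
    proof (intro conjI ballI allI; (elim CollectE exE)?)
      show "0 \<in> {x. \<exists>r. x = (\<Sum>i\<in>I. r i *\<^sub>R v i)}" by (intro CollectI exI[of _ "\<lambda>_. 0"]) simp
      fix x y r s assume "x = (\<Sum>i\<in>I. r i *\<^sub>R v i)" "y = (\<Sum>i\<in>I. s i *\<^sub>R v i)"
      then show "x + y \<in> {x. \<exists>r. x = (\<Sum>i\<in>I. r i *\<^sub>R v i)}"
        by (intro CollectI exI[of _ "\<lambda>i. r i + s i"]) (simp add: scaleR_left_distrib sum.distrib)
    next
      fix x r and c :: real assume "x = (\<Sum>i\<in>I. r i *\<^sub>R v i)"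
      then show "c *\<^sub>R x \<in> {x. \<exists>r. x = (\<Sum>i\<in>I. r i *\<^sub>R v i)}"
        by (intro CollectI exI[of _ "\<lambda>i. c * r i"]) (simp add: scaleR_right.sum)
    qed
  qed
  ultimately obtain r where r: "w = (\<Sum>i\<in>I. r i *\<^sub>R v i)" by blast
  show "\<forall>n::nat. \<exists>c\<in>I \<rightarrow>\<^sub>E \<rat>. norm (w - (\<Sum>i\<in>I. c i *\<^sub>R v i)) < 1 / real (Suc n)"
  proof
    fix n :: nat
    define S where "S = (\<Sum>i\<in>I. norm (v i))"
    have S: "0 \<le> S" unfolding S_def by (intro sum_nonneg) auto
    \<comment> \<open>Coefficients within \<delta> of the exact ones change the vector by at most
      \<open>\<delta> * S\<close>; the summand 1 keeps the bound strict and the quotient defined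
      when all vectors vanish.\<close>
    define \<delta> where "\<delta> = 1 / (real (Suc n) * (1 + S))"
    have \<delta>: "0 < \<delta>" using S by (simp add: \<delta>_def)
    have "\<exists>q\<in>\<rat>. r i < q \<and> q < r i + \<delta>" for i using \<delta> by (intro Rats_dense_in_real) auto
    then obtain q where q: "\<And>i. q i \<in> \<rat>" "\<And>i. r i < q i" "\<And>i. q i < r i + \<delta>" by metis
    define c where "c = restrict q I"
    have "w - (\<Sum>i\<in>I. c i *\<^sub>R v i) = (\<Sum>i\<in>I. (r i - q i) *\<^sub>R v i)"
      by (simp add: r c_def scaleR_left_diff_distrib sum_subtractf)
    also have "norm \<dots> \<le> (\<Sum>i\<in>I. \<delta> * norm (v i))"
    proof (rule sum_norm_le)
      show "norm ((r i - q i) *\<^sub>R v i) \<le> \<delta> * norm (v i)" for i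
        unfolding norm_scaleR using q(2,3)[of i] by (intro mult_right_mono) auto
    qed
    also have "\<dots> = \<delta> * S" by (simp add: S_def sum_distrib_left)
    also have "\<dots> < \<delta> * (1 + S)" using \<delta> by simp
    also have "\<dots> = 1 / real (Suc n)" using S by (simp add: \<delta>_def del: of_nat_Suc)
    finally show "\<exists>c\<in>I \<rightarrow>\<^sub>E \<rat>. norm (w - (\<Sum>i\<in>I. c i *\<^sub>R v i)) < 1 / real (Suc n)"
      using q by (intro bexI[of _ c]) (auto simp: c_def)
  qed
next
  assume *: "\<forall>n::nat. \<exists>c\<in>I \<rightarrow>\<^sub>E \<rat>. norm (w - (\<Sum>i\<in>I. c i *\<^sub>R v i)) < 1 / real (Suc n)"
  have "w \<in> closure (span (v ` I))"
    unfolding closure_approachable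
  proof (intro allI impI)
    fix e :: real assume "0 < e"
    then obtain n where n: "1 / real (Suc n) < e" using reals_Archimedean[of e] by (auto simp: inverse_eq_divide)
    obtain c where "norm (w - (\<Sum>i\<in>I. c i *\<^sub>R v i)) < 1 / real (Suc n)" using * by blast
    moreover have "(\<Sum>i\<in>I. c i *\<^sub>R v i) \<in> span (v ` I)"
      by (intro span_sum span_scale span_base) auto
    ultimately show "\<exists>y\<in>span (v ` I). dist y w < e"
      using n by (intro bexI[of _ "\<Sum>i\<in>I. c i *\<^sub>R v i"]) (auto simp: dist_norm norm_minus_commute)
  qed
  then show "w \<in> span (v ` I)" by (simp add: closure_closed closed_subspace)
qed

text \<open>Stating the condition for the family instead of the set of vectors also rules out
  repetitions, so the number of normals is the full \<open>card J\<close>.\<close>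

lemma independent_family_iff:
  assumes "\<And>l. l \<in> J \<Longrightarrow> v l \<notin> span (v ` (J - {l}))"
  shows "inj_on v J" "independent (v ` J)"
proof -
  show "inj_on v J"
  proof (rule inj_onI, rule ccontr)
    fix i j assume ij: "i \<in> J" "j \<in> J" "v i = v j" "i \<noteq> j"
    then have "v i \<in> v ` (J - {i})" by auto
    then have "v i \<in> span (v ` (J - {i}))" by (rule span_base)
    with assms[OF ij(1)] show False ..
  qed
  show "independent (v ` J)"
    unfolding dependent_def
  proof (clarify)
    fix l assume l: "l \<in> J" "v l \<in> span (v ` J - {v l})"
    have "v ` J - {v l} \<subseteq> v ` (J - {l})" by auto
    from span_mono[OF this] l assms[OF l(1)] show False by auto
  qed
qed

text \<open>The radius is a parameter, because the uniform law depends on it; the scaling argument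
  interprets two radii side by side.\<close>

locale window_law = prob_space \<Theta> for \<Theta> :: "(real ^ 'n::{finite,linorder}) measure" +
  fixes r :: real
  assumes space_Theta: "space \<Theta> = half_sphere"
    and sets_Theta: "sets \<Theta> = sets (restrict_space borel half_sphere)"
    and r: "0 < r"
begin

definition U :: "real measure" where "U = uniform_measure lborel {-r..r}"

definition Q where "Q = U \<Otimes>\<^sub>M \<Theta>"

lemma sets_U [simp, measurable_cong]: "sets U = sets borel" by (simp add: U_def)

lemma space_U [simp]: "space U = UNIV" by (simp add: U_def)

lemma prob_space_U: "prob_space U"
  unfolding U_def by (rule prob_space_uniform_measure) (use r in auto)

sublocale U: prob_space U by (rule prob_space_U)

sublocale U\<Theta>: pair_prob_space U \<Theta> ..

sublocale Q: prob_space Q unfolding Q_def by (rule U\<Theta>.prob_space_axioms)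

text \<open>\<open>\<Theta>\<close> lives on the half-sphere with the trace sigma-algebra; through
  the inclusion into the whole space, Borel functions of the normal become measurable.\<close>

lemma id_Theta [measurable]: "(\<lambda>v. v) \<in> borel_measurable \<Theta>"
proof -
  have "(\<lambda>v. v) \<in> measurable (restrict_space borel half_sphere) borel" by (rule measurable_restrict_space1) simp
  then show ?thesis using measurable_cong_sets[OF sets_Theta refl] by blast
qed

lemma fst_Q [measurable]: "fst \<in> borel_measurable Q"
  unfolding Q_def by (rule measurable_compose[OF measurable_fst]) simp

lemma snd_Q [measurable]: "snd \<in> borel_measurable Q"
  unfolding Q_def by (rule measurable_compose[OF measurable_snd id_Theta])

lemma id_Q [measurable]: "(\<lambda>x. x) \<in> borel_measurable Q"
proof -
  have "(\<lambda>x. (fst x, snd x)) \<in> borel_measurable Q" by measurable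
  then show ?thesis by simp
qed

lemma space_Q: "space Q = UNIV \<times> half_sphere" by (simp add: Q_def space_pair_measure space_Theta)

text \<open>Transfers measurability from the Borel sets of the function space to the product
  sigma-algebra over \<open>J\<close>; coordinates outside \<open>J\<close> have the constant value
  \<open>undefined\<close>.\<close>

lemma id_PiM_borel [measurable]: "(\<lambda>x. x) \<in> borel_measurable (PiM (J :: nat set) (\<lambda>_. Q))"
proof (rule measurable_coordinatewise_then_product)
  fix i :: nat
  show "(\<lambda>x. x i) \<in> borel_measurable (PiM J (\<lambda>_. Q))"
  proof (cases "i \<in> J")
    case True
    show ?thesis by (rule measurable_compose[OF measurable_component_singleton[OF True, where M="\<lambda>_. Q"] id_Q])
  next
    case False
    have "(\<lambda>x. x i) \<in> borel_measurable (PiM J (\<lambda>_. Q)) \<longleftrightarrow> (\<lambda>x. undefined :: real \<times> (real, 'n) vec) \<in> borel_measurable (PiM J (\<lambda>_. Q))"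
      using False by (intro measurable_cong) (auto simp: space_PiM PiE_iff extensional_def)
    then show ?thesis by simp
  qed
qed

lemma flat_ball_hits_measurable [measurable]:
  "Measurable.pred (PiM (J :: nat set) (\<lambda>_. Q)) (\<lambda>x. flat_ball s (x ` I) \<noteq> {})"
proof -
  have "Measurable.pred borel (\<lambda>x :: nat \<Rightarrow> real \<times> (real, 'n) vec. flat_ball s (x ` I) \<noteq> {})"
    using closed_flat_ball_hits[OF closed_UNIV, THEN borel_closed] by (simp add: pred_def)
  from measurable_compose[OF id_PiM_borel this] show ?thesis .
qed

lemma span_measurable:
  assumes J: "finite J" "l \<in> J"
  shows "Measurable.pred (PiM (J :: nat set) (\<lambda>_. Q)) (\<lambda>x. snd (x l) \<in> span ((\<lambda>i. snd (x i)) ` (J - {l})))"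
proof -
  let ?C = "(J - {l}) \<rightarrow>\<^sub>E (\<rat> :: real set)"
  have C: "countable ?C" using J by (intro countable_PiE countable_rat) auto
  let ?B = "\<lambda>c n. {x\<in>space (PiM J (\<lambda>_. Q)). norm (snd (x l) - (\<Sum>i\<in>J - {l}. c i *\<^sub>R snd (x i))) < 1 / real (Suc n)}"
  have [measurable]: "(\<lambda>x. snd (x i)) \<in> borel_measurable (PiM J (\<lambda>_. Q))" if "i \<in> J" for i
    by (rule measurable_compose[OF measurable_component_singleton[OF that, where M="\<lambda>_. Q"] snd_Q])
  have B: "?B c n \<in> sets (PiM J (\<lambda>_. Q))" for c n using J by measurable
  have "{x\<in>space (PiM J (\<lambda>_. Q)). snd (x l) \<in> span ((\<lambda>i. snd (x i)) ` (J - {l}))} = (\<Inter>n. \<Union>c\<in>?C. ?B c n)"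
    using J by (subst in_span_family_iff_rational) auto
  also have "\<dots> \<in> sets (PiM J (\<lambda>_. Q))"
    using C by (intro sets.countable_INT' sets.countable_UN' B image_subsetI) auto
  finally show ?thesis by (simp add: pred_def)
qed

lemma AE_U_neq: "AE p in U. p \<noteq> p0"
  unfolding U_def by (rule AE_uniform_measureI) (use AE_lborel_singleton[of p0] in auto)

text \<open>Fix all data except the signed distance p of hyperplane l. If its normal lies in the
  span of the others, the common points for two values of p differ by a vector orthogonal to that
  span, which forces the values to agree. A single value has probability 0 under the uniform
  law.\<close>

lemma dependent_null:
  assumes J: "finite (J :: nat set)" "l \<in> J"
  shows "AE x in PiM J (\<lambda>_. Q). \<not> (flat_ball s (x ` J) \<noteq> {} \<and> snd (x l) \<in> span ((\<lambda>i. snd (x i)) ` (J - {l})))"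
proof -
  let ?P = "\<lambda>x. flat_ball s (x ` J) \<noteq> {} \<and> snd (x l) \<in> span ((\<lambda>i. snd (x i)) ` (J - {l}))"
  let ?J = "J - {l}"
  interpret QP: product_sigma_finite "\<lambda>_::nat. Q" ..
  have ins: "insert l ?J = J" using J by auto
  have P [measurable]: "Measurable.pred (PiM J (\<lambda>_. Q)) ?P" using span_measurable[OF J] by measurable
  have ind: "(\<lambda>x. indicator {x. ?P x} x :: ennreal) \<in> borel_measurable (PiM J (\<lambda>_. Q))"
  proof -
    have "(\<lambda>x. if ?P x then 1 else 0 :: ennreal) \<in> borel_measurable (PiM J (\<lambda>_. Q))" by measurable
    then show ?thesis by (simp add: indicator_def)
  qed
  have upd: "(\<lambda>y. x(l := y)) \<in> measurable Q (PiM J (\<lambda>_. Q))" if "x \<in> space (PiM ?J (\<lambda>_. Q))" for x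
    using measurable_component_update[OF that, of l] ins by simp
  have one: "p = p'" if p: "?P (x(l := (p, v)))" and p': "?P (x(l := (p', v)))" for x p p' v
  proof -
    have nl: "(x(l := y)) ` ?J = x ` ?J" "(\<lambda>i. snd ((x(l := y)) i)) ` ?J = (\<lambda>i. snd (x i)) ` ?J" for y by auto
    from p obtain z where z: "z \<in> flat_ball s ((x(l := (p, v))) ` J)" by blast
    from p' obtain z' where z': "z' \<in> flat_ball s ((x(l := (p', v))) ` J)" by blast
    have zl: "z \<bullet> v = p" "z' \<bullet> v = p'"
      using z z' J(2) unfolding mem_flat_ball by (metis fst_conv fun_upd_same imageI snd_conv)+
    have zi: "z \<bullet> snd (x i) = fst (x i)" "z' \<bullet> snd (x i) = fst (x i)" if "i \<in> ?J" for i
      using z z' that unfolding mem_flat_ball by (metis DiffE fun_upd_other imageI insertI1)+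
    have v: "v \<in> span ((\<lambda>i. snd (x i)) ` ?J)" using p unfolding nl by simp
    have "orthogonal (z - z') w" if w: "w \<in> (\<lambda>i. snd (x i)) ` ?J" for w
    proof -
      from w obtain i where "i \<in> ?J" "w = snd (x i)" by blast
      then show ?thesis using zi[of i] by (simp add: orthogonal_def inner_diff_left)
    qed
    then have "orthogonal (z - z') v" using v by (rule orthogonal_to_span[rotated])
    then show ?thesis using zl by (simp add: orthogonal_def inner_diff_left)
  qed
  have "emeasure (PiM J (\<lambda>_. Q)) {x\<in>space (PiM J (\<lambda>_. Q)). ?P x} = (\<integral>\<^sup>+x. indicator {x. ?P x} x \<partial>PiM (insert l ?J) (\<lambda>_. Q))"
  proof -
    have "{x\<in>space (PiM J (\<lambda>_. Q)). ?P x} \<in> sets (PiM J (\<lambda>_. Q))" by measurable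
    from nn_integral_indicator[OF this, symmetric] show ?thesis
      unfolding ins by (simp only:) (auto intro!: nn_integral_cong simp: indicator_def)
  qed
  also have "\<dots> = (\<integral>\<^sup>+x. (\<integral>\<^sup>+y. indicator {x. ?P x} (x(l := y)) \<partial>Q) \<partial>PiM ?J (\<lambda>_. Q))"
    by (rule QP.product_nn_integral_insert, use J in simp, simp, unfold ins, rule ind)
  also have "\<dots> = (\<integral>\<^sup>+x. 0 \<partial>PiM ?J (\<lambda>_. Q))"
  proof (rule nn_integral_cong)
    fix x assume x: "x \<in> space (PiM ?J (\<lambda>_. Q))"
    have m: "(\<lambda>y. indicator {x. ?P x} (x(l := y)) :: ennreal) \<in> borel_measurable (U \<Otimes>\<^sub>M \<Theta>)"
      unfolding Q_def[symmetric] by (rule measurable_compose[OF upd[OF x] ind])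
    have "(\<integral>\<^sup>+y. indicator {x. ?P x} (x(l := y)) \<partial>Q) = (\<integral>\<^sup>+v. (\<integral>\<^sup>+p. indicator {x. ?P x} (x(l := (p, v))) \<partial>U) \<partial>\<Theta>)"
      unfolding Q_def by (rule U\<Theta>.nn_integral_snd[OF m, symmetric])
    also have "\<dots> = (\<integral>\<^sup>+v. 0 \<partial>\<Theta>)"
    proof (rule nn_integral_cong)
      fix v
      have "AE p in U. \<not> ?P (x(l := (p, v)))"
      proof (cases "\<exists>p0. ?P (x(l := (p0, v)))")
        case True
        then obtain p0 where p0: "?P (x(l := (p0, v)))" ..
        show ?thesis using AE_U_neq[of p0] by eventually_elim (use one p0 in blast)
      qed auto
      then have "(\<integral>\<^sup>+p. indicator {x. ?P x} (x(l := (p, v))) \<partial>U) = (\<integral>\<^sup>+p. 0 \<partial>U)"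
        by (intro nn_integral_cong_AE) (auto simp: indicator_def)
      then show "(\<integral>\<^sup>+p. indicator {x. ?P x} (x(l := (p, v))) \<partial>U) = 0" by simp
    qed
    finally show "(\<integral>\<^sup>+y. indicator {x. ?P x} (x(l := y)) \<partial>Q) = 0" by simp
  qed
  finally have "emeasure (PiM J (\<lambda>_. Q)) {x\<in>space (PiM J (\<lambda>_. Q)). ?P x} = 0" by simp
  then show ?thesis by (intro AE_I[of _ _ "{x\<in>space (PiM J (\<lambda>_. Q)). ?P x}"]) auto
qed

text \<open>An empty intersection has measure 0, and a nonempty one has almost surely independent
  normals.\<close>

lemma AE_nu_flat_ball_bound:
  assumes J: "finite (J :: nat set)" "card J = CARD('n) - k" and k: "k \<le> CARD('n)"
  shows "AE x in PiM J (\<lambda>_. Q). nu k (flat_ball r (x ` J)) \<le> ennreal (unit_ball_vol (real k) * (2 * real k * (2 * r)) ^ k)"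
proof -
  have "AE x in PiM J (\<lambda>_. Q). \<forall>l\<in>J. \<not> (flat_ball r (x ` J) \<noteq> {} \<and> snd (x l) \<in> span ((\<lambda>i. snd (x i)) ` (J - {l})))"
    using J dependent_null by (intro AE_finite_allI) auto
  then show ?thesis
  proof eventually_elim
    case (elim x)
    show ?case
    proof (cases "flat_ball r (x ` J) = {}")
      case False
      then have "snd (x l) \<notin> span ((\<lambda>i. snd (x i)) ` (J - {l}))" if "l \<in> J" for l using elim that by blast
      from independent_family_iff[where v="\<lambda>i. snd (x i)", OF this]
      have "inj_on (\<lambda>i. snd (x i)) J" "independent (snd ` x ` J)" by (auto simp: image_image)
      moreover have "card (snd ` x ` J) = card J" using card_image[OF \<open>inj_on _ J\<close>] by (simp add: image_image)
      ultimately show ?thesis using J k r by (intro nu_flat_ball_bound) auto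
    qed (simp add: nu_empty)
  qed
qed

end

section \<open>Scaling in the radius\<close>

lemma distr_uniform_scale:
  fixes c r :: real
  assumes c: "0 < c" and r: "0 < r"
  shows "distr (uniform_measure lborel {-r..r}) borel (\<lambda>x. c * x) = uniform_measure lborel {-(c * r)..c * r}"
proof (rule measure_eqI)
  fix A :: "real set" assume "A \<in> sets (distr (uniform_measure lborel {-r..r}) borel (\<lambda>x. c * x))"
  then have A [measurable]: "A \<in> sets borel" by simp
  have pre [measurable]: "(\<lambda>x. c * x) -` A \<in> sets borel"
    using measurable_sets[of "\<lambda>x. c * x" borel borel A] by simp
  have "emeasure lborel ({-(c * r)..c * r} \<inter> A) = (\<integral>\<^sup>+x. indicator ({-(c * r)..c * r} \<inter> A) x \<partial>lborel)"
    by (subst nn_integral_indicator) auto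
  also have "\<dots> = ennreal c * (\<integral>\<^sup>+x. indicator ({-(c * r)..c * r} \<inter> A) (0 + c * x) \<partial>lborel)"
    using c by (subst nn_integral_real_affine[where c=c and t=0]) auto
  also have "(\<integral>\<^sup>+x. indicator ({-(c * r)..c * r} \<inter> A) (0 + c * x) \<partial>lborel) =
    (\<integral>\<^sup>+x. indicator ({-r..r} \<inter> (\<lambda>x. c * x) -` A) x \<partial>lborel)"
  proof (rule nn_integral_cong)
    fix x
    have "- (c * r) \<le> c * x \<longleftrightarrow> - r \<le> x" "c * x \<le> c * r \<longleftrightarrow> x \<le> r"
      using c mult_le_cancel_left_pos[of c "- r" x] by auto
    then show "indicator ({-(c * r)..c * r} \<inter> A) (0 + c * x) = (indicator ({-r..r} \<inter> (\<lambda>x. c * x) -` A) x :: ennreal)"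
      by (auto simp: indicator_def)
  qed
  also have "\<dots> = emeasure lborel ({-r..r} \<inter> (\<lambda>x. c * x) -` A)" by (subst nn_integral_indicator) auto
  finally have e: "emeasure lborel ({-(c * r)..c * r} \<inter> A) = ennreal c * emeasure lborel ({-r..r} \<inter> (\<lambda>x. c * x) -` A)" .
  have cr: "emeasure lborel {-(c * r)..c * r} = ennreal (2 * (c * r))" "emeasure lborel {-r..r} = ennreal (2 * r)"
    using c r by (auto simp: mult_nonneg_nonneg)
  have "ennreal c * y / ennreal (2 * (c * r)) = y / ennreal (2 * r)" for y
  proof -
    have "ennreal (2 * (c * r)) = ennreal c * ennreal (2 * r)" using c r by (simp add: ennreal_mult'[symmetric])
    then show ?thesis using c divide_mult_eq[of "ennreal c" y "ennreal (2 * r)"] by (simp add: mult.commute)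
  qed
  then show "emeasure (distr (uniform_measure lborel {-r..r}) borel (\<lambda>x. c * x)) A = emeasure (uniform_measure lborel {-(c * r)..c * r}) A"
    using c r by (subst emeasure_distr) (auto simp: e cr)
qed simp

lemma flat_ball_scale:
  fixes Y :: "(real \<times> (real ^ 'n)) set"
  assumes c: "0 < c"
  shows "flat_ball (c * r) ((\<lambda>(p, v). (c * p, v)) ` Y) = (\<lambda>x. c *\<^sub>R x) ` flat_ball r Y"
proof (rule set_eqI)
  fix z :: "real ^ 'n"
  have "z \<in> (\<lambda>x. c *\<^sub>R x) ` flat_ball r Y \<longleftrightarrow> (1 / c) *\<^sub>R z \<in> flat_ball r Y"
  proof
    assume "(1 / c) *\<^sub>R z \<in> flat_ball r Y"
    then have "c *\<^sub>R ((1 / c) *\<^sub>R z) \<in> (\<lambda>x. c *\<^sub>R x) ` flat_ball r Y" by (rule imageI)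
    then show "z \<in> (\<lambda>x. c *\<^sub>R x) ` flat_ball r Y" using c by simp
  qed (use c in auto)
  also have "\<dots> \<longleftrightarrow> z \<in> flat_ball (c * r) ((\<lambda>(p, v). (c * p, v)) ` Y)"
    using c by (auto simp: mem_flat_ball field_simps split_beta)
  finally show "z \<in> flat_ball (c * r) ((\<lambda>(p, v). (c * p, v)) ` Y) \<longleftrightarrow> z \<in> (\<lambda>x. c *\<^sub>R x) ` flat_ball r Y" ..
qed

lemma iid_law_scale:
  fixes \<Theta> :: "(real ^ 'n::{finite,linorder}) measure"
  assumes \<Theta>: "spherical_distribution \<Theta>" and r: "0 < r" and c: "0 < c"
  shows "distr (iid_law n r \<Theta>) (iid_law n (c * r) \<Theta>) (compose {1..n} (\<lambda>(p, v). (c * p, v))) = iid_law n (c * r) \<Theta>"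
proof -
  interpret A: window_law \<Theta> r
    using \<Theta> r by (simp add: window_law_def window_law_axioms_def spherical_distribution_def)
  interpret B: window_law \<Theta> "c * r"
    using \<Theta> r c by (simp add: window_law_def window_law_axioms_def spherical_distribution_def)
  have m: "(\<lambda>(p, v). (c * p, v)) \<in> measurable A.Q B.Q"
    unfolding A.Q_def B.Q_def by (auto simp: split_beta intro!: measurable_Pair measurable_compose[OF measurable_fst])
  have "distr A.Q B.Q (\<lambda>(p, v). (c * p, v)) = distr A.U borel (\<lambda>p. c * p) \<Otimes>\<^sub>M distr \<Theta> \<Theta> (\<lambda>v. v)"
    unfolding A.Q_def
  proof (subst pair_measure_distr)
    show "sigma_finite_measure (distr \<Theta> \<Theta> (\<lambda>v. v))"
      by (simp add: distr_id2) unfold_locales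
    show "distr (A.U \<Otimes>\<^sub>M \<Theta>) B.Q (\<lambda>(p, v). (c * p, v)) = distr (A.U \<Otimes>\<^sub>M \<Theta>) (borel \<Otimes>\<^sub>M \<Theta>) (\<lambda>(x, y). (c * x, y))"
      by (rule distr_cong) (auto simp: B.Q_def intro!: sets_pair_measure_cong)
  qed auto
  also have "\<dots> = B.Q"
    unfolding A.U_def B.Q_def B.U_def distr_uniform_scale[OF c r] by (simp add: distr_id2)
  finally have "distr A.Q B.Q (\<lambda>(p, v). (c * p, v)) = B.Q" .
  moreover have "distr (PiM {1..n} (\<lambda>_. A.Q)) (PiM {1..n} (\<lambda>_. B.Q)) (compose {1..n} (\<lambda>(p, v). (c * p, v)))
    = PiM {1..n} (\<lambda>_. distr A.Q B.Q (\<lambda>(p, v). (c * p, v)))"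
    using m by (intro distr_PiM_finite_prob_space' A.Q.prob_space_axioms B.Q.prob_space_axioms) auto
  ultimately show ?thesis
    by (simp add: iid_law_def A.Q_def B.Q_def A.U_def B.U_def)
qed

context window_law
begin

lemma iid_law_eq: "iid_law n r \<Theta> = PiM {1..n} (\<lambda>_. Q)"
  by (simp add: iid_law_def Q_def U_def)

lemma nu_flat_ball_PiM [measurable]: "(\<lambda>x. nu k (flat_ball s (x ` I))) \<in> borel_measurable (PiM (J :: nat set) (\<lambda>_. Q))"
  by (rule measurable_compose[OF id_PiM_borel borel_measurable_nu_flat_ball])

lemma chi_flat_ball_PiM [measurable]: "(\<lambda>x. chi (flat_ball s (x ` I))) \<in> borel_measurable (PiM (J :: nat set) (\<lambda>_. Q))"
  by (rule measurable_compose[OF id_PiM_borel borel_measurable_chi_flat_ball])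

end

lemma INT_hyperplane: "(\<Inter>i\<in>I. hyperplane (x i)) \<inter> cball 0 r = flat_ball r (x ` I)"
  by (auto simp: flat_ball_def)

lemma chi_image: "chi (f ` A) = chi A" by (simp add: chi_def)

text \<open>The error bound for radius r involves the variance computed at r; this brings all of
  them to the common value at \<rho>. Dilation by c maps the flats for r to those for c r, and the
  two factors c^k cancel against the normalization by the power 2k of the radius.\<close>

lemma sigma_scale:
  fixes \<Theta> :: "(real ^ 'n::{finite,linorder}) measure"
  assumes \<Theta>: "spherical_distribution \<Theta>" and r: "0 < r" and c: "0 < c" and k: "k < CARD('n)"
  shows "sigma_chi k (c * r) \<Theta> = sigma_chi k r \<Theta>" "sigma_nu k (c * r) \<Theta> = sigma_nu k r \<Theta>"
proof -
  interpret B: window_law \<Theta> "c * r"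
    using \<Theta> r c by (simp add: window_law_def window_law_axioms_def spherical_distribution_def)
  interpret A: window_law \<Theta> r
    using \<Theta> r by (simp add: window_law_def window_law_axioms_def spherical_distribution_def)
  let ?m = "CARD('n) - k" and ?n = "2 * CARD('n) - 2 * k - 1"
  let ?s = "\<lambda>(p, v). (c * p, v) :: real \<times> (real, 'n) vec"
  have m: "?s \<in> measurable A.Q B.Q"
    unfolding A.Q_def B.Q_def by (auto simp: split_beta intro!: measurable_Pair measurable_compose[OF measurable_fst])
  have comp: "compose {1..?n} ?s \<in> measurable (iid_law ?n r \<Theta>) (iid_law ?n (c * r) \<Theta>)"
    unfolding A.iid_law_eq B.iid_law_eq compose_def
  proof (rule measurable_restrict)
    fix i assume i: "i \<in> {1..?n}"
    show "(\<lambda>x. ?s (x i)) \<in> measurable (PiM {1..?n} (\<lambda>_. A.Q)) B.Q"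
      by (rule measurable_compose[OF measurable_component_singleton[OF i, where M="\<lambda>_. A.Q"] m])
  qed
  have sub: "{1..?m} \<subseteq> {1..?n}" "{?m..?n} \<subseteq> {1..?n}" using k by auto
  have im: "compose {1..?n} ?s x ` I = ?s ` x ` I" if "I \<subseteq> {1..?n}" for x I
    unfolding compose_def image_image by (rule image_cong) (use that in auto)
  have fl: "flat_ball (c * r) (compose {1..?n} ?s x ` I) = (\<lambda>x. c *\<^sub>R x) ` flat_ball r (x ` I)" if "I \<subseteq> {1..?n}" for x I
    unfolding im[OF that] by (rule flat_ball_scale[OF c])
  have gen: "(\<integral>\<^sup>+x. h x \<partial>iid_law ?n (c * r) \<Theta>) = (\<integral>\<^sup>+x. h (compose {1..?n} ?s x) \<partial>iid_law ?n r \<Theta>)"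
    if "h \<in> borel_measurable (iid_law ?n (c * r) \<Theta>)" for h :: "_ \<Rightarrow> ennreal"
  proof -
    have "h \<in> borel_measurable (distr (iid_law ?n r \<Theta>) (iid_law ?n (c * r) \<Theta>) (compose {1..?n} ?s))"
      using that by simp
    from nn_integral_distr[OF comp this] show ?thesis unfolding iid_law_scale[OF \<Theta> r c] .
  qed
  have "(\<integral>\<^sup>+x. chi (flat_ball (c * r) (x ` {1..?m})) * chi (flat_ball (c * r) (x ` {?m..?n})) \<partial>iid_law ?n (c * r) \<Theta>) =
    (\<integral>\<^sup>+x. chi (flat_ball r (x ` {1..?m})) * chi (flat_ball r (x ` {?m..?n})) \<partial>iid_law ?n r \<Theta>)"
  proof (subst gen)
    show "(\<lambda>x. chi (flat_ball (c * r) (x ` {1..?m})) * chi (flat_ball (c * r) (x ` {?m..?n}))) \<in> borel_measurable (iid_law ?n (c * r) \<Theta>)"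
      unfolding B.iid_law_eq by measurable
  qed (simp only: fl[OF sub(1)] fl[OF sub(2)] chi_image)
  then show "sigma_chi k (c * r) \<Theta> = sigma_chi k r \<Theta>"
    by (simp add: sigma_chi_def INT_hyperplane)
  have "(\<integral>\<^sup>+x. nu k (flat_ball (c * r) (x ` {1..?m})) * nu k (flat_ball (c * r) (x ` {?m..?n})) \<partial>iid_law ?n (c * r) \<Theta>) =
    (\<integral>\<^sup>+x. ennreal (c ^ (2 * k)) * (nu k (flat_ball r (x ` {1..?m})) * nu k (flat_ball r (x ` {?m..?n}))) \<partial>iid_law ?n r \<Theta>)"
  proof (subst gen)
    show "(\<lambda>x. nu k (flat_ball (c * r) (x ` {1..?m})) * nu k (flat_ball (c * r) (x ` {?m..?n}))) \<in> borel_measurable (iid_law ?n (c * r) \<Theta>)"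
      unfolding B.iid_law_eq by measurable
    have "ennreal (c ^ (2 * k)) = ennreal (c ^ k) * ennreal (c ^ k)"
      using c by (simp add: ennreal_mult'[symmetric] power_add[symmetric] mult_2)
    note sq = this
    show "(\<integral>\<^sup>+x. nu k (flat_ball (c * r) (compose {1..?n} ?s x ` {1..?m})) * nu k (flat_ball (c * r) (compose {1..?n} ?s x ` {?m..?n})) \<partial>iid_law ?n r \<Theta>)
      = (\<integral>\<^sup>+x. ennreal (c ^ (2 * k)) * (nu k (flat_ball r (x ` {1..?m})) * nu k (flat_ball r (x ` {?m..?n}))) \<partial>iid_law ?n r \<Theta>)"
      unfolding fl[OF sub(1)] fl[OF sub(2)] nu_scaleR[OF c] sq by (simp only: mult_ac)
  qed
  also have "\<dots> = ennreal (c ^ (2 * k)) * (\<integral>\<^sup>+x. nu k (flat_ball r (x ` {1..?m})) * nu k (flat_ball r (x ` {?m..?n})) \<partial>iid_law ?n r \<Theta>)"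
    unfolding A.iid_law_eq by (rule nn_integral_cmult) measurable
  finally show "sigma_nu k (c * r) \<Theta> = sigma_nu k r \<Theta>"
    using c r by (simp add: sigma_nu_def INT_hyperplane enn2real_mult power_mult_distrib)
qed

section \<open>Sums over index tuples\<close>

text \<open>An unordered sum in \<open>ennreal\<close> is the supremum of its finite partial sums,
  and a countable index set has only countably many finite subsets.\<close>

lemma borel_measurable_infsum_ennreal:
  fixes f :: "'i \<Rightarrow> 'w \<Rightarrow> ennreal"
  assumes A: "countable A" and f: "\<And>a. a \<in> A \<Longrightarrow> f a \<in> borel_measurable M"
  shows "(\<lambda>\<omega>. \<Sum>\<^sub>\<infinity>a\<in>A. f a \<omega>) \<in> borel_measurable M"
proof -
  have "(\<lambda>\<omega>. \<Sum>\<^sub>\<infinity>a\<in>A. f a \<omega>) = (\<lambda>\<omega>. SUP F\<in>{F. finite F \<and> F \<subseteq> A}. \<Sum>a\<in>F. f a \<omega>)"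
    by (intro ext nonneg_infsum_complete) simp
  also have "\<dots> \<in> borel_measurable M"
    using f by (intro borel_measurable_SUP countable_Collect_finite_subset A borel_measurable_sum) auto
  finally show ?thesis .
qed

text \<open>Each m-set has m! orderings, which will cancel the factor 1 / m! of the flat
  sums.\<close>

lemma infsum_index_tuples:
  fixes \<phi> :: "nat set \<Rightarrow> ennreal"
  assumes A: "finite A" and zero: "\<And>J. finite J \<Longrightarrow> \<not> J \<subseteq> A \<Longrightarrow> \<phi> J = 0"
  shows "(\<Sum>\<^sub>\<infinity>js\<in>index_tuples m. \<phi> (set js)) = fact m * (\<Sum>J | J \<subseteq> A \<and> card J = m. \<phi> J)"
proof -
  let ?T = "{js. set js \<subseteq> A \<and> length js = m \<and> distinct js}"
  let ?J = "{J. J \<subseteq> A \<and> card J = m}"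
  have T: "finite ?T" by (rule finite_subset[OF _ finite_lists_length_eq[OF A, of m]]) auto
  have "(\<Sum>\<^sub>\<infinity>js\<in>index_tuples m. \<phi> (set js)) = (\<Sum>\<^sub>\<infinity>js\<in>?T. \<phi> (set js))"
    using zero by (intro infsum_cong_neutral) (auto simp: index_tuples_def)
  also have "\<dots> = (\<Sum>js\<in>?T. \<phi> (set js))" using T by simp
  also have "\<dots> = (\<Sum>J\<in>?J. \<Sum>js\<in>{js\<in>?T. set js = J}. \<phi> (set js))"
    using T A by (intro sum.group[symmetric]) (auto simp: distinct_card)
  also have "\<dots> = (\<Sum>J\<in>?J. fact m * \<phi> J)"
  proof (rule sum.cong)
    fix J assume J: "J \<in> ?J"
    then have "finite J" using A by (auto intro: finite_subset)
    have eq: "{js\<in>?T. set js = J} = permutations_of_set J"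
      using J by (auto simp: permutations_of_set_def distinct_card)
    have "(\<Sum>js\<in>{js\<in>?T. set js = J}. \<phi> (set js)) = (\<Sum>js\<in>permutations_of_set J. \<phi> J)"
      unfolding eq by (rule sum.cong) (auto simp: permutations_of_set_def)
    then show "(\<Sum>js\<in>{js\<in>?T. set js = J}. \<phi> (set js)) = fact m * \<phi> J"
      using J \<open>finite J\<close> by simp
  qed simp
  finally show ?thesis by (simp add: sum_distrib_left)
qed

section \<open>From flat sums to U-statistics\<close>

context poisson_window
begin

text \<open>The result is real and bounded everywhere, as \<open>kernel\<close> demands, whereas the
  volume can be infinite for degenerate families. In the uses below, values above \<open>C\<close>
  have probability 0, so replacing them by 0 alters nothing almost surely.\<close>

definition trunc :: "('a set \<Rightarrow> ennreal) \<Rightarrow> real \<Rightarrow> 'a set \<Rightarrow> real"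
  where "trunc \<Phi> C Y = (if \<Phi> Y \<le> ennreal C then enn2real (\<Phi> Y) else 0)"

text \<open>The common form of \<open>Psi\<close> and \<open>zeta\<close>.\<close>

definition flatsum :: "('a set \<Rightarrow> ennreal) \<Rightarrow> nat \<Rightarrow> 'w \<Rightarrow> real"
  where "flatsum \<Phi> m \<omega> = 1 / fact m * enn2real (\<Sum>\<^sub>\<infinity>js\<in>index_tuples m. \<Phi> (img (set js) \<omega>))"

context
  fixes \<Phi> :: "'a set \<Rightarrow> ennreal" and m :: nat and C :: real
  assumes C: "0 \<le> C"
    and meas: "\<And>J :: nat set. finite J \<Longrightarrow> card J = m \<Longrightarrow> (\<lambda>x. \<Phi> (x ` J)) \<in> borel_measurable (PiM J (\<lambda>_. Q))"
    and bound: "\<And>J :: nat set. finite J \<Longrightarrow> card J = m \<Longrightarrow> AE x in PiM J (\<lambda>_. Q). \<Phi> (x ` J) \<le> ennreal C"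
    and window: "\<And>J \<omega>. \<omega> \<in> space M \<Longrightarrow> \<not> J \<subseteq> idx \<omega> \<Longrightarrow> \<Phi> (img J \<omega>) = 0"
begin

lemma kernel_trunc: "kernel m C (trunc \<Phi> C)"
  unfolding kernel_def
proof (intro conjI allI impI)
  fix Y
  show "0 \<le> trunc \<Phi> C Y" by (simp add: trunc_def)
  show "trunc \<Phi> C Y \<le> C" using C enn2real_mono[of "\<Phi> Y" "ennreal C"] by (auto simp: trunc_def)
next
  fix J :: "nat set" assume J: "finite J \<and> card J = m"
  then have [measurable]: "(\<lambda>x. \<Phi> (x ` J)) \<in> borel_measurable (PiM J (\<lambda>_. Q))" by (simp add: meas)
  show "(\<lambda>x. trunc \<Phi> C (x ` J)) \<in> borel_measurable (PiM J (\<lambda>_. Q))" unfolding trunc_def[abs_def] by measurable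
qed

text \<open>The Campbell formula is applied to the indicator of values above \<open>C\<close>: the
  expected number of bad tuples is t^m times the measure of a null set. This carries the bound from
  independent samples to the points of the process.\<close>

lemma AE_trunc: "AE \<omega> in M. \<forall>J. J \<subseteq> idx \<omega> \<and> card J = m \<longrightarrow> \<Phi> (img J \<omega>) = ennreal (trunc \<Phi> C (img J \<omega>))"
proof -
  let ?I = "{..<m}"
  let ?h = "\<lambda>x. if \<Phi> (x ` ?I) \<le> ennreal C then 0 else 1 :: ennreal"
  have [measurable]: "(\<lambda>x. \<Phi> (x ` ?I)) \<in> borel_measurable (PiM ?I (\<lambda>_. Q))" by (rule meas) auto
  have h [measurable]: "?h \<in> borel_measurable (PiM ?I (\<lambda>_. Q))" by measurable
  let ?S = "\<lambda>\<omega>. \<Sum>js\<in>inj_tuples ?I (pts \<omega>). ?h (\<lambda>i\<in>?I. X (js i) \<omega>)"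
  have "(\<integral>\<^sup>+\<omega>. ?S \<omega> \<partial>M) = (\<integral>\<^sup>+\<omega>. (\<Sum>js\<in>inj_tuples ?I (idx \<omega>). ?h (\<lambda>i\<in>?I. X (js i) \<omega>)) \<partial>M)"
    using AE_pts by (intro nn_integral_cong_AE) auto
  also have "\<dots> = ennreal t ^ card ?I * (\<integral>\<^sup>+x. ?h x \<partial>PiM ?I (\<lambda>_. Q))"
    by (rule campbell[OF _ h]) simp
  also have "(\<integral>\<^sup>+x. ?h x \<partial>PiM ?I (\<lambda>_. Q)) = (\<integral>\<^sup>+x. 0 \<partial>PiM ?I (\<lambda>_. Q))"
    using bound[of ?I] by (intro nn_integral_cong_AE) auto
  finally have "(\<integral>\<^sup>+\<omega>. ?S \<omega> \<partial>M) = 0" by simp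
  moreover have "?S \<in> borel_measurable M"
  proof (rule fun_pts_measurable)
    fix A :: "nat set"
    show "(\<lambda>\<omega>. \<Sum>js\<in>inj_tuples ?I A. ?h (\<lambda>i\<in>?I. X (js i) \<omega>)) \<in> borel_measurable M"
      by (intro borel_measurable_sum measurable_compose[OF _ h] measurable_restrict) simp
  qed
  ultimately have "AE \<omega> in M. ?S \<omega> = 0" by (simp add: nn_integral_0_iff_AE)
  with AE_pts AE_finite_idx show ?thesis
  proof eventually_elim
    case (elim \<omega>)
    show ?case
    proof (intro allI impI)
      fix J assume J: "J \<subseteq> idx \<omega> \<and> card J = m"
      then have "finite J" using elim by (auto intro: finite_subset)
      then obtain f where f: "bij_betw f ?I J"
        using J ex_bij_betw_nat_finite[of J] by (auto simp: lessThan_atLeast0)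
      define js where "js = restrict f ?I"
      have js: "js \<in> inj_tuples ?I (idx \<omega>)" "js ` ?I = J"
        using f J by (auto simp: js_def inj_tuples_def bij_betw_def inj_on_def)
      have "?S \<omega> = 0" using elim by blast
      then have "\<forall>js\<in>inj_tuples ?I (pts \<omega>). ?h (\<lambda>i\<in>?I. X (js i) \<omega>) = 0"
        by (simp only: sum_eq_0_iff[OF finite_inj_tuples[OF finite_lessThan finite_pts]])
      moreover have "js \<in> inj_tuples ?I (pts \<omega>)" using js(1) elim by simp
      ultimately have "?h (\<lambda>i\<in>?I. X (js i) \<omega>) = 0" by (rule bspec)
      moreover have "(\<lambda>i\<in>?I. X (js i) \<omega>) ` ?I = img J \<omega>"
        unfolding img_def js(2)[symmetric] image_image by (rule image_cong) auto
      ultimately have "\<Phi> (img J \<omega>) \<le> ennreal C" by (auto split: if_splits)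
      then show "\<Phi> (img J \<omega>) = ennreal (trunc \<Phi> C (img J \<omega>))"
        by (simp add: trunc_def) (metis ennreal_enn2real ennreal_less_top le_less_trans)
    qed
  qed
qed

lemma flatsum_measurable [measurable]: "flatsum \<Phi> m \<in> borel_measurable M"
proof -
  have "(\<lambda>\<omega>. \<Phi> (img (set js) \<omega>)) \<in> borel_measurable M" if "js \<in> index_tuples m" for js
  proof -
    have J: "finite (set js)" "card (set js) = m" using that by (auto simp: index_tuples_def distinct_card)
    have "(\<lambda>\<omega>. \<lambda>i\<in>set js. X i \<omega>) \<in> measurable M (PiM (set js) (\<lambda>_. Q))" by (rule measurable_restrict) simp
    from measurable_compose[OF this meas[OF J]] show ?thesis by (simp add: img_def)
  qed
  then have "(\<lambda>\<omega>. \<Sum>\<^sub>\<infinity>js\<in>index_tuples m. \<Phi> (img (set js) \<omega>)) \<in> borel_measurable M"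
    by (intro borel_measurable_infsum_ennreal) auto
  then show ?thesis unfolding flatsum_def[abs_def] by measurable
qed

text \<open>Families with an index outside the window contribute 0, so the infinite sum reduces to
  the subsets of the finitely many indices in the window.\<close>

lemma flatsum_eq_ustat: "AE \<omega> in M. flatsum \<Phi> m \<omega> = ustat m (trunc \<Phi> C) \<omega>"
  using AE_trunc AE_finite_idx AE_pts AE_space
proof eventually_elim
  case (elim \<omega>)
  have "(\<Sum>\<^sub>\<infinity>js\<in>index_tuples m. \<Phi> (img (set js) \<omega>)) = fact m * (\<Sum>J | J \<subseteq> idx \<omega> \<and> card J = m. \<Phi> (img J \<omega>))"
    using elim by (intro infsum_index_tuples window) auto
  also have "(\<Sum>J | J \<subseteq> idx \<omega> \<and> card J = m. \<Phi> (img J \<omega>)) = (\<Sum>J | J \<subseteq> idx \<omega> \<and> card J = m. ennreal (trunc \<Phi> C (img J \<omega>)))"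
    using elim by (intro sum.cong) auto
  also have "\<dots> = ennreal (ustat m (trunc \<Phi> C) \<omega>)"
    using kernel_bound[OF kernel_trunc] elim by (subst sum_ennreal) (auto simp: ustat_def)
  also have "fact m * ennreal (ustat m (trunc \<Phi> C) \<omega>) = ennreal (fact m * ustat m (trunc \<Phi> C) \<omega>)"
    using ustat_bound(1)[OF kernel_trunc, of \<omega>]
    by (subst ennreal_mult) (auto, metis ennreal_of_nat_eq_real_of_nat of_nat_fact)
  finally show ?case
    using ustat_bound(1)[OF kernel_trunc] by (simp add: flatsum_def)
qed

lemma sigma_trunc:
  assumes m: "1 \<le> m"
  shows "(\<integral>x. trunc \<Phi> C (x ` {1..m}) * trunc \<Phi> C (x ` {m..2*m-1}) \<partial>PiM {1..2*m-1} (\<lambda>_. Q)) =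
    enn2real (\<integral>\<^sup>+x. \<Phi> (x ` {1..m}) * \<Phi> (x ` {m..2*m-1}) \<partial>PiM {1..2*m-1} (\<lambda>_. Q))"
proof -
  let ?P = "PiM {1..2*m-1} (\<lambda>_. Q)"
  have AE: "AE x in ?P. \<Phi> (x ` J) = ennreal (trunc \<Phi> C (x ` J))" if J: "J \<subseteq> {1..2*m-1}" "card J = m" for J
  proof -
    interpret PP: product_prob_space "\<lambda>_::nat. Q" "{1..2*m-1}" ..
    have fin: "finite J" using J by (auto intro: finite_subset)
    \<comment> \<open>The coordinates in \<open>J\<close> of the longer sample are distributed as a
      sample over \<open>J\<close>, so the almost sure bound carries over.\<close>
    have "AE x in distr ?P (PiM J (\<lambda>_. Q)) (\<lambda>x. restrict x J). \<Phi> (x ` J) \<le> ennreal C"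
      using bound[OF fin J(2)] J fin by (subst PP.distr_restrict[symmetric]) auto
    then have "AE x in ?P. \<Phi> (restrict x J ` J) \<le> ennreal C"
      by (rule AE_distrD[OF measurable_restrict_subset[OF J(1)]])
    then show ?thesis
      by eventually_elim (simp add: trunc_def, metis ennreal_enn2real ennreal_less_top le_less_trans)
  qed
  have [measurable]: "(\<lambda>x. trunc \<Phi> C (x ` {1..m})) \<in> borel_measurable ?P" "(\<lambda>x. trunc \<Phi> C (x ` {m..2*m-1})) \<in> borel_measurable ?P"
    using m by (auto intro!: kernel_measurable[OF kernel_trunc])
  have "(\<integral>x. trunc \<Phi> C (x ` {1..m}) * trunc \<Phi> C (x ` {m..2*m-1}) \<partial>?P) =
    enn2real (\<integral>\<^sup>+x. ennreal (trunc \<Phi> C (x ` {1..m}) * trunc \<Phi> C (x ` {m..2*m-1})) \<partial>?P)"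
  proof (rule integral_eq_nn_integral)
    show "(\<lambda>x. trunc \<Phi> C (x ` {1..m}) * trunc \<Phi> C (x ` {m..2*m-1})) \<in> borel_measurable ?P" by measurable
  qed (use kernel_bound[OF kernel_trunc] in auto)
  also have "(\<integral>\<^sup>+x. ennreal (trunc \<Phi> C (x ` {1..m}) * trunc \<Phi> C (x ` {m..2*m-1})) \<partial>?P) =
    (\<integral>\<^sup>+x. \<Phi> (x ` {1..m}) * \<Phi> (x ` {m..2*m-1}) \<partial>?P)"
  proof (rule nn_integral_cong_AE)
    have "AE x in ?P. \<Phi> (x ` {1..m}) = ennreal (trunc \<Phi> C (x ` {1..m}))" "AE x in ?P. \<Phi> (x ` {m..2*m-1}) = ennreal (trunc \<Phi> C (x ` {m..2*m-1}))"
      using m by (auto intro!: AE)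
    then show "AE x in ?P. ennreal (trunc \<Phi> C (x ` {1..m}) * trunc \<Phi> C (x ` {m..2*m-1})) = \<Phi> (x ` {1..m}) * \<Phi> (x ` {m..2*m-1})"
      by eventually_elim (simp add: ennreal_mult kernel_bound[OF kernel_trunc])
  qed
  finally show ?thesis .
qed

text \<open>The flat sum and the U-statistic of the truncated kernel are almost surely equal and
  hence have the same expectation, so \<open>char_ustat\<close> applies; the variance is expressed
  through \<Phi> itself.\<close>

theorem char_flatsum:
  assumes m: "1 \<le> m" and t1: "1 \<le> t"
  shows "cmod (char (distr M borel (\<lambda>\<omega>. fact (m-1) / t powr (real m - 1/2) * (flatsum \<Phi> m \<omega> - expectation (flatsum \<Phi> m)))) u -
      exp (- (u^2 * enn2real (\<integral>\<^sup>+x. \<Phi> (x ` {1..m}) * \<Phi> (x ` {m..2*m-1}) \<partial>PiM {1..2*m-1} (\<lambda>_. Q)) / 2)))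
    \<le> (\<bar>u\<bar> * (fact (m-1) * sqrt (C^2 * 16^m * (2^(2*m-2) + (2 * real (2*m-2))^(2*m-2)))) + \<bar>u\<bar>^3 * C^3 / 6) / sqrt t"
  unfolding sigma_trunc[OF m, symmetric]
proof (rule char_ustat[OF kernel_trunc m t1])
  have e: "expectation (flatsum \<Phi> m) = expectation (ustat m (trunc \<Phi> C))"
    using flatsum_eq_ustat ustat_measurable[OF kernel_trunc] by (intro integral_cong_AE) auto
  show "AE \<omega> in M. fact (m-1) / t powr (real m - 1/2) * (flatsum \<Phi> m \<omega> - expectation (flatsum \<Phi> m)) =
      fact (m-1) / t powr (real m - 1/2) * (ustat m (trunc \<Phi> C) \<omega> - expectation (ustat m (trunc \<Phi> C)))"
    using flatsum_eq_ustat by eventually_elim (simp add: e)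
qed measurable

end

end

section \<open>The central limit theorem\<close>

text \<open>Halving the intervals gives nested cells: the integer part of 2x determines that of x.
  Negative arguments, which \<open>nat\<close> sends to 0, occur because nestedness is demanded of
  all points and not only of those in the window.\<close>

lemma nat_floor_double:
  fixes a b :: real
  assumes "nat \<lfloor>2 * a\<rfloor> = nat \<lfloor>2 * b\<rfloor>" shows "nat \<lfloor>a\<rfloor> = nat \<lfloor>b\<rfloor>"
proof (cases "0 < nat \<lfloor>2 * b\<rfloor>")
  case True
  then have "\<lfloor>2 * a\<rfloor> = \<lfloor>2 * b\<rfloor>" using assms by linarith
  moreover have "\<lfloor>2 * x\<rfloor> = 2 * \<lfloor>x\<rfloor> \<or> \<lfloor>2 * x\<rfloor> = 2 * \<lfloor>x\<rfloor> + 1" for x :: real by linarith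
  ultimately have "\<lfloor>a\<rfloor> = \<lfloor>b\<rfloor>" by (metis even_add even_mult_iff even_numeral odd_one add_right_cancel mult_cancel_left zero_neq_numeral)
  then show ?thesis by simp
next
  case False
  then have "\<lfloor>2 * a\<rfloor> \<le> 0" "\<lfloor>2 * b\<rfloor> \<le> 0" using assms by auto
  then have "\<lfloor>a\<rfloor> \<le> 0" "\<lfloor>b\<rfloor> \<le> 0" by linarith+
  then show ?thesis by simp
qed

context window_law
begin

definition window :: "(real \<times> (real, 'n) vec) set" where "window = {-r..r} \<times> half_sphere"

text \<open>A dyadic subdivision of the distance alone: the law of the distance has no atoms, so the
  strips become small whatever the law of the normals is. The right end of the window gets the
  number 2^n.\<close>

definition cells :: "nat \<Rightarrow> real \<times> (real, 'n) vec \<Rightarrow> nat"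
  where "cells n x = nat \<lfloor>2 ^ n * ((fst x + r) / (2 * r))\<rfloor>"

lemma window_sets [measurable]: "window \<in> sets Q"
proof -
  have "{-r..r} \<times> space \<Theta> \<in> sets Q" unfolding Q_def by (intro pair_measureI) auto
  then show ?thesis by (simp add: window_def space_Theta)
qed

lemma prob_strip_le:
  assumes "a \<le> b" "{a..b} \<inter> {-r..r} \<subseteq> {c..d}" "c \<le> d"
  shows "Q.prob ({a..b} \<times> space \<Theta>) \<le> (d - c) / (2 * r)"
proof -
  have "emeasure Q ({a..b} \<times> space \<Theta>) = emeasure U {a..b} * 1"
    unfolding Q_def by (subst emeasure_pair_measure_Times) (auto simp: emeasure_space_1)
  also have "\<dots> = emeasure lborel ({-r..r} \<inter> {a..b}) / ennreal (2 * r)"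
    using r by (simp add: U_def)
  also have "\<dots> \<le> emeasure lborel {c..d} / ennreal (2 * r)"
    using assms by (intro divide_right_mono_ennreal emeasure_mono) auto
  also have "\<dots> = ennreal ((d - c) / (2 * r))"
    using assms r by (simp add: divide_ennreal)
  finally show ?thesis
    using assms r by (simp add: Q.emeasure_eq_measure)
qed

lemma AE_window: "AE x in Q. x \<in> window"
proof -
  have "emeasure Q ({-r..r} \<times> space \<Theta>) = emeasure U {-r..r} * 1"
    unfolding Q_def by (subst emeasure_pair_measure_Times) (auto simp: emeasure_space_1)
  also have "\<dots> = ennreal (2 * r) / ennreal (2 * r)" using r by (simp add: U_def)
  also have "\<dots> = 1" using r by (simp add: divide_ennreal)
  finally have "Q.prob window = 1"
    by (simp add: window_def space_Theta Q.emeasure_eq_measure)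
  then show ?thesis using window_sets by (simp add: Q.prob_eq_1)
qed

text \<open>Inside the window Lebesgue measure is 2r times the uniform law; with the factor \<gamma>
  the intensity measure becomes t Q for t = 2 \<gamma> r.\<close>

lemma emeasure_window:
  assumes B: "B \<in> sets Q" "B \<subseteq> window"
  shows "emeasure (lborel \<Otimes>\<^sub>M \<Theta>) B = ennreal (2 * r * Q.prob B)"
proof -
  have B': "B \<in> sets (lborel \<Otimes>\<^sub>M \<Theta>)" "B \<in> sets (U \<Otimes>\<^sub>M \<Theta>)"
    using B(1) sets_pair_measure_cong[of U lborel \<Theta> \<Theta>] by (auto simp: Q_def)
  have m: "(\<lambda>p. emeasure \<Theta> (Pair p -` B)) \<in> borel_measurable lborel"
    by (rule measurable_emeasure_Pair[OF B'(1)])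
  have "emeasure Q B = (\<integral>\<^sup>+p. emeasure \<Theta> (Pair p -` B) \<partial>U)"
    unfolding Q_def by (rule emeasure_pair_measure_alt[OF B'(2)])
  also have "\<dots> = (\<integral>\<^sup>+p. emeasure \<Theta> (Pair p -` B) * indicator {-r..r} p \<partial>lborel) / ennreal (2 * r)"
    using m r unfolding U_def by (subst nn_integral_uniform_measure) auto
  also have "(\<integral>\<^sup>+p. emeasure \<Theta> (Pair p -` B) * indicator {-r..r} p \<partial>lborel) = (\<integral>\<^sup>+p. emeasure \<Theta> (Pair p -` B) \<partial>lborel)"
  proof (rule nn_integral_cong)
    fix p :: real
    have "Pair p -` B = {}" if "p \<notin> {-r..r}" using that B(2) by (auto simp: window_def)
    then show "emeasure \<Theta> (Pair p -` B) * indicator {-r..r} p = emeasure \<Theta> (Pair p -` B)"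
      by (cases "p \<in> {-r..r}") auto
  qed
  also have "\<dots> = emeasure (lborel \<Otimes>\<^sub>M \<Theta>) B"
    by (rule emeasure_pair_measure_alt[OF B'(1), symmetric])
  finally have "emeasure (lborel \<Otimes>\<^sub>M \<Theta>) B = ennreal (2 * r) * emeasure Q B"
    using r by (simp add: ennreal_times_divide ennreal_mult_divide_eq mult.commute)
  then show ?thesis using r by (simp add: Q.emeasure_eq_measure ennreal_mult)
qed

lemma poisson_window_hyperplanes:
  assumes P: "poisson_hyperplane_process M X \<gamma> \<Theta>" and \<gamma>: "0 < \<gamma>"
  shows "poisson_window M Q X window (2 * \<gamma> * r) cells"
proof -
  let ?\<mu> = "scale_measure (ennreal \<gamma>) (lborel \<Otimes>\<^sub>M \<Theta>)"
  have PP: "poisson_process M X ?\<mu>" using P by (simp add: poisson_hyperplane_process_def)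
  have sets: "sets ?\<mu> = sets Q" unfolding Q_def by (simp cong: sets_pair_measure_cong)
  interpret M: prob_space M using PP by (simp add: poisson_process_def)
  show ?thesis
  proof (unfold_locales)
    show "X i \<in> measurable M Q" for i
      using PP measurable_cong_sets[OF refl sets] by (auto simp: poisson_process_def)
    show "window \<in> Q.events" by (rule window_sets)
    show "AE x in Q. x \<in> window" by (rule AE_window)
    show "0 < 2 * \<gamma> * r" using \<gamma> r by simp
    fix n :: nat
    show "cells n \<in> measurable Q (count_space UNIV)" unfolding cells_def[abs_def] by measurable
    show "cells n x = cells n y" if "cells (Suc n) x = cells (Suc n) y" for x y
      using that unfolding cells_def power_Suc mult.assoc by (rule nat_floor_double)
    show "cells n x \<le> 2 ^ n" if "x \<in> window" for x
    proof -
      have "(fst x + r) / (2 * r) \<le> 1" using that r by (auto simp: window_def)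
      then have "2 ^ n * ((fst x + r) / (2 * r)) \<le> 2 ^ n * (1 :: real)" by (intro mult_left_mono) auto
      then have "\<lfloor>2 ^ n * ((fst x + r) / (2 * r))\<rfloor> \<le> \<lfloor>(2 ^ n :: real)\<rfloor>" by (intro floor_mono) simp
      then show ?thesis by (simp add: cells_def nat_le_iff)
    qed
    show "Q.prob {x \<in> space Q. x \<in> window \<and> cells n x = c} \<le> 1 / 2 ^ n" for c
    proof -
      \<comment> \<open>The width of a strip of level n; the cell with number c lies between c w - r
        and (c + 1) w - r.\<close>
      define w where "w = 2 * r / 2 ^ n"
      have w: "0 < w" using r by (simp add: w_def)
      let ?a = "real c * w - r"
      have "{x \<in> space Q. x \<in> window \<and> cells n x = c} \<subseteq> {?a..?a + w} \<times> space \<Theta>"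
      proof safe
        fix p v assume x: "(p, v) \<in> window" "c = cells n (p, v)"
        have "0 \<le> (p + r) / w" using x w by (auto simp: window_def)
        moreover have "2 ^ n * ((p + r) / (2 * r)) = (p + r) / w" using r by (simp add: w_def)
        ultimately have "real c \<le> (p + r) / w" "(p + r) / w \<le> real c + 1"
          using x(2) by (auto simp: cells_def)
        then show "p \<in> {real (cells n (p, v)) * w - r..real (cells n (p, v)) * w - r + w}"
          using w x(2) by (auto simp: field_simps)
        show "v \<in> space \<Theta>" using x by (auto simp: window_def space_Theta)
      qed
      then have "Q.prob {x \<in> space Q. x \<in> window \<and> cells n x = c} \<le> Q.prob ({?a..?a + w} \<times> space \<Theta>)"
        by (intro Q.finite_measure_mono) (auto simp: Q_def intro!: pair_measureI)
      also have "\<dots> \<le> (?a + w - ?a) / (2 * r)" using w by (intro prob_strip_le) auto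
      also have "\<dots> = 1 / 2 ^ n" using r by (simp add: w_def)
      finally show ?thesis .
    qed
  next
    fix B and n :: nat assume B: "B \<in> Q.events" "B \<subseteq> window"
    have "emeasure ?\<mu> B = ennreal (2 * \<gamma> * r * Q.prob B)"
      using \<gamma> r by (simp add: emeasure_window[OF B] ennreal_mult'[symmetric] mult_ac)
    then have "emeasure ?\<mu> B < \<infinity>" "measure ?\<mu> B = 2 * \<gamma> * r * Q.prob B"
      using \<gamma> r by (auto simp: measure_def)
    then show "M.prob {\<omega> \<in> space M. point_count X B \<omega> = of_nat n} =
      (2 * \<gamma> * r * Q.prob B) ^ n / fact n * exp (- (2 * \<gamma> * r * Q.prob B))"
      using PP B(1) sets by (auto simp: poisson_process_def)
  next
    fix B :: "nat \<Rightarrow> (real \<times> (real, 'n) vec) set"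
    assume "range B \<subseteq> Q.events" "disjoint_family B"
    then show "M.indep_vars (\<lambda>_. borel) (\<lambda>j. point_count X (B j)) UNIV"
      using PP sets by (auto simp: poisson_process_def)
  qed
qed

text \<open>By Cauchy-Schwarz, a hyperplane with unit normal and |p| > r misses the ball. This
  confines the sums over all tuples to the points in the window.\<close>

lemma flat_ball_outside:
  assumes "x \<in> Y" "x \<in> space Q" "x \<notin> window"
  shows "flat_ball r Y = {}"
proof (rule ccontr)
  assume "flat_ball r Y \<noteq> {}"
  then obtain z where "z \<in> flat_ball r Y" by blast
  then have z: "z \<bullet> snd x = fst x" "norm z \<le> r" using assms(1) by (auto simp: mem_flat_ball)
  have "norm (snd x) = 1" using assms(2) by (auto simp: space_Q half_sphere_def)
  then have "\<bar>fst x\<bar> \<le> r" using Cauchy_Schwarz_ineq2[of z "snd x"] z by simp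
  then have "x \<in> window" using assms(2) by (cases x) (auto simp: window_def space_Q)
  with assms(3) show False ..
qed

lemma chi_flat_ball_le: "chi (flat_ball r Y) \<le> ennreal 1"
  by (simp add: chi_def)

end

theorem theorem4p1:
  fixes M :: "'w measure"
    and X :: "nat \<Rightarrow> 'w \<Rightarrow> real \<times> (real ^ 'n::{finite,linorder})"
    and \<Theta> :: "(real ^ 'n::{finite,linorder}) measure"
    and \<gamma> \<rho> :: real
    and k :: nat
  assumes "\<gamma> > 0"
    and "spherical_distribution \<Theta>"
    and "nondegenerate \<Theta>"
    and "poisson_hyperplane_process M X \<gamma> \<Theta>"
    and "k < CARD('n)"
    and "\<rho> > 0"
  shows "converges_in_distribution M (Z_chi k M X \<gamma>) (gaussian 0 (sigma_chi k \<rho> \<Theta>))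
       \<and> converges_in_distribution M (Z_nu k M X \<gamma>) (gaussian 0 (sigma_nu k \<rho> \<Theta>))"
proof -
  define m where "m = CARD('n) - k"
  have m1: "1 \<le> m" and n2: "2 * m - 1 = 2 * CARD('n) - 2 * k - 1"
    and mr: "real CARD('n) - real k = real m"
    using \<open>k < CARD('n)\<close> by (auto simp: m_def of_nat_diff)
  have kn: "k \<le> CARD('n)" using \<open>k < CARD('n)\<close> by simp
  interpret M: prob_space M
    using assms(4) by (simp add: poisson_hyperplane_process_def poisson_process_def)
  have WL: "window_law \<Theta> r" if "0 < r" for r
    using that assms(2) by (simp add: window_law_def window_law_axioms_def spherical_distribution_def)
  have sig: "sigma_chi k r \<Theta> = sigma_chi k \<rho> \<Theta>" "sigma_nu k r \<Theta> = sigma_nu k \<rho> \<Theta>" if "0 < r" for r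
    using sigma_scale[OF assms(2) \<open>\<rho> > 0\<close> _ \<open>k < CARD('n)\<close>, of "r / \<rho>"] that \<open>\<rho> > 0\<close> by auto
  \<comment> \<open>The constant of the remainder estimate; it is homogeneous in the kernel bound:
    \<open>D (\<kappa> * r^k) = r^k * D \<kappa>\<close>.\<close>
  define D where "D C = sqrt (C^2 * 16^m * (2^(2*m-2) + (2 * real (2*m-2))^(2*m-2)))" for C :: real
  \<comment> \<open>The bound of the volume kernel at radius 1, from (2k * 2r)^k = (4k)^k
    r^k.\<close>
  define \<kappa> where "\<kappa> = unit_ball_vol (real k) * (4 * real k) ^ k"
  have \<kappa>: "0 \<le> \<kappa>" by (simp add: \<kappa>_def)

  have chi: "Z_chi k M X \<gamma> r \<in> borel_measurable M \<and>
      (1 \<le> 2 * \<gamma> * r \<longrightarrow> cmod (char (distr M borel (Z_chi k M X \<gamma> r)) u - exp (- (u^2 * sigma_chi k \<rho> \<Theta> / 2)))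
        \<le> (\<bar>u\<bar> * (fact (m-1) * D 1) + \<bar>u\<bar>^3 * 1^3 / 6) / sqrt (2 * \<gamma> * r))" if r: "0 < r" for r u
  proof -
    interpret W: window_law \<Theta> r by (rule WL[OF r])
    interpret PW: poisson_window M W.Q X W.window "2 * \<gamma> * r" W.cells
      by (rule W.poisson_window_hyperplanes[OF assms(4,1)])
    let ?\<Phi> = "\<lambda>Y. chi (flat_ball r Y)"
    have img: "PW.img J \<omega> = (\<lambda>j. X j \<omega>) ` J" for J \<omega> by (simp add: PW.img_def)
    have meas: "(\<lambda>x. ?\<Phi> (x ` J)) \<in> borel_measurable (PiM J (\<lambda>_. W.Q))" for J :: "nat set" by measurable
    have bound: "AE x in PiM J (\<lambda>_. W.Q). ?\<Phi> (x ` J) \<le> ennreal 1" for J :: "nat set"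
      by (intro AE_I2 W.chi_flat_ball_le)
    have out: "?\<Phi> (PW.img J \<omega>) = 0" if \<omega>: "\<omega> \<in> space M" "\<not> J \<subseteq> PW.idx \<omega>" for J \<omega>
    proof -
      obtain j where "j \<in> J" "X j \<omega> \<notin> W.window" using \<omega>(2) by (auto simp: PW.idx_def)
      then show ?thesis
        using W.flat_ball_outside[of "X j \<omega>" "PW.img J \<omega>"] measurable_space[OF PW.X \<omega>(1)]
        by (auto simp: chi_def img)
    qed
    have Psi: "Psi k X r = PW.flatsum ?\<Phi> m"
      unfolding Psi_def[abs_def] PW.flatsum_def[abs_def] INT_hyperplane img m_def ..
    have Z: "Z_chi k M X \<gamma> r = (\<lambda>\<omega>. fact (m-1) / (2 * \<gamma> * r) powr (real m - 1/2) * (PW.flatsum ?\<Phi> m \<omega> - M.expectation (PW.flatsum ?\<Phi> m)))"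
      unfolding Z_chi_def[abs_def] Psi mr m_def[symmetric] ..
    have s: "sigma_chi k \<rho> \<Theta> = enn2real (\<integral>\<^sup>+x. ?\<Phi> (x ` {1..m}) * ?\<Phi> (x ` {m..2*m-1}) \<partial>PiM {1..2*m-1} (\<lambda>_. W.Q))"
      unfolding sig(1)[OF r, symmetric] unfolding sigma_chi_def INT_hyperplane W.iid_law_eq n2 m_def[symmetric] ..
    show ?thesis
    proof (intro conjI impI)
      show "Z_chi k M X \<gamma> r \<in> borel_measurable M"
        unfolding Z using PW.flatsum_measurable[of 1 m ?\<Phi>, OF _ meas bound out] by measurable
      assume t1: "1 \<le> 2 * \<gamma> * r"
      show "cmod (char (distr M borel (Z_chi k M X \<gamma> r)) u - exp (- (u^2 * sigma_chi k \<rho> \<Theta> / 2)))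
        \<le> (\<bar>u\<bar> * (fact (m-1) * D 1) + \<bar>u\<bar>^3 * 1^3 / 6) / sqrt (2 * \<gamma> * r)"
        unfolding Z s D_def by (rule PW.char_flatsum[OF _ meas bound out m1 t1]) auto
    qed
  qed

  have nu: "Z_nu k M X \<gamma> r \<in> borel_measurable M \<and>
      (1 \<le> 2 * \<gamma> * r \<longrightarrow> cmod (char (distr M borel (Z_nu k M X \<gamma> r)) u - exp (- (u^2 * sigma_nu k \<rho> \<Theta> / 2)))
        \<le> (\<bar>u\<bar> * (fact (m-1) * D \<kappa>) + \<bar>u\<bar>^3 * \<kappa>^3 / 6) / sqrt (2 * \<gamma> * r))" if r: "0 < r" for r u
  proof -
    interpret W: window_law \<Theta> r by (rule WL[OF r])
    interpret PW: poisson_window M W.Q X W.window "2 * \<gamma> * r" W.cells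
      by (rule W.poisson_window_hyperplanes[OF assms(4,1)])
    let ?\<Phi> = "\<lambda>Y. nu k (flat_ball r Y)"
    let ?C = "\<kappa> * r^k"
    have img: "PW.img J \<omega> = (\<lambda>j. X j \<omega>) ` J" for J \<omega> by (simp add: PW.img_def)
    have C: "0 \<le> ?C" using \<kappa> r by simp
    have meas: "(\<lambda>x. ?\<Phi> (x ` J)) \<in> borel_measurable (PiM J (\<lambda>_. W.Q))" for J :: "nat set" by measurable
    have bound: "AE x in PiM J (\<lambda>_. W.Q). ?\<Phi> (x ` J) \<le> ennreal ?C" if "finite J" "card J = m" for J :: "nat set"
      using W.AE_nu_flat_ball_bound[of J k] that kn
      by (simp add: m_def \<kappa>_def power_mult_distrib mult_ac)
    have out: "?\<Phi> (PW.img J \<omega>) = 0" if \<omega>: "\<omega> \<in> space M" "\<not> J \<subseteq> PW.idx \<omega>" for J \<omega>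
    proof -
      obtain j where "j \<in> J" "X j \<omega> \<notin> W.window" using \<omega>(2) by (auto simp: PW.idx_def)
      then show ?thesis
        using W.flat_ball_outside[of "X j \<omega>" "PW.img J \<omega>"] measurable_space[OF PW.X \<omega>(1)]
        by (auto simp: nu_empty img)
    qed
    have zeta: "zeta k X r = PW.flatsum ?\<Phi> m"
      unfolding zeta_def[abs_def] PW.flatsum_def[abs_def] INT_hyperplane img m_def ..
    let ?Z = "\<lambda>\<omega>. fact (m-1) / (2 * \<gamma> * r) powr (real m - 1/2) * (PW.flatsum ?\<Phi> m \<omega> - M.expectation (PW.flatsum ?\<Phi> m))"
    \<comment> \<open>The statistic without the factor r^(-k), in the form of the general estimate;
      the factor is moved into the argument u / r^k of the characteristic function.\<close>
    define Y where "Y = ?Z"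
    have Z: "Z_nu k M X \<gamma> r = (\<lambda>\<omega>. 1 / r^k * Y \<omega>)"
      unfolding Y_def Z_nu_def[abs_def] zeta mr m_def[symmetric] by (simp add: mult_ac)
    have [measurable]: "Y \<in> borel_measurable M"
      unfolding Y_def using PW.flatsum_measurable[of ?C m ?\<Phi>, OF C meas bound out] by measurable
    let ?s = "enn2real (\<integral>\<^sup>+x. ?\<Phi> (x ` {1..m}) * ?\<Phi> (x ` {m..2*m-1}) \<partial>PiM {1..2*m-1} (\<lambda>_. W.Q))"
    have s: "sigma_nu k \<rho> \<Theta> = 1 / r^(2*k) * ?s"
      unfolding sig(2)[OF r, symmetric] unfolding sigma_nu_def INT_hyperplane W.iid_law_eq n2 m_def[symmetric] ..
    show ?thesis
    proof (intro conjI impI)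
      show "Z_nu k M X \<gamma> r \<in> borel_measurable M" unfolding Z by measurable
      assume t1: "1 \<le> 2 * \<gamma> * r"
      have "char (distr M borel (Z_nu k M X \<gamma> r)) u = char (distr M borel Y) (u / r^k)"
      proof -
        have "(CLINT x|distr M borel (\<lambda>\<omega>. 1 / r^k * Y \<omega>). iexp (u * x)) = (CLINT \<omega>|M. iexp (u * (1 / r^k * Y \<omega>)))"
          by (rule integral_distr) measurable
        moreover have "(CLINT x|distr M borel Y. iexp (u / r^k * x)) = (CLINT \<omega>|M. iexp (u / r^k * Y \<omega>))"
          by (rule integral_distr) measurable
        moreover have "u * (1 / r^k * y) = u / r^k * y" for y by simp
        ultimately show ?thesis unfolding Z char_def by (simp only:)
      qed
      moreover have "u^2 * sigma_nu k \<rho> \<Theta> = (u / r^k)^2 * ?s"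
        unfolding s by (simp add: power_divide power_mult[symmetric] mult.commute)
      \<comment> \<open>The powers of r from the argument and from the kernel bound cancel, which
        leaves an error of order t^(-1/2) with a constant that is free of r.\<close>
      moreover have "(\<bar>u / r^k\<bar> * (fact (m-1) * D ?C) + \<bar>u / r^k\<bar>^3 * ?C^3 / 6) = \<bar>u\<bar> * (fact (m-1) * D \<kappa>) + \<bar>u\<bar>^3 * \<kappa>^3 / 6"
      proof -
        have "D ?C = r^k * D \<kappa>" using r by (simp add: D_def power_mult_distrib real_sqrt_mult)
        then show ?thesis using r by (simp add: power_mult_distrib power_divide)
      qed
      moreover have "cmod (char (distr M borel Y) (u / r^k) - exp (- ((u / r^k)^2 * ?s / 2)))
        \<le> (\<bar>u / r^k\<bar> * (fact (m-1) * D ?C) + \<bar>u / r^k\<bar>^3 * ?C^3 / 6) / sqrt (2 * \<gamma> * r)"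
        unfolding D_def Y_def by (rule PW.char_flatsum[OF C meas bound out m1 t1])
      ultimately show "cmod (char (distr M borel (Z_nu k M X \<gamma> r)) u - exp (- (u^2 * sigma_nu k \<rho> \<Theta> / 2)))
        \<le> (\<bar>u\<bar> * (fact (m-1) * D \<kappa>) + \<bar>u\<bar>^3 * \<kappa>^3 / 6) / sqrt (2 * \<gamma> * r)" by (simp only:)
    qed
  qed

  have conv: "converges_in_distribution M Z (gaussian 0 s)"
    if Z: "\<And>r. 0 < r \<Longrightarrow> Z r \<in> borel_measurable M" and s: "0 \<le> s"
      and bd: "\<And>r u. 0 < r \<Longrightarrow> 1 \<le> 2 * \<gamma> * r \<Longrightarrow> cmod (char (distr M borel (Z r)) u - exp (- (u^2 * s / 2))) \<le> K u / sqrt (2 * \<gamma> * r)"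
    for Z s and K :: "real \<Rightarrow> real"
  proof (rule converges_in_distribution_char[OF M.prob_space_axioms Z s])
    fix u
    have lim: "((\<lambda>r. K u / sqrt (2 * \<gamma> * r)) \<longlongrightarrow> 0) at_top"
      using \<open>\<gamma> > 0\<close> by real_asymp
    have "\<forall>\<^sub>F r in at_top. cmod (char (distr M borel (Z r)) u - exp (- (u^2 * s / 2))) \<le> K u / sqrt (2 * \<gamma> * r)"
      \<comment> \<open>The estimates hold for t \<ge> 1, that is for r \<ge> 1 / (2
        \<gamma>).\<close>
      using eventually_ge_at_top[of "1 / (2 * \<gamma>)"] eventually_gt_at_top[of 0]
    proof eventually_elim
      case (elim r)
      then have "1 \<le> 2 * \<gamma> * r" using \<open>\<gamma> > 0\<close> by (simp add: field_simps)
      then show ?case using elim by (intro bd)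
    qed
    then show "((\<lambda>r. char (distr M borel (Z r)) u) \<longlongrightarrow> exp (- (u^2 * s / 2))) at_top"
      by (rule LIM_zero_cancel[OF Lim_null_comparison[OF _ lim]])
  qed
  show ?thesis
  proof
    show "converges_in_distribution M (Z_chi k M X \<gamma>) (gaussian 0 (sigma_chi k \<rho> \<Theta>))"
    proof (rule conv)
      show "0 \<le> sigma_chi k \<rho> \<Theta>" by (simp add: sigma_chi_def)
    qed (use chi in blast)+
    show "converges_in_distribution M (Z_nu k M X \<gamma>) (gaussian 0 (sigma_nu k \<rho> \<Theta>))"
    proof (rule conv)
      show "0 \<le> sigma_nu k \<rho> \<Theta>" using \<open>\<rho> > 0\<close> by (simp add: sigma_nu_def)
    qed (use nu in blast)+
  qed
qed

end
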